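(* Let $\mu$ be an infinitely divisible distribution on $\mathbb{R}_+$ (with zero drift $\gamma_0=0$) whose Lévy measure $\nu$ satisfies $\nu((c,\infty))>0$ for all $c>0$. Assume that $\int_{-\infty}^\infty|\widehat\mu(z)|^t\,dz<\infty$ for every $t>0$. Let $p^t(x)$ be the continuous density of $\mu^{t*}$ for $t>0$. Then we have the following. (i) If $p^t\in\mathcal{S}_d$ for some $t>0$, then $p^t\in\mathcal{S}_d$ for all $t>0$ and $$p^t(x)\sim t\,p^1(x)\quad\text{for all } t>0.$$ (ii) If $p^1\in\mathcal{L}_d$ and, for some $t\in(0,1)\cup(1,\infty)$, there is $C(t)\in(0,\infty)$ such that $$p^t(x)\sim C(t)\,p^1(x),$$ then $C(t)=t$ and $p^1\in\mathcal{S}_d$.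
   Context: $\mathbb{R}_+=[0,\infty)$. For functions $f,h$ that are positive on some half line $[A,\infty)$, $f(x)\sim h(x)$ means $\lim_{x\to\infty}f(x)/h(x)=1$. A nonnegative measurable function $h$ on $\mathbb{R}$ belongs to the class $\mathbf{L}$ (long-tailed) if $h(x+a)\sim h(x)$ for every $a\in\mathbb{R}$. For probability densities $f,h$ on $\mathbb{R}$, $f\otimes h(x)=\int_{-\infty}^{\infty} f(x-u)h(u)\,du$ and $f^{2\otimes}=f\otimes f$. A probability density $h$ on $\mathbb{R}$ belongs to $\mathcal{L}_d$ if $h\in\mathbf{L}$; it belongs to $\mathcal{S}_d$ (subexponential density) if $h\in\mathcal{L}_d$ and $h^{2\otimes}(x)\sim 2h(x)$. An infinitely divisible distribution $\mu$ on $\mathbb{R}_+$ has characteristic function $\widehat\mu(z)=\int e^{izx}\mu(dx)=\exp\left(\int_0^\infty(e^{izx}-1)\nu(dx)+i\gamma_0z\right)$, where $\gamma_0\in\mathbb{R}_+$ is the drift and the Lévy measure $\nu$ is a measure on $\mathbb{R}_+$ with $\nu(\{0\})=0$ and $\int_0^\infty(1\wedge x)\nu(dx)<\infty$. For $t>0$, $\mu^{t*}$ denotes the $t$-th convolution power of $\mu$, i.e. the infinitely divisible distribution on $\mathbb{R}_+$ with drift $t\gamma_0$ and Lévy measure $t\nu$. Integrability of the characteristic function of a distribution implies that it has a bounded continuous density on $\mathbb{R}$. *)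

theory Defs
  imports "HOL-Probability.Probability" "HOL-Library.Landau_Symbols"
begin

text \<open>
  \<open>\<sim>[at_top]\<close> reads \<open>0/0\<close> as \<open>1\<close>, so positivity near infinity, which the relation
  presupposes, is required explicitly.
\<close>
definition tail_equiv :: "(real \<Rightarrow> real) \<Rightarrow> (real \<Rightarrow> real) \<Rightarrow> bool" where
  "tail_equiv f h \<longleftrightarrow>
     (\<exists>A. \<forall>x\<ge>A. 0 < f x \<and> 0 < h x) \<and> f \<sim>[at_top] h"

definition long_tailed :: "(real \<Rightarrow> real) \<Rightarrow> bool" where
  "long_tailed h \<longleftrightarrow> h \<in> borel_measurable borel \<and> (\<forall>x. 0 \<le> h x) \<and>
     (\<forall>a. tail_equiv (\<lambda>x. h (x + a)) h)"

definition prob_density :: "(real \<Rightarrow> real) \<Rightarrow> bool" where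
  "prob_density h \<longleftrightarrow> h \<in> borel_measurable borel \<and> (\<forall>x. 0 \<le> h x) \<and>
     (\<integral>\<^sup>+x. ennreal (h x) \<partial>lborel) = 1"

text \<open>
  The Bochner integral is \<open>0\<close> at points where the convolution of two densities is infinite.
  In \<open>subexp_density\<close> below this makes no difference: if there are arbitrarily
  large such points, the relation fails under either convention.
\<close>
definition density_conv :: "(real \<Rightarrow> real) \<Rightarrow> (real \<Rightarrow> real) \<Rightarrow> real \<Rightarrow> real" where
  "density_conv f h x = (\<integral>u. f (x - u) * h u \<partial>lborel)"

definition long_tailed_density :: "(real \<Rightarrow> real) \<Rightarrow> bool" where
  "long_tailed_density h \<longleftrightarrow> prob_density h \<and> long_tailed h"

definition subexp_density :: "(real \<Rightarrow> real) \<Rightarrow> bool" where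
  "subexp_density h \<longleftrightarrow> long_tailed_density h \<and>
     tail_equiv (density_conv h h) (\<lambda>x. 2 * h x)"

definition infinitely_divisible :: "real measure \<Rightarrow> bool" where
  "infinitely_divisible \<mu> \<longleftrightarrow> real_distribution \<mu> \<and>
     (\<forall>n\<ge>1. \<exists>\<rho>. real_distribution \<rho> \<and> \<mu> = ((convolution \<rho>) ^^ n) (return borel 0))"

text \<open>Measures on \<open>[0,\<infinity>)\<close> are encoded as Borel measures on the real line that vanish on \<open>(-\<infinity>,0)\<close>.\<close>

definition levy_measure_nonneg :: "real measure \<Rightarrow> bool" where
  "levy_measure_nonneg \<nu> \<longleftrightarrow> sets \<nu> = sets borel \<and>
     emeasure \<nu> {..<0} = 0 \<and> emeasure \<nu> {0} = 0 \<and>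
     (\<integral>\<^sup>+x. ennreal (min 1 x) \<partial>\<nu>) < \<infinity>"

definition id_dist_nonneg :: "real measure \<Rightarrow> real \<Rightarrow> real measure \<Rightarrow> bool" where
  "id_dist_nonneg \<mu> \<gamma> \<nu> \<longleftrightarrow>
     infinitely_divisible \<mu> \<and> emeasure \<mu> {..<0} = 0 \<and>
     0 \<le> \<gamma> \<and> levy_measure_nonneg \<nu> \<and>
     (\<forall>z. char \<mu> z =
        exp ((CLINT x|\<nu>. iexp (z * x) - 1) + \<i> * of_real (\<gamma> * z)))"

text \<open>\<open>\<rho>\<close> is the \<open>t\<close>-th convolution power of the distribution with drift \<open>\<gamma>\<close> and Levy measure \<open>\<nu>\<close>.\<close>
definition is_conv_power :: "real \<Rightarrow> real measure \<Rightarrow> real \<Rightarrow> real measure \<Rightarrow> bool" where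
  "is_conv_power \<gamma> \<nu> t \<rho> \<longleftrightarrow> id_dist_nonneg \<rho> (t * \<gamma>) (scale_measure (ennreal t) \<nu>)"

definition is_continuous_density :: "(real \<Rightarrow> real) \<Rightarrow> real measure \<Rightarrow> bool" where
  "is_continuous_density f \<rho> \<longleftrightarrow> continuous_on UNIV f \<and> (\<forall>x. 0 \<le> f x) \<and>
     \<rho> = density lborel (\<lambda>x. ennreal (f x))"

end

theory Submission
  imports Defs
begin

text \<open>
  Write \<open>p t\<close> for the density of the \<open>t\<close>-th convolution power. The key is the size-biased identity
  \<open>\<integral> (x - v) * p s (x - v) * p t v dv = s / (s + t) * x * p (s + t) x\<close> (\<open>size_biased_conv\<close>): given that
  the process is at \<open>x\<close> at time \<open>s + t\<close>, its mean at time \<open>s\<close> is \<open>x * s / (s + t)\<close>. If a large value is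
  caused by one big jump, that jump falls before time \<open>s\<close> or after it, so the increment over \<open>[0, s]\<close>
  is close to \<open>x\<close> or bounded, and the identity says that the former has probability \<open>s / (s + t)\<close>. Thus
  \<open>p s x\<close> is close to \<open>s / (s + t) * p (s + t) x\<close>, and this is where the factor \<open>t\<close> in the theorem
  comes from. Throughout, subexponentiality is used in the form of a single-big-jump property
  (\<open>negligible_middle\<close>), which for long-tailed densities is equivalent to it and clearly invariant
  under tail equivalence.

  Part (ii). Let \<open>p s x\<close> be asymptotic to \<open>c * p (s + t) x\<close>, both functions being long-tailed. The event that the
  increment after time \<open>s\<close> is bounded has conditional probability tending to \<open>c\<close>, and the identity gives
  \<open>c \<le> s / (s + t)\<close> (\<open>ratio_le_time_ratio\<close>). For the reverse inequality the identity is integrated against a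
  submultiplicative weight for which the total mass is hardly changed but the first moment is huge
  (\<open>submultiplicative_weight\<close>, \<open>time_ratio_le_ratio\<close>). Equality in the first estimate then leaves no mass for
  the middle part of the convolution, which is subexponentiality (\<open>negligible_middle_if_ratio\<close>).

  Part (i). Let \<open>p T\<close> be subexponential and \<open>s < T\<close>. The middle part being negligible, the identity shows
  that the average of \<open>p s / p T\<close> near \<open>x\<close> with respect to the distribution at time \<open>T - s\<close> converges to
  \<open>s / T\<close> (\<open>ratio_convolution_limit\<close>). The average must be undone, which is impossible for a general
  distribution but not for an infinitely divisible one. It is the convolution of the distributions of the sum of its jumps above
  \<open>\<epsilon>\<close> and of the sum of its jumps below \<open>\<epsilon>\<close>. The former is compound Poisson; over a short time it has
  an atom of mass above \<open>1 / 2\<close> at \<open>0\<close>, and convolution with it can be inverted at infinity by a contraction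
  argument (\<open>tendsto_deconvolve_semigroup\<close>). The latter is concentrated near \<open>0\<close> for small \<open>\<epsilon>\<close> and does little
  to a slowly oscillating function. That \<open>p s / p T\<close> is bounded and slowly oscillating comes from the
  splitting at \<open>\<epsilon> = 1\<close>: the jumps below \<open>1\<close> contribute a uniformly continuous density with exponential tail,
  while \<open>p T\<close> decays more slowly than any exponential (\<open>earlier_density_le\<close>,
  \<open>earlier_density_equicontinuous\<close>). Times beyond \<open>T\<close> are reached by doubling, as \<open>p (2 * T)\<close> is asymptotic
  to \<open>2 * p T\<close> by definition of subexponentiality.

  The two jump distributions are constructed from the Levy measure: the large jumps as a Poisson mixture of
  convolution powers, the small ones as a weak limit of such mixtures, and their densities by Fourier
  inversion.
\<close>

section \<open>Long-tailed functions\<close>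

lemma tail_equiv_iff:
  "tail_equiv f h \<longleftrightarrow>
     (\<forall>\<^sub>F x in at_top. 0 < f x \<and> 0 < h x) \<and> ((\<lambda>x. f x / h x) \<longlongrightarrow> 1) at_top"
proof -
  have ev: "(\<exists>A. \<forall>x\<ge>A. 0 < f x \<and> 0 < h x) \<longleftrightarrow> (\<forall>\<^sub>F x in at_top. 0 < f x \<and> 0 < h x)"
    by (simp add: eventually_at_top_linorder)
  have "f \<sim>[at_top] h \<longleftrightarrow> ((\<lambda>x. f x / h x) \<longlongrightarrow> 1) at_top"
    if "\<forall>\<^sub>F x in at_top. 0 < f x \<and> 0 < h x"
  proof
    assume "f \<sim>[at_top] h"
    then show "((\<lambda>x. f x / h x) \<longlongrightarrow> 1) at_top"
      by (rule asymp_equivD_strong) (use that in \<open>eventually_elim, auto\<close>)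
  qed (rule asymp_equivI')
  then show ?thesis
    unfolding tail_equiv_def ev by blast
qed

text \<open>
  The locally uniform form of long-tailedness: the shift ranges over a compact interval, and the error
  is relative. Every estimate below uses this form; for continuous functions it follows from the
  pointwise one.
\<close>
definition uniformly_long_tailed :: "(real \<Rightarrow> real) \<Rightarrow> bool" where
  "uniformly_long_tailed h \<longleftrightarrow>
     (\<forall>\<eta>>0. \<forall>K\<ge>0. \<exists>X. \<forall>x\<ge>X. 0 < h x \<and>
        (\<forall>v\<in>{0..K}. (1 - \<eta>) * h x \<le> h (x - v) \<and> h (x - v) \<le> (1 + \<eta>) * h x))"

lemma uniformly_long_tailedD:
  assumes "uniformly_long_tailed h" "0 < \<eta>" "0 \<le> K"
  obtains X where "\<And>x. X \<le> x \<Longrightarrow> 0 < h x"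
    "\<And>x v. X \<le> x \<Longrightarrow> 0 \<le> v \<Longrightarrow> v \<le> K \<Longrightarrow> (1 - \<eta>) * h x \<le> h (x - v)"
    "\<And>x v. X \<le> x \<Longrightarrow> 0 \<le> v \<Longrightarrow> v \<le> K \<Longrightarrow> h (x - v) \<le> (1 + \<eta>) * h x"
proof -
  obtain X where "\<forall>x\<ge>X. 0 < h x \<and>
        (\<forall>v\<in>{0..K}. (1 - \<eta>) * h x \<le> h (x - v) \<and> h (x - v) \<le> (1 + \<eta>) * h x)"
    using assms unfolding uniformly_long_tailed_def by blast
  then show ?thesis
    by (intro that[of X]) auto
qed

text \<open>
  The uniform convergence theorem of regular variation, in additive notation. For the shifts \<open>a\<close>
  whose increment is at most \<open>e\<close> beyond \<open>n\<close>, continuity of \<open>L\<close> gives a closed set \<open>E n\<close>. These sets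
  cover the half-line, so by Baire's theorem one of them contains an interval; differences of two of its
  elements control all small shifts, and a finite grid of shifts does the rest.
\<close>
lemma slowly_varying_log_uniform:
  fixes L :: "real \<Rightarrow> real"
  assumes cont: "continuous_on {A..} L"
    and lim: "\<And>a. 0 \<le> a \<Longrightarrow> ((\<lambda>x. L (x + a) - L x) \<longlongrightarrow> 0) at_top"
    and \<eta>: "0 < \<eta>" and K: "0 \<le> K"
  obtains X where "A \<le> X" "\<And>x a. X \<le> x \<Longrightarrow> 0 \<le> a \<Longrightarrow> a \<le> K \<Longrightarrow> \<bar>L (x + a) - L x\<bar> \<le> \<eta>"
proof -
  define e where "e = \<eta> / 3"
  have e: "0 < e" using \<eta> by (simp add: e_def)
  define E where "E n = {a. 0 \<le> a \<and> (\<forall>x\<ge>max A (real n). \<bar>L (x + a) - L x\<bar> \<le> e)}" for n :: nat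
  have E_eq: "E n = (\<Inter>x\<in>{max A (real n)..}. {a\<in>{0..}. \<bar>L (x + a) - L x\<bar> \<in> {..e}})" for n
    unfolding E_def by auto
  have clE: "closed (E n)" for n
  proof -
    have "closed {a\<in>{0..}. \<bar>L (x + a) - L x\<bar> \<in> {..e}}" if "x \<in> {max A (real n)..}" for x
    proof (rule continuous_closed_preimage[folded vimage_def, unfolded Int_def vimage_def mem_Collect_eq])
      show "continuous_on {0..} (\<lambda>a. \<bar>L (x + a) - L x\<bar>)"
        using that by (intro continuous_intros continuous_on_compose2[OF cont]) auto
    qed auto
    then show ?thesis unfolding E_eq by (intro closed_INT) auto
  qed
  have un: "\<exists>n. a \<in> E n" if "0 \<le> a" for a
  proof -
    have "\<forall>\<^sub>F x in at_top. \<bar>L (x + a) - L x\<bar> < e"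
      using tendstoD[OF lim[OF that] e] by (simp add: dist_real_def)
    then obtain N where N: "\<And>x. x \<ge> N \<Longrightarrow> \<bar>L (x + a) - L x\<bar> < e"
      by (auto simp: eventually_at_top_linorder)
    obtain n :: nat where "N \<le> real n" using real_arch_simple by blast
    then have "a \<in> E n" using N that unfolding E_def by (auto intro!: less_imp_le)
    then show ?thesis ..
  qed
  \<comment> \<open>Otherwise the complements of the \<open>E n\<close> are open and dense with empty intersection.\<close>
  have "\<exists>n c d. 0 \<le> c \<and> 0 < d \<and> {c..c+d} \<subseteq> E n"
  proof (rule ccontr)
    assume neg: "\<not> ?thesis"
    let ?G = "range (\<lambda>n. {0..} - E n)"
    have "{0..} \<subseteq> closure (\<Inter>?G)"
    proof (rule Baire)
      fix T assume "T \<in> ?G"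
      then obtain n where T: "T = {0..} - E n" by auto
      have "openin (top_of_set {0..}) T"
        unfolding T using clE by (intro openin_diff) (auto simp: closedin_closed intro!: exI[of _ "E n"] simp: E_def)
      moreover have "{0..} \<subseteq> closure T"
      proof
        fix c :: real assume c: "c \<in> {0..}"
        show "c \<in> closure T"
          unfolding closure_approachable
        proof (intro allI impI)
          fix r :: real assume r: "0 < r"
          have "\<not> {c..c + r/2} \<subseteq> E n" using neg c r by (metis atLeast_iff half_gt_zero)
          then obtain b where "b \<in> {c..c+r/2}" "b \<notin> E n" by blast
          then show "\<exists>y\<in>T. dist y c < r"
            using c r unfolding T by (intro bexI[of _ b]) (auto simp: dist_real_def)
        qed
      qed
      ultimately show "openin (top_of_set {0..}) T \<and> {0..} \<subseteq> closure T" ..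
    qed auto
    moreover have G: "\<Inter>?G = {}" using un by auto
    ultimately have "{0..} \<subseteq> ({} :: real set)" unfolding G by simp
    then show False by auto
  qed
  then obtain n c d where cd: "0 \<le> c" "0 < d" "{c..c+d} \<subseteq> E n" by blast
  \<comment> \<open>A shift by \<open>u \<le> d\<close> is the difference of the shifts \<open>c + u\<close> and \<open>c\<close>, both in \<open>E n\<close>.\<close>
  define X0 where "X0 = max A (real n) + c"
  have small: "\<bar>L (x + u) - L x\<bar> \<le> 2 * e" if "X0 \<le> x" "0 \<le> u" "u \<le> d" for x u
  proof -
    have "c + u \<in> E n" "c \<in> E n" using cd that by auto
    moreover have "max A (real n) \<le> x - c" using that unfolding X0_def by linarith
    ultimately have "\<bar>L (x - c + (c + u)) - L (x - c)\<bar> \<le> e" "\<bar>L (x - c + c) - L (x - c)\<bar> \<le> e"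
      unfolding E_def by blast+
    then show ?thesis by (simp add: algebra_simps)
  qed
  \<comment> \<open>The grid of the shifts \<open>j * d\<close> up to \<open>K\<close>; every other shift exceeds one of them by at most \<open>d\<close>.\<close>
  define m where "m = nat \<lfloor>K / d\<rfloor>"
  have "\<forall>\<^sub>F x in at_top. \<forall>j\<in>{..m}. \<bar>L (x + real j * d) - L x\<bar> < e"
  proof (intro eventually_ball_finite ballI)
    fix j
    show "\<forall>\<^sub>F x in at_top. \<bar>L (x + real j * d) - L x\<bar> < e"
      using tendstoD[OF lim[of "real j * d"] e] cd by (simp add: dist_real_def)
  qed simp
  then obtain X1 where X1: "\<And>x j. X1 \<le> x \<Longrightarrow> j \<le> m \<Longrightarrow> \<bar>L (x + real j * d) - L x\<bar> < e"
    by (auto simp: eventually_at_top_linorder)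
  show ?thesis
  proof (rule that[of "max X0 X1"])
    show "A \<le> max X0 X1" using cd by (auto simp: X0_def)
    fix x a assume x: "max X0 X1 \<le> x" and a: "0 \<le> a" "a \<le> K"
    define j where "j = nat \<lfloor>a / d\<rfloor>"
    have jm: "j \<le> m" unfolding j_def m_def using a cd
      by (intro nat_mono floor_mono divide_right_mono) auto
    have "real j = of_int \<lfloor>a / d\<rfloor>" unfolding j_def using a cd by simp
    then have "real j \<le> a / d" "a / d < real j + 1" by linarith+
    then have j: "real j * d \<le> a" "a \<le> real j * d + d" using cd by (auto simp: field_simps)
    have "\<bar>L (x + real j * d + (a - real j * d)) - L (x + real j * d)\<bar> \<le> 2 * e"
      using x j cd by (intro small) (auto intro: add_increasing2)
    moreover have "\<bar>L (x + real j * d) - L x\<bar> < e" using X1 x jm by auto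
    ultimately have "\<bar>L (x + a) - L x\<bar> \<le> 3 * e" by (simp add: algebra_simps)
    then show "\<bar>L (x + a) - L x\<bar> \<le> \<eta>" by (simp add: e_def)
  qed
qed

lemma long_tailed_uniform:
  assumes lt: "long_tailed h" and cont: "continuous_on UNIV h"
  shows "uniformly_long_tailed h"
  unfolding uniformly_long_tailed_def
proof (intro allI impI)
  fix \<eta> K :: real assume \<eta>: "0 < \<eta>" and K: "0 \<le> K"
  have te: "tail_equiv (\<lambda>x. h (x + a)) h" for a using lt by (simp add: long_tailed_def)
  have "\<forall>\<^sub>F x in at_top. 0 < h x" using te[of 0] unfolding tail_equiv_iff by (auto elim: eventually_mono)
  then obtain A where A: "\<And>x. A \<le> x \<Longrightarrow> 0 < h x" by (auto simp: eventually_at_top_linorder)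
  have lim: "((\<lambda>x. ln (h (x + a)) - ln (h x)) \<longlongrightarrow> 0) at_top" if "0 \<le> a" for a
  proof -
    have "((\<lambda>x. ln (h (x + a) / h x)) \<longlongrightarrow> ln 1) at_top"
      using te[of a] unfolding tail_equiv_iff by (intro tendsto_ln) auto
    moreover have "\<forall>\<^sub>F x in at_top. ln (h (x + a) / h x) = ln (h (x + a)) - ln (h x)"
      using eventually_ge_at_top[of A]
    proof eventually_elim
      case (elim x)
      then show ?case using A[of x] A[of "x + a"] that by (simp add: ln_div)
    qed
    ultimately show ?thesis by (simp add: tendsto_cong)
  qed
  have c: "continuous_on {A..} (\<lambda>x. ln (h x))"
    using A by (intro continuous_on_ln continuous_on_subset[OF cont]) (auto simp: less_imp_neq[symmetric])
  have l: "0 < ln (1 + \<eta>)" using \<eta> by simp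
  obtain X where X: "A \<le> X" "\<And>x a. X \<le> x \<Longrightarrow> 0 \<le> a \<Longrightarrow> a \<le> K \<Longrightarrow> \<bar>ln (h (x + a)) - ln (h x)\<bar> \<le> ln (1 + \<eta>)"
    using slowly_varying_log_uniform[OF c lim l K] by metis
  show "\<exists>X. \<forall>x\<ge>X. 0 < h x \<and> (\<forall>v\<in>{0..K}. (1 - \<eta>) * h x \<le> h (x - v) \<and> h (x - v) \<le> (1 + \<eta>) * h x)"
  proof (intro exI[of _ "X + K"] allI impI conjI ballI)
    fix x assume x: "X + K \<le> x"
    show hx: "0 < h x" using x X(1) K by (intro A) linarith
    fix v assume v: "v \<in> {0..K}"
    have hv: "0 < h (x - v)" using x X(1) v by (intro A) auto
    have "\<bar>ln (h (x - v + v)) - ln (h (x - v))\<bar> \<le> ln (1 + \<eta>)"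
      using x v by (intro X(2)) auto
    then have "ln (h x) \<le> ln (1 + \<eta>) + ln (h (x - v))" "ln (h (x - v)) \<le> ln (1 + \<eta>) + ln (h x)" by auto
    then have "ln (h x) \<le> ln ((1 + \<eta>) * h (x - v))" "ln (h (x - v)) \<le> ln ((1 + \<eta>) * h x)"
      using hx hv \<eta> by (simp_all add: ln_mult)
    then have 1: "h x \<le> (1 + \<eta>) * h (x - v)" and 2: "h (x - v) \<le> (1 + \<eta>) * h x"
      using hx hv \<eta> by simp_all
    show "h (x - v) \<le> (1 + \<eta>) * h x" by (fact 2)
    have "(1 - \<eta>) * h x \<le> h (x - v)"
    proof (cases "\<eta> \<le> 1")
      case True
      have "(1 - \<eta>) * h x \<le> (1 - \<eta>) * ((1 + \<eta>) * h (x - v))"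
        using True 1 by (intro mult_left_mono) auto
      also have "\<dots> = (1 - \<eta>\<^sup>2) * h (x - v)" by (simp add: algebra_simps power2_eq_square)
      also have "\<dots> \<le> 1 * h (x - v)" using hv by (intro mult_right_mono) auto
      finally show ?thesis by simp
    next
      case False
      then have "(1 - \<eta>) * h x \<le> 0" using hx by (intro mult_nonpos_nonneg) auto
      then show ?thesis using hv by linarith
    qed
    then show "(1 - \<eta>) * h x \<le> h (x - v)" .
  qed
qed

text \<open>
  A long-tailed function changes by a factor near \<open>1\<close> over a unit step, hence by less than any
  exponential over long steps.
\<close>
lemma uniformly_long_tailed_exp_bound:
  assumes "uniformly_long_tailed h" and \<alpha>: "0 < \<alpha>"
  obtains X where "\<And>x. X \<le> x \<Longrightarrow> 0 < h x"
    "\<And>x w. 0 \<le> w \<Longrightarrow> X \<le> x - w \<Longrightarrow> h (x - w) \<le> exp (\<alpha> * (w + 1)) * h x"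
proof -
  obtain X where pos: "\<And>x. X \<le> x \<Longrightarrow> 0 < h x" and
    X: "\<And>x v. X \<le> x \<Longrightarrow> 0 \<le> v \<Longrightarrow> v \<le> 1 \<Longrightarrow> h (x - v) \<le> (1 + \<alpha>) * h x"
    using uniformly_long_tailedD[OF assms(1) \<alpha>, of 1] by (metis zero_le_one)
  have *: "h (x - w) \<le> exp (\<alpha> * real n) * h x" if "0 \<le> w" "w \<le> real n" "X \<le> x - w" for x w n
    using that
  proof (induction n arbitrary: x w)
    case (Suc n)
    define v where "v = min w 1"
    have "h (x - v - (w - v)) \<le> exp (\<alpha> * real n) * h (x - v)"
      using Suc.prems by (intro Suc.IH) (auto simp: v_def min_def)
    also have "\<dots> \<le> exp (\<alpha> * real n) * ((1 + \<alpha>) * h x)"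
      using Suc.prems by (intro mult_left_mono X) (auto simp: v_def)
    also have "\<dots> \<le> exp (\<alpha> * real n) * (exp \<alpha> * h x)"
      using pos[of x] Suc.prems exp_ge_add_one_self[of \<alpha>] by (intro mult_left_mono mult_right_mono) auto
    finally show ?case by (simp add: algebra_simps exp_add)
  qed simp
  show ?thesis
  proof (rule that[of X])
    fix x w assume w: "0 \<le> w" "X \<le> x - w"
    have "h (x - w) \<le> exp (\<alpha> * real (nat \<lceil>w\<rceil>)) * h x"
      using w by (intro *) (auto simp: of_nat_nat)
    also have "\<dots> \<le> exp (\<alpha> * (w + 1)) * h x"
      using w pos[of x] \<alpha> by (intro mult_right_mono) (auto intro!: mult_left_mono simp: of_nat_nat)
    finally show "h (x - w) \<le> exp (\<alpha> * (w + 1)) * h x" .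
  qed (fact pos)
qed

section \<open>Subexponential densities and the middle part of a convolution\<close>

text \<open>
  The contribution of the arguments \<open>v \<in> S\<close> to the convolution of \<open>f\<close> and \<open>g\<close>. Values in \<open>ennreal\<close>
  make it additive in \<open>S\<close> without integrability conditions.
\<close>
definition conv_part :: "(real \<Rightarrow> real) \<Rightarrow> (real \<Rightarrow> real) \<Rightarrow> real set \<Rightarrow> real \<Rightarrow> ennreal" where
  "conv_part f g S x = (\<integral>\<^sup>+v. ennreal (f (x - v) * g v) * indicator S v \<partial>lborel)"

definition halfline_density :: "(real \<Rightarrow> real) \<Rightarrow> bool" where
  "halfline_density h \<longleftrightarrow> prob_density h \<and> (\<forall>x<0. h x = 0)"

lemma halfline_densityD:
  assumes "halfline_density h"
  shows "h \<in> borel_measurable borel" "0 \<le> h x" "x < 0 \<Longrightarrow> h x = 0" "(\<integral>\<^sup>+x. ennreal (h x) \<partial>lborel) = 1"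
  using assms by (auto simp: halfline_density_def prob_density_def)

lemma conv_part_mono:
  assumes "\<And>v. v \<in> S \<Longrightarrow> v \<in> T"
  shows "conv_part f g S x \<le> conv_part f g T x"
  unfolding conv_part_def using assms by (intro nn_integral_mono) (auto split: split_indicator)

lemma conv_part_Un:
  assumes [measurable]: "f \<in> borel_measurable borel" "g \<in> borel_measurable borel" "S \<in> sets borel" "T \<in> sets borel"
    and "S \<inter> T = {}"
  shows "conv_part f g (S \<union> T) x = conv_part f g S x + conv_part f g T x"
proof -
  have "conv_part f g (S \<union> T) x =
     (\<integral>\<^sup>+v. ennreal (f (x - v) * g v) * indicator S v + ennreal (f (x - v) * g v) * indicator T v \<partial>lborel)"
    unfolding conv_part_def using assms(5) by (intro nn_integral_cong) (auto split: split_indicator)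
  also have "\<dots> = conv_part f g S x + conv_part f g T x"
    unfolding conv_part_def by (subst nn_integral_add) auto
  finally show ?thesis .
qed

lemma conv_part_Un_le:
  assumes [measurable]: "f \<in> borel_measurable borel" "g \<in> borel_measurable borel" "S \<in> sets borel" "T \<in> sets borel"
  shows "conv_part f g (S \<union> T) x \<le> conv_part f g S x + conv_part f g T x"
proof -
  have "conv_part f g (S \<union> T) x \<le>
     (\<integral>\<^sup>+v. ennreal (f (x - v) * g v) * indicator S v + ennreal (f (x - v) * g v) * indicator T v \<partial>lborel)"
    unfolding conv_part_def by (intro nn_integral_mono) (auto split: split_indicator)
  also have "\<dots> = conv_part f g S x + conv_part f g T x"
    unfolding conv_part_def by (subst nn_integral_add) auto
  finally show ?thesis .
qed

lemma nn_integral_lborel_reflect: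
  fixes F :: "real \<Rightarrow> ennreal"
  assumes "F \<in> borel_measurable borel"
  shows "(\<integral>\<^sup>+v. F (x - v) \<partial>lborel) = (\<integral>\<^sup>+v. F v \<partial>lborel)"
  using nn_integral_real_affine[OF assms, of "-1" x] by simp

lemma nn_integral_lborel_shift:
  fixes F :: "real \<Rightarrow> ennreal"
  assumes "F \<in> borel_measurable borel"
  shows "(\<integral>\<^sup>+v. F (v - x) \<partial>lborel) = (\<integral>\<^sup>+v. F v \<partial>lborel)"
  using nn_integral_real_affine[OF assms, of "1" "-x"] by simp

lemma conv_part_split3:
  assumes [measurable]: "f \<in> borel_measurable borel" "g \<in> borel_measurable borel" and K: "0 \<le> K" "2 * K < x"
  shows "conv_part f g {0..x} x =
    conv_part f g {0..K} x + (conv_part f g {K<..<x - K} x + conv_part f g {x - K..x} x)"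
proof -
  have "{0..x} = {0..K} \<union> ({K<..<x - K} \<union> {x - K..x})" using K by auto
  moreover have "conv_part f g ({0..K} \<union> ({K<..<x - K} \<union> {x - K..x})) x =
      conv_part f g {0..K} x + conv_part f g ({K<..<x - K} \<union> {x - K..x}) x"
    using K by (intro conv_part_Un) auto
  moreover have "conv_part f g ({K<..<x - K} \<union> {x - K..x}) x =
      conv_part f g {K<..<x - K} x + conv_part f g {x - K..x} x"
    using K by (intro conv_part_Un) auto
  ultimately show ?thesis by simp
qed

lemma conv_part_reflect:
  assumes [measurable]: "f \<in> borel_measurable borel" "g \<in> borel_measurable borel" "S \<in> sets borel"
  shows "conv_part f g S x = conv_part g f {v. x - v \<in> S} x"
proof -
  have "conv_part f g S x = (\<integral>\<^sup>+v. ennreal (f (x - (x - v)) * g (x - v)) * indicator S (x - v) \<partial>lborel)"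
    unfolding conv_part_def by (rule nn_integral_lborel_reflect[symmetric]) measurable
  also have "\<dots> = conv_part g f {v. x - v \<in> S} x"
    unfolding conv_part_def by (intro nn_integral_cong) (auto split: split_indicator simp: mult.commute)
  finally show ?thesis .
qed

lemma conv_part_cong_support:
  assumes "halfline_density f" "halfline_density g" "\<And>v. 0 \<le> v \<Longrightarrow> v \<le> x \<Longrightarrow> v \<in> S \<longleftrightarrow> v \<in> T"
  shows "conv_part f g S x = conv_part f g T x"
  unfolding conv_part_def
proof (intro nn_integral_cong)
  fix v
  consider "v < 0" | "x < v" | "0 \<le> v" "v \<le> x" by linarith
  then show "ennreal (f (x - v) * g v) * indicator S v = ennreal (f (x - v) * g v) * indicator T v"
    using assms halfline_densityD(3)[OF assms(1), of "x - v"] halfline_densityD(3)[OF assms(2), of v]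
    by cases (auto split: split_indicator)
qed

lemma conv_part_near_le:
  assumes g: "halfline_density g" and f: "\<And>v. v \<in> S \<Longrightarrow> 0 \<le> v \<Longrightarrow> f (x - v) \<le> M" and M: "0 \<le> M"
  shows "conv_part f g S x \<le> ennreal M"
proof -
  have [measurable]: "g \<in> borel_measurable borel" using halfline_densityD[OF g] by auto
  have "conv_part f g S x \<le> (\<integral>\<^sup>+v. ennreal M * ennreal (g v) \<partial>lborel)"
    unfolding conv_part_def
  proof (intro nn_integral_mono)
    fix v
    show "ennreal (f (x - v) * g v) * indicator S v \<le> ennreal M * ennreal (g v)"
    proof (cases "v \<in> S \<and> 0 \<le> v")
      case True
      then have "f (x - v) * g v \<le> M * g v" using f halfline_densityD(2)[OF g] by (intro mult_right_mono) auto
      then show ?thesis using True M halfline_densityD(2)[OF g]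
        by (auto simp: ennreal_mult'[symmetric] ennreal_leI)
    next
      case False
      then show ?thesis using halfline_densityD(3)[OF g, of v] by (cases "v \<in> S") auto
    qed
  qed
  also have "\<dots> = ennreal M" by (subst nn_integral_cmult) (auto simp: halfline_densityD(4)[OF g])
  finally show ?thesis .
qed

lemma conv_part_near_ge:
  assumes g: "halfline_density g" and f: "\<And>v. v \<in> S \<Longrightarrow> m \<le> f (x - v)" and m: "0 \<le> m"
    and [measurable]: "S \<in> sets borel"
  shows "ennreal m * (\<integral>\<^sup>+v. ennreal (g v) * indicator S v \<partial>lborel) \<le> conv_part f g S x"
proof -
  have [measurable]: "g \<in> borel_measurable borel" using halfline_densityD[OF g] by auto
  have "ennreal m * (\<integral>\<^sup>+v. ennreal (g v) * indicator S v \<partial>lborel) =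
     (\<integral>\<^sup>+v. ennreal m * (ennreal (g v) * indicator S v) \<partial>lborel)"
    by (subst nn_integral_cmult) auto
  also have "\<dots> \<le> conv_part f g S x"
    unfolding conv_part_def using m halfline_densityD(2)[OF g]
    by (intro nn_integral_mono)
       (auto split: split_indicator simp: ennreal_mult'[symmetric] intro!: ennreal_leI mult_right_mono f)
  finally show ?thesis .
qed

lemma halfline_density_mass:
  assumes g: "halfline_density g" and \<eta>: "0 < \<eta>"
  obtains K0 where "0 \<le> K0" "\<And>K. K0 \<le> K \<Longrightarrow>
    ennreal (1 - \<eta>) \<le> (\<integral>\<^sup>+v. ennreal (g v) * indicator {0..K} v \<partial>lborel)"
proof -
  have [measurable]: "g \<in> borel_measurable borel" using halfline_densityD[OF g] by auto
  have "(SUP n. (\<integral>\<^sup>+v. ennreal (g v) * indicator {0..real n} v \<partial>lborel)) =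
    (\<integral>\<^sup>+v. (SUP n. ennreal (g v) * indicator {0..real n} v) \<partial>lborel)"
    by (intro nn_integral_monotone_convergence_SUP[symmetric])
       (auto simp: incseq_def le_fun_def split: split_indicator)
  also have "\<dots> = (\<integral>\<^sup>+v. ennreal (g v) \<partial>lborel)"
  proof (intro nn_integral_cong)
    fix v :: real
    show "(SUP n. ennreal (g v) * indicator {0..real n} v) = ennreal (g v)"
    proof (cases "v < 0")
      case False
      obtain n :: nat where "v \<le> real n" using real_arch_simple by blast
      then have "ennreal (g v) \<le> (SUP n. ennreal (g v) * indicator {0..real n} v)"
        using False by (intro SUP_upper2[of n]) auto
      moreover have "(SUP n. ennreal (g v) * indicator {0..real n} v) \<le> ennreal (g v)"
        by (intro SUP_least) (auto split: split_indicator)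
      ultimately show ?thesis by (rule antisym[rotated])
    qed (simp add: halfline_densityD(3)[OF g])
  qed
  finally have S: "(SUP n. (\<integral>\<^sup>+v. ennreal (g v) * indicator {0..real n} v \<partial>lborel)) = 1"
    by (simp add: halfline_densityD(4)[OF g])
  have "ennreal (1 - \<eta>) < 1" using \<eta> by (simp add: ennreal_less_one_iff)
  then obtain n where n: "ennreal (1 - \<eta>) < (\<integral>\<^sup>+v. ennreal (g v) * indicator {0..real n} v \<partial>lborel)"
    using S less_SUP_iff[of "ennreal (1 - \<eta>)" "\<lambda>n. (\<integral>\<^sup>+v. ennreal (g v) * indicator {0..real n} v \<partial>lborel)" UNIV] by auto
  show ?thesis
  proof (rule that[of "real n"])
    fix K :: real assume "real n \<le> K"
    then have "(\<integral>\<^sup>+v. ennreal (g v) * indicator {0..real n} v \<partial>lborel) \<le> (\<integral>\<^sup>+v. ennreal (g v) * indicator {0..K} v \<partial>lborel)"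
      by (intro nn_integral_mono) (auto split: split_indicator)
    with n show "ennreal (1 - \<eta>) \<le> (\<integral>\<^sup>+v. ennreal (g v) * indicator {0..K} v \<partial>lborel)" by auto
  qed simp
qed

text \<open>
  If the sum of two independent variables with density \<open>h\<close> is a large \<open>x\<close>, then one of them is bounded,
  uniformly in \<open>x\<close> and up to a small conditional probability. For long-tailed densities this
  single-big-jump property is equivalent to subexponentiality, and unlike the latter it is visibly
  preserved by two-sided bounds on \<open>h\<close>.
\<close>
definition negligible_middle :: "(real \<Rightarrow> real) \<Rightarrow> bool" where
  "negligible_middle h \<longleftrightarrow>
     (\<forall>\<delta>>0. \<exists>K\<ge>0. \<exists>X. \<forall>x\<ge>X. conv_part h h {K<..<x - K} x \<le> ennreal (\<delta> * h x))"

lemma density_conv_eq: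
  assumes "halfline_density f" "halfline_density g"
  shows "density_conv f g x = enn2real (conv_part f g UNIV x)"
proof -
  have [measurable]: "f \<in> borel_measurable borel" "g \<in> borel_measurable borel"
    using halfline_densityD(1) assms by auto
  show ?thesis
    unfolding density_conv_def conv_part_def using halfline_densityD(2) assms
    by (subst integral_eq_nn_integral) auto
qed

text \<open>
  Each of the two ends \<open>{0..K}\<close> and \<open>{x - K..x}\<close> contributes about \<open>h x\<close> to the convolution because
  \<open>h\<close> is long-tailed. The total is about \<open>2 * h x\<close>, so nothing is left for the middle.
\<close>
lemma subexp_density_imp_negligible_middle:
  assumes h: "halfline_density h" and u: "uniformly_long_tailed h" and s: "subexp_density h"
  shows "negligible_middle h"
  unfolding negligible_middle_def
proof (intro allI impI)
  fix \<delta> :: real assume \<delta>: "0 < \<delta>"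
  have [measurable]: "h \<in> borel_measurable borel" using halfline_densityD(1)[OF h] .
  define \<eta> where "\<eta> = min (1/2) (\<delta> / 5)"
  have \<eta>: "0 < \<eta>" "\<eta> < 1" "5 * \<eta> \<le> \<delta>" using \<delta> by (auto simp: \<eta>_def min_def)
  obtain K where K: "0 \<le> K" "ennreal (1 - \<eta>) \<le> (\<integral>\<^sup>+v. ennreal (h v) * indicator {0..K} v \<partial>lborel)"
    using halfline_density_mass[OF h \<eta>(1)] by (metis order_refl)
  obtain X1 where X1: "\<And>x. X1 \<le> x \<Longrightarrow> 0 < h x"
    "\<And>x v. X1 \<le> x \<Longrightarrow> 0 \<le> v \<Longrightarrow> v \<le> K \<Longrightarrow> (1 - \<eta>) * h x \<le> h (x - v)"
    using uniformly_long_tailedD[OF u \<eta>(1) K(1)] by metis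
  have te: "tail_equiv (density_conv h h) (\<lambda>x. 2 * h x)" using s by (simp add: subexp_density_def)
  have "\<forall>\<^sub>F x in at_top. density_conv h h x / (2 * h x) < 1 + \<eta> / 2"
    using te \<eta> unfolding tail_equiv_iff by (intro order_tendstoD(2)[of _ 1]) auto
  moreover have "\<forall>\<^sub>F x in at_top. 0 < density_conv h h x \<and> 0 < 2 * h x"
    using te unfolding tail_equiv_iff by auto
  ultimately have "\<forall>\<^sub>F x in at_top. 0 < density_conv h h x \<and> density_conv h h x \<le> (2 + \<eta>) * h x"
    by eventually_elim (auto simp: field_simps)
  then obtain X2 where X2: "\<And>x. X2 \<le> x \<Longrightarrow> 0 < density_conv h h x \<and> density_conv h h x \<le> (2 + \<eta>) * h x"
    by (auto simp: eventually_at_top_linorder)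
  show "\<exists>K\<ge>0. \<exists>X. \<forall>x\<ge>X. conv_part h h {K<..<x - K} x \<le> ennreal (\<delta> * h x)"
  proof (rule exI[of _ K], intro conjI K(1) exI[of _ "max (max X1 X2) (2 * K + 1)"] allI impI)
    fix x assume x: "max (max X1 X2) (2 * K + 1) \<le> x"
    have hx: "0 < h x" using X1(1) x by auto
    have nn: "0 \<le> (1 - \<eta>) * h x" using hx \<eta> by simp
    have fin: "conv_part h h UNIV x \<le> ennreal ((2 + \<eta>) * h x)"
    proof -
      have dc: "density_conv h h x = enn2real (conv_part h h UNIV x)" by (rule density_conv_eq[OF h h])
      have "conv_part h h UNIV x \<noteq> \<top>" using X2[of x] x unfolding dc by (auto simp: enn2real_eq_0_iff)
      then have "conv_part h h UNIV x = ennreal (density_conv h h x)" unfolding dc by (simp add: less_top)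
      then show ?thesis using X2[of x] x by (auto intro!: ennreal_leI)
    qed
    have near: "ennreal ((1 - \<eta>)\<^sup>2 * h x) \<le> conv_part h h {0..K} x"
    proof -
      have "ennreal ((1 - \<eta>)\<^sup>2 * h x) = ennreal ((1 - \<eta>) * h x) * ennreal (1 - \<eta>)"
        using \<eta> hx by (subst ennreal_mult[symmetric]) (auto simp: power2_eq_square algebra_simps)
      also have "\<dots> \<le> ennreal ((1 - \<eta>) * h x) * (\<integral>\<^sup>+v. ennreal (h v) * indicator {0..K} v \<partial>lborel)"
        by (intro mult_left_mono K(2)) auto
      also have "\<dots> \<le> conv_part h h {0..K} x"
        using X1 x \<eta> hx nn by (intro conv_part_near_ge[OF h]) auto
      finally show ?thesis .
    qed
    have far: "conv_part h h {x - K..x} x = conv_part h h {0..K} x"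
      by (subst conv_part_reflect) (auto intro!: arg_cong[where f="\<lambda>S. conv_part h h S x"])
    let ?m = "conv_part h h {K<..<x - K} x"
    have "ennreal (2 * (1 - \<eta>)\<^sup>2 * h x) + ?m =
        ennreal ((1 - \<eta>)\<^sup>2 * h x) + (?m + ennreal ((1 - \<eta>)\<^sup>2 * h x))"
      using hx by (simp add: ac_simps flip: ennreal_plus)
    also have "\<dots> \<le> conv_part h h {0..K} x + (?m + conv_part h h {x - K..x} x)"
      unfolding far by (intro add_mono near order_refl)
    also have "\<dots> = conv_part h h {0..x} x"
      using x K by (intro conv_part_split3[symmetric]) auto
    also have "\<dots> \<le> conv_part h h UNIV x" by (intro conv_part_mono) auto
    also note fin
    finally have le: "ennreal (2 * (1 - \<eta>)\<^sup>2 * h x) + ?m \<le> ennreal ((2 + \<eta>) * h x)" .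
    have "?m \<noteq> \<top>" using le by (auto simp: top_unique)
    then obtain m where m: "?m = ennreal m" "0 \<le> m" by (cases ?m) auto
    have "2 * (1 - \<eta>)\<^sup>2 * h x + m \<le> (2 + \<eta>) * h x"
      using le hx m \<eta> by (simp add: ennreal_le_iff flip: ennreal_plus)
    then have "m \<le> (5 * \<eta> - 2 * \<eta>\<^sup>2) * h x" by (simp add: algebra_simps power2_eq_square)
    also have "\<dots> \<le> \<delta> * h x" using \<eta> hx by (intro mult_right_mono) (auto intro: order_trans[of _ "5 * \<eta>"])
    finally show "?m \<le> ennreal (\<delta> * h x)" unfolding m by (rule ennreal_leI)
  qed
qed

text \<open>
  The two ends contribute about \<open>h x\<close> each; this needs only long-tailedness. So a negligible middle
  part makes the convolution asymptotic to \<open>2 * h x\<close>.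
\<close>
lemma negligible_middle_imp_subexp_density:
  assumes h: "halfline_density h" and l: "long_tailed h" and u: "uniformly_long_tailed h"
    and t: "negligible_middle h"
  shows "subexp_density h"
proof -
  have [measurable]: "h \<in> borel_measurable borel" using halfline_densityD(1)[OF h] .
  have main: "\<forall>\<^sub>F x in at_top. 0 < h x \<and> (2 - \<epsilon>) * h x \<le> density_conv h h x \<and> density_conv h h x \<le> (2 + \<epsilon>) * h x"
    if \<epsilon>: "0 < \<epsilon>" for \<epsilon>
  proof -
    define \<eta> where "\<eta> = min (1/2) (\<epsilon> / 4)"
    have \<eta>: "0 < \<eta>" "\<eta> < 1" "4 * \<eta> \<le> \<epsilon>" using \<epsilon> by (auto simp: \<eta>_def min_def)
    obtain K1 X0 where K1: "0 \<le> K1" and X0: "\<And>x. X0 \<le> x \<Longrightarrow> conv_part h h {K1<..<x - K1} x \<le> ennreal (\<eta> * h x)"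
      using t \<eta>(1) unfolding negligible_middle_def by metis
    obtain K2 where K2: "\<And>K. K2 \<le> K \<Longrightarrow> ennreal (1 - \<eta>) \<le> (\<integral>\<^sup>+v. ennreal (h v) * indicator {0..K} v \<partial>lborel)"
      using halfline_density_mass[OF h \<eta>(1)] by metis
    define K where "K = max K1 K2"
    have K: "0 \<le> K" "K1 \<le> K" "K2 \<le> K" using K1 by (auto simp: K_def)
    obtain X1 where X1: "\<And>x. X1 \<le> x \<Longrightarrow> 0 < h x"
      "\<And>x v. X1 \<le> x \<Longrightarrow> 0 \<le> v \<Longrightarrow> v \<le> K \<Longrightarrow> (1 - \<eta>) * h x \<le> h (x - v)"
      "\<And>x v. X1 \<le> x \<Longrightarrow> 0 \<le> v \<Longrightarrow> v \<le> K \<Longrightarrow> h (x - v) \<le> (1 + \<eta>) * h x"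
      using uniformly_long_tailedD[OF u \<eta>(1) K(1)] by metis
    show ?thesis
      using eventually_ge_at_top[of "max (max X0 X1) (2 * K + 1)"]
    proof eventually_elim
      fix x assume x: "max (max X0 X1) (2 * K + 1) \<le> x"
      have hx: "0 < h x" using X1(1) x by auto
      have nn: "0 \<le> (1 - \<eta>) * h x" "0 \<le> (1 + \<eta>) * h x" using hx \<eta> by simp_all
      let ?m = "conv_part h h {K<..<x - K} x"
      have far: "conv_part h h {x - K..x} x = conv_part h h {0..K} x"
        by (subst conv_part_reflect) (auto intro!: arg_cong[where f="\<lambda>S. conv_part h h S x"])
      have split: "conv_part h h UNIV x = conv_part h h {0..K} x + (?m + conv_part h h {0..K} x)"
      proof -
        have "conv_part h h UNIV x = conv_part h h {0..x} x"
          by (intro conv_part_cong_support[OF h h]) auto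
        also have "\<dots> = conv_part h h {0..K} x + (?m + conv_part h h {x - K..x} x)"
          using x K by (intro conv_part_split3) auto
        finally show ?thesis unfolding far .
      qed
      have m: "?m \<le> ennreal (\<eta> * h x)"
        using x K by (intro order_trans[OF conv_part_mono X0]) auto
      have up: "conv_part h h {0..K} x \<le> ennreal ((1 + \<eta>) * h x)"
        using X1 x \<eta> hx nn by (intro conv_part_near_le[OF h]) auto
      have "ennreal ((1 - \<eta>)\<^sup>2 * h x) = ennreal ((1 - \<eta>) * h x) * ennreal (1 - \<eta>)"
        using \<eta> hx by (subst ennreal_mult[symmetric]) (auto simp: power2_eq_square algebra_simps)
      also have "\<dots> \<le> ennreal ((1 - \<eta>) * h x) * (\<integral>\<^sup>+v. ennreal (h v) * indicator {0..K} v \<partial>lborel)"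
        by (intro mult_left_mono K2 K) auto
      also have "\<dots> \<le> conv_part h h {0..K} x"
        using X1 x \<eta> hx nn by (intro conv_part_near_ge[OF h]) auto
      finally have lo: "ennreal ((1 - \<eta>)\<^sup>2 * h x) \<le> conv_part h h {0..K} x" .
      have "conv_part h h UNIV x \<le> ennreal ((1 + \<eta>) * h x) + (ennreal (\<eta> * h x) + ennreal ((1 + \<eta>) * h x))"
        unfolding split by (intro add_mono up m)
      also have "\<dots> = ennreal ((2 + 3 * \<eta>) * h x)"
        using hx \<eta> by (simp add: algebra_simps flip: ennreal_plus)
      finally have U: "conv_part h h UNIV x \<le> ennreal ((2 + 3 * \<eta>) * h x)" .
      have "ennreal (2 * (1 - \<eta>)\<^sup>2 * h x) = ennreal ((1 - \<eta>)\<^sup>2 * h x) + (0 + ennreal ((1 - \<eta>)\<^sup>2 * h x))"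
        using hx by (simp flip: ennreal_plus)
      also have "\<dots> \<le> conv_part h h UNIV x"
        unfolding split by (intro add_mono lo) auto
      finally have L: "ennreal (2 * (1 - \<eta>)\<^sup>2 * h x) \<le> conv_part h h UNIV x" .
      have "conv_part h h UNIV x \<noteq> \<top>" using U by (auto simp: top_unique)
      then obtain m where m: "conv_part h h UNIV x = ennreal m" "0 \<le> m" by (cases "conv_part h h UNIV x") auto
      have dc: "density_conv h h x = m" unfolding density_conv_eq[OF h h] m(1) using m(2) by simp
      have "m \<le> (2 + 3 * \<eta>) * h x" "2 * (1 - \<eta>)\<^sup>2 * h x \<le> m"
        using U L hx \<eta> m by (auto simp: ennreal_le_iff)
      moreover have "(2 + 3 * \<eta>) * h x \<le> (2 + \<epsilon>) * h x" using \<eta> hx by (intro mult_right_mono) auto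
      moreover have "(2 - \<epsilon>) * h x \<le> 2 * (1 - \<eta>)\<^sup>2 * h x"
      proof (intro mult_right_mono)
        have "2 - \<epsilon> \<le> 2 - 4 * \<eta> + 2 * \<eta>\<^sup>2" using \<eta> by (intro add_increasing2) auto
        then show "2 - \<epsilon> \<le> 2 * (1 - \<eta>)\<^sup>2" by (simp add: power2_eq_square algebra_simps)
      qed (use hx in auto)
      ultimately show "0 < h x \<and> (2 - \<epsilon>) * h x \<le> density_conv h h x \<and> density_conv h h x \<le> (2 + \<epsilon>) * h x"
        unfolding dc using hx by linarith
    qed
  qed
  have pos: "\<forall>\<^sub>F x in at_top. 0 < density_conv h h x \<and> 0 < 2 * h x"
    using main[of 1, simplified] by eventually_elim linarith
  have "((\<lambda>x. density_conv h h x / (2 * h x)) \<longlongrightarrow> 1) at_top"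
  proof (rule tendstoI)
    fix e :: real assume "0 < e"
    show "\<forall>\<^sub>F x in at_top. dist (density_conv h h x / (2 * h x)) 1 < e"
      using main[of e, OF \<open>0 < e\<close>]
    proof eventually_elim
      case (elim x)
      then have "density_conv h h x / (2 * h x) \<le> (2 + e) / 2" "(2 - e) / 2 \<le> density_conv h h x / (2 * h x)"
        by (auto simp: field_simps)
      moreover have "(2 + e) / 2 < 1 + e" "1 - e < (2 - e) / 2" using elim \<open>0 < e\<close> by auto
      ultimately show ?case by (auto simp: dist_real_def abs_less_iff)
    qed
  qed
  then show ?thesis
    unfolding subexp_density_def tail_equiv_iff long_tailed_density_def using pos l h by (auto simp: halfline_density_def)
qed

lemma tendsto_ratio_bounds:
  fixes f h :: "real \<Rightarrow> real"
  assumes "((\<lambda>x. f x / h x) \<longlongrightarrow> c) at_top" "\<forall>\<^sub>F x in at_top. 0 < h x" "a < c" "c < b"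
  obtains X where "\<And>x. X \<le> x \<Longrightarrow> a * h x \<le> f x" "\<And>x. X \<le> x \<Longrightarrow> f x \<le> b * h x" "\<And>x. X \<le> x \<Longrightarrow> 0 < h x"
proof -
  have "\<forall>\<^sub>F x in at_top. a < f x / h x" "\<forall>\<^sub>F x in at_top. f x / h x < b"
    using assms by (auto intro: order_tendstoD)
  with assms(2) have "\<forall>\<^sub>F x in at_top. a * h x \<le> f x \<and> f x \<le> b * h x \<and> 0 < h x"
    by eventually_elim (auto simp: field_simps)
  then show ?thesis using that by (auto simp: eventually_at_top_linorder)
qed

lemma negligible_middle_tail_equiv:
  assumes "negligible_middle h" and f: "halfline_density f" and h: "halfline_density h"
    and lim: "((\<lambda>x. f x / h x) \<longlongrightarrow> c) at_top" "\<forall>\<^sub>F x in at_top. 0 < h x" "0 < c"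
  shows "negligible_middle f"
  unfolding negligible_middle_def
proof (intro allI impI)
  fix \<delta> :: real assume \<delta>: "0 < \<delta>"
  obtain Y where Y: "\<And>x. Y \<le> x \<Longrightarrow> c / 2 * h x \<le> f x" "\<And>x. Y \<le> x \<Longrightarrow> f x \<le> 2 * c * h x" "\<And>x. Y \<le> x \<Longrightarrow> 0 < h x"
    using tendsto_ratio_bounds[OF lim(1,2), of "c/2" "2 * c"] lim(3) by auto
  obtain K X where K: "0 \<le> K" and X: "\<And>x. X \<le> x \<Longrightarrow> conv_part h h {K<..<x - K} x \<le> ennreal (\<delta> / (8 * c) * h x)"
    using assms(1) \<delta> lim(3) unfolding negligible_middle_def by (metis divide_pos_pos mult_pos_pos zero_less_numeral)
  have [measurable]: "f \<in> borel_measurable borel" "h \<in> borel_measurable borel"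
    using halfline_densityD(1) f h by auto
  show "\<exists>K\<ge>0. \<exists>X. \<forall>x\<ge>X. conv_part f f {K<..<x - K} x \<le> ennreal (\<delta> * f x)"
  proof (rule exI[of _ "max K Y"], intro conjI exI[of _ "max X Y"] allI impI)
    fix x assume x: "max X Y \<le> x"
    have "conv_part f f {max K Y<..<x - max K Y} x \<le>
        (\<integral>\<^sup>+v. ennreal (4 * c\<^sup>2) * (ennreal (h (x - v) * h v) * indicator {K<..<x - K} v) \<partial>lborel)"
      unfolding conv_part_def
    proof (intro nn_integral_mono)
      fix v
      show "ennreal (f (x - v) * f v) * indicator {max K Y<..<x - max K Y} v
        \<le> ennreal (4 * c\<^sup>2) * (ennreal (h (x - v) * h v) * indicator {K<..<x - K} v)"
      proof (cases "v \<in> {max K Y<..<x - max K Y}")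
        case True
        then have v: "Y \<le> v" "Y \<le> x - v" "v \<in> {K<..<x - K}" by auto
        have "f (x - v) * f v \<le> (2 * c * h (x - v)) * (2 * c * h v)"
          using Y v halfline_densityD(2)[OF f] lim(3) less_imp_le[OF Y(3)] by (intro mult_mono) auto
        also have "\<dots> = 4 * c\<^sup>2 * (h (x - v) * h v)" by (simp add: power2_eq_square algebra_simps)
        finally show ?thesis using v True halfline_densityD(2)[OF h]
          by (auto simp: ennreal_mult'[symmetric] intro!: ennreal_leI)
      qed auto
    qed
    also have "\<dots> = ennreal (4 * c\<^sup>2) * conv_part h h {K<..<x - K} x"
      unfolding conv_part_def by (subst nn_integral_cmult) auto
    also have "\<dots> \<le> ennreal (4 * c\<^sup>2) * ennreal (\<delta> / (8 * c) * h x)"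
      using x by (intro mult_left_mono X) auto
    also have "\<dots> = ennreal (\<delta> * (c / 2 * h x))"
      using lim(3) \<delta> Y(3)[of x] x by (subst ennreal_mult'[symmetric]) (auto simp: field_simps power2_eq_square)
    also have "\<dots> \<le> ennreal (\<delta> * f x)"
      using \<delta> Y x by (intro ennreal_leI mult_left_mono) auto
    finally show "conv_part f f {max K Y<..<x - max K Y} x \<le> ennreal (\<delta> * f x)" .
  qed (use K in auto)
qed

lemma long_tailed_cong:
  assumes h: "long_tailed h" and f: "f \<in> borel_measurable borel" "\<And>x. 0 \<le> f x"
    and lim: "((\<lambda>x. f x / h x) \<longlongrightarrow> c) at_top" "0 < c"
  shows "long_tailed f"
  unfolding long_tailed_def
proof (intro conjI allI f)
  fix a
  have te: "tail_equiv (\<lambda>x. h (x + a)) h" using h by (simp add: long_tailed_def)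
  have sh: "filterlim (\<lambda>x::real. x + a) at_top at_top"
    using filterlim_tendsto_add_at_top[OF tendsto_const[of a] filterlim_ident] by (simp add: add.commute)
  have lim_a: "((\<lambda>x. f (x + a) / h (x + a)) \<longlongrightarrow> c) at_top"
    using filterlim_compose[OF lim(1) sh] by simp
  have pos: "\<forall>\<^sub>F x in at_top. 0 < h (x + a) \<and> 0 < h x" using te unfolding tail_equiv_iff by auto
  have fpos: "\<forall>\<^sub>F x in at_top. 0 < f x"
    using order_tendstoD(1)[OF lim] by eventually_elim (metis f(2) div_0 less_eq_real_def less_irrefl)
  have "\<forall>\<^sub>F x in at_top. 0 < f (x + a)"
    using sh fpos by (rule eventually_compose_filterlim[rotated])
  then have fpos2: "\<forall>\<^sub>F x in at_top. 0 < f (x + a) \<and> 0 < f x"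
    using fpos by eventually_elim auto
  show "tail_equiv (\<lambda>x. f (x + a)) f"
    unfolding tail_equiv_iff
  proof (intro conjI fpos2)
    have "((\<lambda>x. (f (x + a) / h (x + a)) * (h (x + a) / h x) / (f x / h x)) \<longlongrightarrow> c * 1 / c) at_top"
      using te lim lim_a unfolding tail_equiv_iff by (intro tendsto_intros) auto
    moreover have "\<forall>\<^sub>F x in at_top. (f (x + a) / h (x + a)) * (h (x + a) / h x) / (f x / h x) = f (x + a) / f x"
      using pos by eventually_elim auto
    ultimately have "((\<lambda>x. f (x + a) / f x) \<longlongrightarrow> c * 1 / c) at_top"
      by (rule Lim_transform_eventually)
    then show "((\<lambda>x. f (x + a) / f x) \<longlongrightarrow> 1) at_top"
      using lim(2) by simp
  qed
qed

text \<open>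
  Subexponentiality of a density depends only on its tail up to a constant factor: the passage through
  negligible middle parts avoids the comparison of the two convolutions.
\<close>
lemma subexp_density_cong:
  assumes s: "subexp_density h" and h: "halfline_density h" "continuous_on UNIV h"
    and f: "halfline_density f" "continuous_on UNIV f"
    and lim: "((\<lambda>x. f x / h x) \<longlongrightarrow> c) at_top" "0 < c"
  shows "subexp_density f"
proof -
  have lh: "long_tailed h" using s by (simp add: subexp_density_def long_tailed_density_def)
  have lf: "long_tailed f" using halfline_densityD[OF f(1)] by (intro long_tailed_cong[OF lh _ _ lim])
  have "\<forall>\<^sub>F x in at_top. 0 < h x"
    using s unfolding subexp_density_def tail_equiv_iff by (auto elim: eventually_mono)
  then have "negligible_middle f"
    using negligible_middle_tail_equiv[OF _ f(1) h(1) lim(1) _ lim(2)]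
      subexp_density_imp_negligible_middle[OF h(1) long_tailed_uniform[OF lh h(2)] s] by blast
  then show ?thesis
    by (rule negligible_middle_imp_subexp_density[OF f(1) lf long_tailed_uniform[OF lf f(2)]])
qed

section \<open>Convolution semigroups of densities and size biasing\<close>

text \<open>
  Cauchy's functional equation on an interval: a nonnegative additive function is monotone, so its
  values on the grid of multiples of \<open>T / n\<close> determine it up to \<open>h T / n\<close>.
\<close>
lemma additive_nonneg_linear:
  fixes h :: "real \<Rightarrow> real"
  assumes nonneg: "\<And>r. 0 < r \<Longrightarrow> r \<le> T \<Longrightarrow> 0 \<le> h r"
    and add: "\<And>r s. 0 < r \<Longrightarrow> 0 < s \<Longrightarrow> r + s \<le> T \<Longrightarrow> h (r + s) = h r + h s"
    and r: "0 < r" "r \<le> T"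
  shows "h r = r / T * h T"
proof -
  have T: "0 < T" using r by simp
  have mono: "h a \<le> h b" if "0 < a" "a \<le> b" "b \<le> T" for a b
  proof (cases "a = b")
    case False
    then have "h (a + (b - a)) = h a + h (b - a)" using that by (intro add) auto
    then show ?thesis using nonneg[of "b - a"] that False by auto
  qed simp
  have bound: "\<bar>h r - r / T * h T\<bar> \<le> h T / real n" if n: "0 < n" for n :: nat
  proof -
    define d where "d = T / real n"
    have d: "0 < d" "real n * d = T" using T n by (auto simp: d_def)
    have mult: "0 < k \<Longrightarrow> k \<le> n \<Longrightarrow> h (real k * d) = real k * h d" for k
    proof (induction k)
      case (Suc k)
      show ?case
      proof (cases "k = 0")
        case False
        have "real k * d + d \<le> T"
          using Suc.prems d mult_right_mono[of "real (Suc k)" "real n" d] by (simp add: algebra_simps)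
        then have "h (real k * d + d) = h (real k * d) + h d" using False d by (intro add) auto
        then show ?thesis using Suc False by (simp add: algebra_simps)
      qed simp
    qed simp
    have hd: "h d = h T / real n" using mult[of n] d n by (simp add: field_simps)
    have hT: "0 \<le> h T" using nonneg T by auto
    define k where "k = nat \<lfloor>r / d\<rfloor>"
    have "real k = of_int \<lfloor>r / d\<rfloor>" unfolding k_def using r d by simp
    then have "real k \<le> r / d" "r / d < real k + 1" by linarith+
    then have k: "real k * d \<le> r" "r < real (Suc k) * d" using d by (auto simp: field_simps)
    have "real k * d \<le> real n * d" using k r d by simp
    then have kn: "k \<le> n" using d(1) by (simp only: mult_le_cancel_right_pos of_nat_le_iff)
    have lo: "real k * h d \<le> h r"
      using mono[of "real k * d" r] mult[of k] k kn d r nonneg[of r] by (cases "k = 0") auto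
    have hi: "h r \<le> real (Suc k) * h d"
    proof (cases "k = n")
      case True
      then have "r = T" using k d r by auto
      then show ?thesis using True n hT by (simp add: hd field_simps)
    next
      case False
      then have "Suc k \<le> n" using kn by simp
      moreover from this have "real (Suc k) * d \<le> T"
        using mult_right_mono[of "real (Suc k)" "real n" d] d by simp
      ultimately show ?thesis
        using mono[of r "real (Suc k) * d"] mult[of "Suc k"] k r by auto
    qed
    have q: "real k \<le> r / T * real n" "r / T * real n \<le> real (Suc k)"
      using k T n by (auto simp: d_def field_simps)
    have eq: "r / T * h T = r / T * real n * h d" using n by (simp add: hd)
    have "0 \<le> h d" using hT by (simp add: hd)
    then have "real k * h d \<le> r / T * h T" "r / T * h T \<le> real (Suc k) * h d"
      unfolding eq using mult_right_mono[OF q(1)] mult_right_mono[OF q(2)] by blast+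
    then have "\<bar>h r - r / T * h T\<bar> \<le> real (Suc k) * h d - real k * h d" using lo hi by linarith
    also have "\<dots> = h T / real n" by (simp add: hd algebra_simps add_divide_distrib)
    finally show ?thesis .
  qed
  have "\<bar>h r - r / T * h T\<bar> \<le> 0"
  proof (rule tendsto_lowerbound)
    show "(\<lambda>n. h T / real n) \<longlonglongrightarrow> 0" by (rule lim_const_over_n)
    show "\<forall>\<^sub>F n in sequentially. \<bar>h r - r / T * h T\<bar> \<le> h T / real n"
      using eventually_gt_at_top[of 0] by eventually_elim (rule bound)
  qed simp
  then show ?thesis by simp
qed

definition nn_conv :: "(real \<Rightarrow> ennreal) \<Rightarrow> (real \<Rightarrow> ennreal) \<Rightarrow> real \<Rightarrow> ennreal" where
  "nn_conv F G x = (\<integral>\<^sup>+v. F (x - v) * G v \<partial>lborel)"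

lemma nn_conv_measurable [measurable]:
  assumes [measurable]: "F \<in> borel_measurable borel" "G \<in> borel_measurable borel"
  shows "nn_conv F G \<in> borel_measurable borel"
  unfolding nn_conv_def by measurable

lemma nn_conv_commute:
  assumes [measurable]: "F \<in> borel_measurable borel" "G \<in> borel_measurable borel"
  shows "nn_conv F G = nn_conv G F"
proof
  fix x
  have "nn_conv F G x = (\<integral>\<^sup>+v. F (x - (x - v)) * G (x - v) \<partial>lborel)"
    unfolding nn_conv_def by (rule nn_integral_lborel_reflect[symmetric]) measurable
  then show "nn_conv F G x = nn_conv G F x" by (simp add: nn_conv_def mult.commute)
qed

lemma nn_conv_assoc:
  assumes [measurable]: "F \<in> borel_measurable borel" "G \<in> borel_measurable borel" "H \<in> borel_measurable borel"
  shows "nn_conv (nn_conv F G) H = nn_conv F (nn_conv G H)"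
proof
  fix x
  have "nn_conv F (nn_conv G H) x = (\<integral>\<^sup>+v. (\<integral>\<^sup>+u. F (x - v) * (G (v - u) * H u) \<partial>lborel) \<partial>lborel)"
    unfolding nn_conv_def by (intro nn_integral_cong nn_integral_cmult[symmetric]) measurable
  also have "\<dots> = (\<integral>\<^sup>+u. (\<integral>\<^sup>+v. F (x - v) * (G (v - u) * H u) \<partial>lborel) \<partial>lborel)"
    by (rule lborel_pair.Fubini') measurable
  also have "\<dots> = (\<integral>\<^sup>+u. (\<integral>\<^sup>+v. F (x - u - v) * G v * H u \<partial>lborel) \<partial>lborel)"
  proof (rule nn_integral_cong)
    fix u
    have "(\<integral>\<^sup>+v. F (x - v) * (G (v - u) * H u) \<partial>lborel) =
      (\<integral>\<^sup>+v. (\<lambda>w. F (x - u - w) * G w * H u) (v - u) \<partial>lborel)"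
      by (intro nn_integral_cong) (simp add: ac_simps)
    also have "\<dots> = (\<integral>\<^sup>+v. F (x - u - v) * G v * H u \<partial>lborel)"
      by (rule nn_integral_lborel_shift) measurable
    finally show "(\<integral>\<^sup>+v. F (x - v) * (G (v - u) * H u) \<partial>lborel) = (\<integral>\<^sup>+v. F (x - u - v) * G v * H u \<partial>lborel)" .
  qed
  also have "\<dots> = nn_conv (nn_conv F G) H x"
    unfolding nn_conv_def by (intro nn_integral_cong nn_integral_multc) measurable
  finally show "nn_conv (nn_conv F G) H x = nn_conv F (nn_conv G H) x" by simp
qed

lemma nn_conv_add_left:
  assumes [measurable]: "F \<in> borel_measurable borel" "G \<in> borel_measurable borel" "H \<in> borel_measurable borel"
  shows "nn_conv (\<lambda>x. F x + G x) H x = nn_conv F H x + nn_conv G H x"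
  unfolding nn_conv_def by (subst nn_integral_add[symmetric]) (auto simp: distrib_right)

lemma conv_part_UNIV:
  assumes "halfline_density g"
  shows "conv_part f g UNIV x = nn_conv (\<lambda>x. ennreal (f x)) (\<lambda>x. ennreal (g x)) x"
  unfolding conv_part_def nn_conv_def using halfline_densityD(2)[OF assms]
  by (auto simp: ennreal_mult'')

locale density_semigroup =
  fixes p :: "real \<Rightarrow> real \<Rightarrow> real"
  assumes halfline: "0 < t \<Longrightarrow> halfline_density (p t)"
    and cont: "0 < t \<Longrightarrow> continuous_on UNIV (p t)"
    and conv: "0 < s \<Longrightarrow> 0 < t \<Longrightarrow> conv_part (p s) (p t) UNIV x = ennreal (p (s + t) x)"
begin

lemma p_nonneg: "0 < t \<Longrightarrow> 0 \<le> p t x"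
  and p_neg: "0 < t \<Longrightarrow> x < 0 \<Longrightarrow> p t x = 0"
  and p_measurable: "0 < t \<Longrightarrow> p t \<in> borel_measurable borel"
  and p_integral: "0 < t \<Longrightarrow> (\<integral>\<^sup>+x. ennreal (p t x) \<partial>lborel) = 1"
  using halfline_densityD[OF halfline] by auto

lemma nn_conv_p:
  assumes "0 < s" "0 < t"
  shows "nn_conv (\<lambda>x. ennreal (p s x)) (\<lambda>x. ennreal (p t x)) = (\<lambda>x. ennreal (p (s + t) x))"
  using conv[OF assms] conv_part_UNIV[OF halfline[OF assms(2)]] by (auto simp: fun_eq_iff)

text \<open>
  Multiplication by the variable is a derivation of the convolution algebra, since
  \<open>x = (x - v) + v\<close>.
\<close>
lemma size_biased_Leibniz:
  assumes st: "0 < s" "0 < t"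
  shows "ennreal (x * p (s + t) x) =
    nn_conv (\<lambda>x. ennreal (x * p s x)) (\<lambda>x. ennreal (p t x)) x + nn_conv (\<lambda>x. ennreal (p s x)) (\<lambda>x. ennreal (x * p t x)) x"
proof -
  have [measurable]: "p s \<in> borel_measurable borel" "p t \<in> borel_measurable borel"
    using p_measurable st by auto
  have "ennreal (x * p (s + t) x) = ennreal x * ennreal (p (s + t) x)"
    using p_nonneg[of "s + t" x] p_neg[of "s + t" x] st
    by (cases "x < 0") (auto simp: ennreal_mult)
  also have "ennreal (p (s + t) x) = nn_conv (\<lambda>x. ennreal (p s x)) (\<lambda>x. ennreal (p t x)) x"
    by (simp add: nn_conv_p st)
  also have "ennreal x * nn_conv (\<lambda>x. ennreal (p s x)) (\<lambda>x. ennreal (p t x)) x =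
    (\<integral>\<^sup>+v. ennreal x * (ennreal (p s (x - v)) * ennreal (p t v)) \<partial>lborel)"
    unfolding nn_conv_def by (intro nn_integral_cmult[symmetric]) measurable
  also have "\<dots> = (\<integral>\<^sup>+v. ennreal ((x - v) * p s (x - v)) * ennreal (p t v) +
       ennreal (p s (x - v)) * ennreal (v * p t v) \<partial>lborel)"
  proof (intro nn_integral_cong)
    fix v
    show "ennreal x * (ennreal (p s (x - v)) * ennreal (p t v)) =
      ennreal ((x - v) * p s (x - v)) * ennreal (p t v) + ennreal (p s (x - v)) * ennreal (v * p t v)"
    proof (cases "v < 0 \<or> x - v < 0")
      case True
      then show ?thesis using p_neg[of t v] p_neg[of s "x - v"] st by auto
    next
      case False
      then have "0 \<le> v" "0 \<le> x - v" "0 \<le> x" "0 \<le> p t v" "0 \<le> p s (x - v)"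
        using p_nonneg st by auto
      moreover have "x * (p s (x - v) * p t v) = (x - v) * p s (x - v) * p t v + p s (x - v) * (v * p t v)"
        by (simp add: algebra_simps)
      ultimately show ?thesis
        by (simp only: ennreal_mult[symmetric] ennreal_plus[symmetric] mult_nonneg_nonneg)
    qed
  qed
  also have "\<dots> = nn_conv (\<lambda>x. ennreal (x * p s x)) (\<lambda>x. ennreal (p t x)) x +
      nn_conv (\<lambda>x. ennreal (p s x)) (\<lambda>x. ennreal (x * p t x)) x"
    unfolding nn_conv_def by (intro nn_integral_add) measurable
  finally show ?thesis .
qed

text \<open>
  Conditionally on the value \<open>x\<close> at time \<open>s + t\<close>, the process with these densities has the value
  \<open>x * s / (s + t)\<close> at time \<open>s\<close> in the mean, because increments over equal times are exchangeable. For arbitrary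
  real times: with \<open>T = s + t\<close> fixed, the left-hand side is additive in \<open>s\<close> by the Leibniz rule, and a
  nonnegative additive function is linear. No moment of the densities is involved, as all integrals run
  over \<open>[0, x]\<close>.
\<close>
lemma size_biased_conv:
  assumes st: "0 < s" "0 < t"
  shows "(\<integral>\<^sup>+v. ennreal ((x - v) * p s (x - v) * p t v) \<partial>lborel) = ennreal (s / (s + t) * (x * p (s + t) x))"
proof -
  define T where "T = s + t"
  define H where "H r = nn_conv (\<lambda>x. ennreal (x * p r x)) (\<lambda>x. ennreal (p (T - r) x)) x" for r
  have [measurable]: "p r \<in> borel_measurable borel" if "0 < r" for r using p_measurable that by auto
  have total: "H r + H (T - r) = ennreal (x * p T x)" if r: "0 < r" "r < T" for r
  proof -
    have "nn_conv (\<lambda>x. ennreal (p r x)) (\<lambda>x. ennreal (x * p (T - r) x)) =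
      nn_conv (\<lambda>x. ennreal (x * p (T - r) x)) (\<lambda>x. ennreal (p r x))"
      using r by (intro nn_conv_commute) measurable
    then show ?thesis
      using size_biased_Leibniz[of r "T - r" x] r by (simp add: H_def)
  qed
  have add: "H (r + r') = H r + H r'" if r: "0 < r" "0 < r'" "r + r' < T" for r r'
  proof -
    let ?P = "\<lambda>r x. ennreal (p r x)" and ?V = "\<lambda>r x. ennreal (x * p r x)" and ?q = "T - (r + r')"
    have [measurable]: "p r \<in> borel_measurable borel" "p r' \<in> borel_measurable borel" "p ?q \<in> borel_measurable borel"
      using p_measurable r by auto
    have "H (r + r') = nn_conv (\<lambda>x. nn_conv (?V r) (?P r') x + nn_conv (?P r) (?V r') x) (?P ?q) x"
      unfolding H_def size_biased_Leibniz[OF r(1,2)] ..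
    also have "\<dots> = nn_conv (nn_conv (?V r) (?P r')) (?P ?q) x + nn_conv (nn_conv (?P r) (?V r')) (?P ?q) x"
      by (rule nn_conv_add_left) measurable
    also have "nn_conv (nn_conv (?V r) (?P r')) (?P ?q) = nn_conv (?V r) (nn_conv (?P r') (?P ?q))"
      by (rule nn_conv_assoc) measurable
    also have "nn_conv (?P r') (?P ?q) = ?P (T - r)"
      using r by (subst nn_conv_p) (auto simp: algebra_simps)
    also have "nn_conv (?P r) (?V r') = nn_conv (?V r') (?P r)" by (rule nn_conv_commute) measurable
    also have "nn_conv (nn_conv (?V r') (?P r)) (?P ?q) = nn_conv (?V r') (nn_conv (?P r) (?P ?q))"
      by (rule nn_conv_assoc) measurable
    also have "nn_conv (?P r) (?P ?q) = ?P (T - r')"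
      using r by (subst nn_conv_p) (auto simp: algebra_simps)
    finally show ?thesis by (simp add: H_def)
  qed
  have fin: "H r \<noteq> \<top>" if "0 < r" "r < T" for r
    using total[OF that] by (metis ennreal_add_eq_top ennreal_neq_top)
  have xp: "0 \<le> x * p T x" using p_nonneg[of T x] p_neg[of T x] st by (cases "x < 0") (auto simp: T_def)
  define h where "h r = (if r = T then x * p T x else enn2real (H r))" for r
  have "h s = s / T * h T"
  proof (rule additive_nonneg_linear)
    show "0 \<le> h r" for r using xp by (simp add: h_def)
    show "h (r + r') = h r + h r'" if r: "0 < r" "0 < r'" "r + r' \<le> T" for r r'
    proof (cases "r + r' = T")
      case True
      then have d: "T - r = r'" by simp
      have "r < T" using True r by simp
      then have "H r + H r' = ennreal (x * p T x)" using total[OF r(1)] unfolding d by blast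
      then have "x * p T x = enn2real (H r + H r')" using xp by simp
      also have "\<dots> = enn2real (H r) + enn2real (H r')"
        using r True fin[of r] fin[of r'] by (subst enn2real_plus) (auto simp: less_top)
      finally show ?thesis using True r by (auto simp: h_def)
    next
      case False
      then show ?thesis
        using r add[of r r'] fin[of r] fin[of r'] by (auto simp: h_def enn2real_plus less_top)
    qed
  qed (use st in \<open>auto simp: T_def\<close>)
  then have "enn2real (H s) = s / T * (x * p T x)" using st by (simp add: h_def T_def)
  moreover have "H s \<noteq> \<top>" using fin[of s] st by (simp add: T_def)
  ultimately have "H s = ennreal (s / T * (x * p T x))" by (metis ennreal_enn2real_if)
  moreover have "H s = (\<integral>\<^sup>+v. ennreal ((x - v) * p s (x - v) * p t v) \<partial>lborel)"
    unfolding H_def nn_conv_def T_def using p_nonneg[OF st(2)]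
    by (simp add: ennreal_mult'')
  ultimately show ?thesis by (simp add: T_def)
qed

end

section \<open>The tail ratio of two times, and negligible middle parts\<close>

lemma conv_part_near_lower:
  assumes f: "uniformly_long_tailed f" and g: "halfline_density g" and \<eta>: "0 < \<eta>" "\<eta> < 1"
  obtains K where "0 \<le> K" "\<forall>\<^sub>F x in at_top. 0 < f x \<and> ennreal ((1 - \<eta>)\<^sup>2 * f x) \<le> conv_part f g {0..K} x"
proof -
  obtain K where K: "0 \<le> K" "ennreal (1 - \<eta>) \<le> (\<integral>\<^sup>+v. ennreal (g v) * indicator {0..K} v \<partial>lborel)"
    using halfline_density_mass[OF g \<eta>(1)] by (metis order_refl)
  obtain X where X: "\<And>x. X \<le> x \<Longrightarrow> 0 < f x"
    "\<And>x v. X \<le> x \<Longrightarrow> 0 \<le> v \<Longrightarrow> v \<le> K \<Longrightarrow> (1 - \<eta>) * f x \<le> f (x - v)"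
    using uniformly_long_tailedD[OF f \<eta>(1) K(1)] by metis
  have "\<forall>\<^sub>F x in at_top. 0 < f x \<and> ennreal ((1 - \<eta>)\<^sup>2 * f x) \<le> conv_part f g {0..K} x"
    using eventually_ge_at_top[of X]
  proof eventually_elim
    fix x assume x: "X \<le> x"
    then have fx: "0 < f x" by (rule X)
    have nn: "0 \<le> (1 - \<eta>) * f x" using fx \<eta> by simp
    have "ennreal ((1 - \<eta>)\<^sup>2 * f x) = ennreal ((1 - \<eta>) * f x) * ennreal (1 - \<eta>)"
      using \<eta> fx by (subst ennreal_mult[symmetric]) (auto simp: power2_eq_square algebra_simps)
    also have "\<dots> \<le> ennreal ((1 - \<eta>) * f x) * (\<integral>\<^sup>+v. ennreal (g v) * indicator {0..K} v \<partial>lborel)"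
      by (intro mult_left_mono K(2)) auto
    also have "\<dots> \<le> conv_part f g {0..K} x"
      using X x nn by (intro conv_part_near_ge[OF g]) auto
    finally show "0 < f x \<and> ennreal ((1 - \<eta>)\<^sup>2 * f x) \<le> conv_part f g {0..K} x" using fx by simp
  qed
  with K(1) show ?thesis by (rule that)
qed

text \<open>
  A one-sided version of \<open>negligible_middle\<close> for two densities: large but not dominant values of the
  second summand are negligible relative to \<open>f\<close>.
\<close>
definition negligible_lower_middle :: "(real \<Rightarrow> real) \<Rightarrow> (real \<Rightarrow> real) \<Rightarrow> bool" where
  "negligible_lower_middle f g \<longleftrightarrow>
     (\<forall>\<delta>>0. \<exists>K\<ge>0. \<forall>\<^sub>F x in at_top. conv_part f g {K<..x / 2} x \<le> ennreal (\<delta> * f x))"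

context density_semigroup
begin

lemma conv_part_finite:
  assumes "0 < s" "0 < t"
  obtains m where "0 \<le> m" "conv_part (p s) (p t) S x = ennreal m" "m \<le> p (s + t) x"
proof -
  have le: "conv_part (p s) (p t) S x \<le> ennreal (p (s + t) x)"
    unfolding conv[OF assms, symmetric] by (rule conv_part_mono) simp
  then have "conv_part (p s) (p t) S x \<noteq> \<top>" by (auto simp: top_unique)
  then obtain m where m: "0 \<le> m" "conv_part (p s) (p t) S x = ennreal m"
    by (cases "conv_part (p s) (p t) S x") auto
  moreover have "m \<le> p (s + t) x" using le m p_nonneg[of "s + t" x] assms by simp
  ultimately show ?thesis using that by blast
qed

text \<open>
  Restriction of \<open>size_biased_conv\<close> to \<open>v \<le> x / 2\<close>, where the weight \<open>x - v\<close> is bounded below.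
\<close>
lemma weighted_conv_part_le:
  assumes st: "0 < s" "0 < t" and K: "0 \<le> K" "2 * K < x"
  shows "ennreal (x - K) * conv_part (p s) (p t) {0..K} x + ennreal (x / 2) * conv_part (p s) (p t) {K<..x / 2} x
    \<le> ennreal (s / (s + t) * (x * p (s + t) x))"
proof -
  have [measurable]: "p s \<in> borel_measurable borel" "p t \<in> borel_measurable borel"
    using p_measurable st by auto
  have "ennreal (x - K) * conv_part (p s) (p t) {0..K} x + ennreal (x / 2) * conv_part (p s) (p t) {K<..x / 2} x =
    (\<integral>\<^sup>+v. ennreal (x - K) * (ennreal (p s (x - v) * p t v) * indicator {0..K} v) +
       ennreal (x / 2) * (ennreal (p s (x - v) * p t v) * indicator {K<..x / 2} v) \<partial>lborel)"
    unfolding conv_part_def by (subst nn_integral_add) (auto simp: nn_integral_cmult)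
  also have "\<dots> \<le> (\<integral>\<^sup>+v. ennreal ((x - v) * p s (x - v) * p t v) \<partial>lborel)"
  proof (intro nn_integral_mono)
    fix v
    have nn: "0 \<le> p s (x - v) * p t v" using p_nonneg st by simp
    consider "v \<in> {0..K}" | "v \<in> {K<..x / 2}" | "v \<notin> {0..K}" "v \<notin> {K<..x / 2}" by blast
    then show "ennreal (x - K) * (ennreal (p s (x - v) * p t v) * indicator {0..K} v) +
       ennreal (x / 2) * (ennreal (p s (x - v) * p t v) * indicator {K<..x / 2} v)
       \<le> ennreal ((x - v) * p s (x - v) * p t v)"
    proof cases
      case 1
      then have "(x - K) * (p s (x - v) * p t v) \<le> (x - v) * (p s (x - v) * p t v)"
        using nn by (intro mult_right_mono) auto
      then show ?thesis using 1 K nn by (simp add: ennreal_mult[symmetric] ennreal_leI mult.assoc)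
    next
      case 2
      then have "(x / 2) * (p s (x - v) * p t v) \<le> (x - v) * (p s (x - v) * p t v)"
        using nn by (intro mult_right_mono) auto
      then show ?thesis using 2 K nn by (simp add: ennreal_mult[symmetric] ennreal_leI mult.assoc)
    qed auto
  qed
  also have "\<dots> = ennreal (s / (s + t) * (x * p (s + t) x))" by (rule size_biased_conv[OF st])
  finally show ?thesis .
qed

text \<open>
  If the first summand takes nearly all of \<open>x\<close>, its weight in \<open>size_biased_conv\<close> is nearly \<open>x\<close>. This event has
  conditional probability about \<open>p s x / p (s + t) x\<close>, hence at most \<open>s / (s + t)\<close> in the limit.
\<close>
lemma ratio_le_time_ratio:
  assumes st: "0 < s" "0 < t" and u: "uniformly_long_tailed (p s)"
    and lim: "((\<lambda>x. p s x / p (s + t) x) \<longlongrightarrow> c) at_top" and pos: "\<forall>\<^sub>F x in at_top. 0 < p (s + t) x"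
  shows "c \<le> s / (s + t)"
proof -
  have *: "(1 - \<eta>)\<^sup>2 * c \<le> s / (s + t)" if \<eta>: "0 < \<eta>" "\<eta> < 1" for \<eta>
  proof -
    obtain K where K: "0 \<le> K" and ev: "\<forall>\<^sub>F x in at_top. 0 < p s x \<and>
        ennreal ((1 - \<eta>)\<^sup>2 * p s x) \<le> conv_part (p s) (p t) {0..K} x"
      using conv_part_near_lower[OF u halfline[OF st(2)] \<eta>] by blast
    have "((\<lambda>x::real. 1 - K / x) \<longlongrightarrow> 1 - 0) at_top"
      by (intro tendsto_intros tendsto_divide_0[OF tendsto_const] filterlim_at_top_imp_at_infinity filterlim_ident)
    then have "((\<lambda>x. (1 - K / x) * ((1 - \<eta>)\<^sup>2 * (p s x / p (s + t) x))) \<longlongrightarrow> (1 - 0) * ((1 - \<eta>)\<^sup>2 * c)) at_top"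
      using lim by (intro tendsto_mult tendsto_const)
    moreover have "\<forall>\<^sub>F x in at_top. (1 - K / x) * ((1 - \<eta>)\<^sup>2 * (p s x / p (s + t) x)) \<le> s / (s + t)"
      using ev pos eventually_gt_at_top[of "2 * K"]
    proof eventually_elim
      case (elim x)
      then have x: "0 < x" using K by linarith
      have "ennreal ((x - K) * ((1 - \<eta>)\<^sup>2 * p s x)) = ennreal (x - K) * ennreal ((1 - \<eta>)\<^sup>2 * p s x)"
        using elim K by (intro ennreal_mult) auto
      also have "\<dots> \<le> ennreal (x - K) * conv_part (p s) (p t) {0..K} x"
        using elim by (intro mult_left_mono) auto
      also have "\<dots> \<le> ennreal (s / (s + t) * (x * p (s + t) x))"
        using weighted_conv_part_le[OF st K, of x] elim by (auto intro: order_trans[rotated] simp: add_increasing2)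
      finally have "(x - K) * ((1 - \<eta>)\<^sup>2 * p s x) \<le> s / (s + t) * (x * p (s + t) x)"
        using st x elim by (simp add: ennreal_le_iff)
      then have "(x - K) * ((1 - \<eta>)\<^sup>2 * p s x) / (x * p (s + t) x) \<le> s / (s + t)"
        using x elim by (subst pos_divide_le_eq) auto
      moreover have "(x - K) * ((1 - \<eta>)\<^sup>2 * p s x) / (x * p (s + t) x) = (1 - K / x) * ((1 - \<eta>)\<^sup>2 * (p s x / p (s + t) x))"
        using x elim by (simp add: field_simps)
      ultimately show ?case by simp
    qed
    ultimately have "(1 - 0) * ((1 - \<eta>)\<^sup>2 * c) \<le> s / (s + t)"
      by (intro tendsto_upperbound) auto
    then show ?thesis by simp
  qed
  have "((\<lambda>\<eta>::real. (1 - \<eta>)\<^sup>2 * c) \<longlongrightarrow> (1 - 0)\<^sup>2 * c) (at_right 0)" by (intro tendsto_intros)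
  moreover have "\<forall>\<^sub>F \<eta> in at_right 0. (1 - \<eta>)\<^sup>2 * c \<le> s / (s + t)"
    using eventually_at_right_less[of 0] eventually_at_right_field[of _ "0::real"]
    by (auto simp: eventually_at_right_field intro!: exI[of _ 1] *)
  ultimately have "(1 - 0)\<^sup>2 * c \<le> s / (s + t)" by (intro tendsto_upperbound) auto
  then show ?thesis by simp
qed

text \<open>
  When the ratio has the extreme value \<open>s / (s + t)\<close>, the part \<open>v \<le> K\<close> already exhausts the size-biased
  identity, and the part \<open>K < v \<le> x / 2\<close>, whose weights are at least \<open>x / 2\<close>, must vanish in the limit.
\<close>
lemma negligible_lower_middle_if_ratio:
  assumes st: "0 < s" "0 < t" and u: "uniformly_long_tailed (p s)"
    and lim: "((\<lambda>x. p s x / p (s + t) x) \<longlongrightarrow> s / (s + t)) at_top" and pos: "\<forall>\<^sub>F x in at_top. 0 < p (s + t) x"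
  shows "negligible_lower_middle (p s) (p t)"
  unfolding negligible_lower_middle_def
proof (intro allI impI)
  fix \<delta> :: real assume \<delta>: "0 < \<delta>"
  define \<eta> where "\<eta> = min (1/2) (\<delta> / 8)"
  have \<eta>: "0 < \<eta>" "\<eta> < 1" "8 * \<eta> \<le> \<delta>" using \<delta> by (auto simp: \<eta>_def min_def)
  obtain K where K: "0 \<le> K" and ev: "\<forall>\<^sub>F x in at_top. 0 < p s x \<and>
      ennreal ((1 - \<eta>)\<^sup>2 * p s x) \<le> conv_part (p s) (p t) {0..K} x"
    using conv_part_near_lower[OF u halfline[OF st(2)] \<eta>(1,2)] by blast
  have "0 < s / (s + t)" using st by simp
  moreover have "q / (1 + \<eta>) < q" if "0 < q" for q
    using \<eta> that by (subst pos_divide_less_eq) auto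
  ultimately have "s / (s + t) / (1 + \<eta>) < s / (s + t)" by blast
  then have "\<forall>\<^sub>F x in at_top. s / (s + t) / (1 + \<eta>) < p s x / p (s + t) x"
    by (rule order_tendstoD(1)[OF lim])
  then have ev2: "\<forall>\<^sub>F x in at_top. s / (s + t) * p (s + t) x \<le> (1 + \<eta>) * p s x"
    using pos
  proof eventually_elim
    case (elim x)
    then have "s / (s + t) / (1 + \<eta>) * p (s + t) x \<le> p s x" by (simp only: pos_less_divide_eq less_imp_le)
    then have "s / (s + t) * p (s + t) x / (1 + \<eta>) \<le> p s x" by simp
    then show ?case using \<eta> by (simp only: pos_divide_le_eq mult.commute) 
  qed
  have "\<forall>\<^sub>F x in at_top. conv_part (p s) (p t) {K<..x / 2} x \<le> ennreal (\<delta> * p s x)"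
    using ev ev2 eventually_gt_at_top[of "2 * K"] eventually_ge_at_top[of "K / \<eta>"]
  proof eventually_elim
    case (elim x)
    then have x: "0 < x" using K by linarith
    have Kx: "K \<le> \<eta> * x" using elim \<eta> by (simp add: field_simps)
    obtain m where m: "0 \<le> m" "conv_part (p s) (p t) {K<..x / 2} x = ennreal m" 
      using conv_part_finite[OF st] by blast
    have nn: "0 \<le> x - K" "0 \<le> (1 - \<eta>)\<^sup>2 * p s x" "0 \<le> x / 2" using elim K by auto
    have "ennreal ((x - K) * ((1 - \<eta>)\<^sup>2 * p s x) + x / 2 * m) =
       ennreal (x - K) * ennreal ((1 - \<eta>)\<^sup>2 * p s x) + ennreal (x / 2) * ennreal m"
      using m nn by (simp only: ennreal_plus[OF mult_nonneg_nonneg mult_nonneg_nonneg] ennreal_mult)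
    also have "\<dots> \<le> ennreal (x - K) * conv_part (p s) (p t) {0..K} x + ennreal (x / 2) * conv_part (p s) (p t) {K<..x / 2} x"
      unfolding m(2) using elim by (intro add_mono mult_left_mono) auto
    also have "\<dots> \<le> ennreal (s / (s + t) * (x * p (s + t) x))"
      using elim by (intro weighted_conv_part_le[OF st K]) auto
    finally have "(x - K) * ((1 - \<eta>)\<^sup>2 * p s x) + x / 2 * m \<le> s / (s + t) * (x * p (s + t) x)"
      using st x p_nonneg[of "s + t" x] by (simp add: ennreal_le_iff)
    also have "\<dots> = x * (s / (s + t) * p (s + t) x)" by simp
    also have "\<dots> \<le> x * ((1 + \<eta>) * p s x)" using elim x by (intro mult_left_mono) auto
    finally have "(x - K) * ((1 - \<eta>)\<^sup>2 * p s x) + x / 2 * m \<le> x * ((1 + \<eta>) * p s x)" .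
    moreover have "(x - \<eta> * x) * ((1 - \<eta>)\<^sup>2 * p s x) \<le> (x - K) * ((1 - \<eta>)\<^sup>2 * p s x)"
      using Kx elim by (intro mult_right_mono) auto
    ultimately have "x / 2 * m \<le> x * (((1 + \<eta>) - (1 - \<eta>) ^ 3) * p s x)"
      by (simp add: algebra_simps power2_eq_square power3_eq_cube)
    then have "x * (m / 2) \<le> x * (((1 + \<eta>) - (1 - \<eta>) ^ 3) * p s x)" by simp
    then have "m / 2 \<le> ((1 + \<eta>) - (1 - \<eta>) ^ 3) * p s x" using x by (rule mult_left_le_imp_le)
    then have "m \<le> 2 * (((1 + \<eta>) - (1 - \<eta>) ^ 3) * p s x)" by simp
    also have "\<dots> \<le> 2 * (4 * \<eta> * p s x)"
    proof (intro mult_left_mono mult_right_mono)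
      have "\<eta> ^ 3 \<le> 3 * \<eta>\<^sup>2" using \<eta> by (simp add: power3_eq_cube power2_eq_square)
      then show "(1 + \<eta>) - (1 - \<eta>) ^ 3 \<le> 4 * \<eta>" by (simp add: algebra_simps power3_eq_cube power2_eq_square)
    qed (use elim in auto)
    also have "2 * (4 * \<eta> * p s x) \<le> \<delta> * p s x" using \<eta> elim by (simp add: mult.assoc[symmetric] mult_right_mono)
    finally show ?case using m \<eta> elim by (auto intro: ennreal_leI mult_right_mono)
  qed
  then show "\<exists>K\<ge>0. \<forall>\<^sub>F x in at_top. conv_part (p s) (p t) {K<..x / 2} x \<le> ennreal (\<delta> * p s x)"
    using K by blast
qed

text \<open>
  Of two summands with total \<open>v\<close>, one is at least \<open>v / 2\<close>. That one lies between \<open>K\<close> and half of what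
  remains of \<open>x\<close> after removal of the other, so the hypothesis applies to it; the other summand is then
  integrated out.
\<close>
lemma negligible_lower_middle_double:
  assumes st: "0 < s" "0 < t" and nl: "negligible_lower_middle (p s) (p t)"
    and u: "uniformly_long_tailed (p s)"
  shows "negligible_lower_middle (p s) (p (2 * t))"
  unfolding negligible_lower_middle_def
proof (intro allI impI)
  fix \<delta> :: real assume \<delta>: "0 < \<delta>"
  have [measurable]: "p s \<in> borel_measurable borel" "p t \<in> borel_measurable borel"
    using p_measurable st by auto
  define d where "d = \<delta> / 6"
  have d: "0 < d" using \<delta> by (simp add: d_def)
  have M: "\<forall>\<^sub>F x in at_top. conv_part (p s) (p t) {..x / 2} x \<le> ennreal (3 * p s x)"
  proof -
    obtain K where K: "0 \<le> K" and ev: "\<forall>\<^sub>F x in at_top. conv_part (p s) (p t) {K<..x / 2} x \<le> ennreal (1 * p s x)"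
      using nl zero_less_one unfolding negligible_lower_middle_def by blast
    obtain X where X: "\<And>x. X \<le> x \<Longrightarrow> 0 < p s x"
      "\<And>x v. X \<le> x \<Longrightarrow> 0 \<le> v \<Longrightarrow> v \<le> K \<Longrightarrow> p s (x - v) \<le> (1 + 1) * p s x"
      using uniformly_long_tailedD[OF u zero_less_one K] by metis
    show ?thesis using ev eventually_ge_at_top[of X] eventually_ge_at_top[of "2 * K"]
    proof eventually_elim
      case (elim x)
      have "conv_part (p s) (p t) {..x / 2} x \<le> conv_part (p s) (p t) ({..K} \<union> {K<..x / 2}) x"
        by (intro conv_part_mono) auto
      also have "\<dots> \<le> conv_part (p s) (p t) {..K} x + conv_part (p s) (p t) {K<..x / 2} x"
        by (rule conv_part_Un_le) auto
      also have "\<dots> \<le> ennreal ((1 + 1) * p s x) + ennreal (1 * p s x)"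
      proof (intro add_mono)
        show "conv_part (p s) (p t) {..K} x \<le> ennreal ((1 + 1) * p s x)"
          using X elim less_imp_le[OF X(1)] by (intro conv_part_near_le[OF halfline[OF st(2)]]) auto
      qed (use elim in auto)
      also have "\<dots> = ennreal (3 * p s x)"
        using X(1) elim by (subst ennreal_plus[symmetric]) (auto simp: less_imp_le)
      finally show ?case .
    qed
  qed
  obtain K where K: "0 \<le> K" and "\<forall>\<^sub>F x in at_top. conv_part (p s) (p t) {K<..x / 2} x \<le> ennreal (d * p s x)"
    using nl d unfolding negligible_lower_middle_def by blast
  then obtain X where X: "\<And>x. X \<le> x \<Longrightarrow> conv_part (p s) (p t) {K<..x / 2} x \<le> ennreal (d * p s x)"
    by (auto simp: eventually_at_top_linorder)
  have half: "ennreal (p (2 * t) v) \<le> 2 * conv_part (p t) (p t) {..v / 2} v" for v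
  proof -
    have "{..v / 2} \<union> {v / 2..} = UNIV" by auto
    then have "ennreal (p (2 * t) v) = conv_part (p t) (p t) ({..v / 2} \<union> {v / 2..}) v"
      using conv[OF st(2) st(2), of v] by simp
    also have "\<dots> \<le> conv_part (p t) (p t) {..v / 2} v + conv_part (p t) (p t) {v / 2..} v"
      by (rule conv_part_Un_le) auto
    also have "conv_part (p t) (p t) {v / 2..} v = conv_part (p t) (p t) {..v / 2} v"
    proof -
      have "{u. v - u \<in> {v / 2..}} = {..v / 2}" by (auto simp: field_simps)
      then show ?thesis using conv_part_reflect[of "p t" "p t" "{v / 2..}" v] by simp
    qed
    also have "conv_part (p t) (p t) {..v / 2} v + conv_part (p t) (p t) {..v / 2} v = 2 * conv_part (p t) (p t) {..v / 2} v"
      by (rule mult_2[symmetric])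
    finally show ?thesis .
  qed
  have "\<forall>\<^sub>F x in at_top. conv_part (p s) (p (2 * t)) {2 * K<..x / 2} x \<le> ennreal (\<delta> * p s x)"
    using M eventually_ge_at_top[of 0] eventually_ge_at_top[of "4 / 3 * X"]
  proof eventually_elim
    case (elim x)
    let ?I = "indicator {2 * K<..x / 2} :: real \<Rightarrow> ennreal"
    let ?J = "\<lambda>v y. indicator {..v / 2} y :: ennreal"
    have "conv_part (p s) (p (2 * t)) {2 * K<..x / 2} x \<le>
       (\<integral>\<^sup>+v. (\<integral>\<^sup>+y. 2 * (ennreal (p s (x - v)) * ?I v * (ennreal (p t (v - y)) * ennreal (p t y) * ?J v y)) \<partial>lborel) \<partial>lborel)"
      unfolding conv_part_def
    proof (rule nn_integral_mono)
      fix v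
      have "ennreal (p s (x - v) * p (2 * t) v) * ?I v = ennreal (p s (x - v)) * ?I v * ennreal (p (2 * t) v)"
        using p_nonneg st by (simp add: ennreal_mult ac_simps)
      also have "\<dots> \<le> ennreal (p s (x - v)) * ?I v * (2 * conv_part (p t) (p t) {..v / 2} v)"
        by (intro mult_left_mono half) auto
      also have "\<dots> = (2 * (ennreal (p s (x - v)) * ?I v)) * (\<integral>\<^sup>+y. ennreal (p t (v - y)) * ennreal (p t y) * ?J v y \<partial>lborel)"
        unfolding conv_part_def using p_nonneg st by (simp add: ennreal_mult ac_simps)
      also have "\<dots> = (\<integral>\<^sup>+y. (2 * (ennreal (p s (x - v)) * ?I v)) * (ennreal (p t (v - y)) * ennreal (p t y) * ?J v y) \<partial>lborel)"
        by (intro nn_integral_cmult[symmetric]) measurable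
      finally show "ennreal (p s (x - v) * p (2 * t) v) * ?I v \<le>
          (\<integral>\<^sup>+y. 2 * (ennreal (p s (x - v)) * ?I v * (ennreal (p t (v - y)) * ennreal (p t y) * ?J v y)) \<partial>lborel)"
        by (simp add: mult.assoc)
    qed
    also have "\<dots> = (\<integral>\<^sup>+y. (\<integral>\<^sup>+v. 2 * (ennreal (p s (x - v)) * ?I v * (ennreal (p t (v - y)) * ennreal (p t y) * ?J v y)) \<partial>lborel) \<partial>lborel)"
    proof (rule lborel_pair.Fubini')
      have "(\<lambda>(y, v). 2 * (ennreal (p s (x - v)) * ?I v * (ennreal (p t (v - y)) * ennreal (p t y) * indicator {z. fst z \<le> snd z / 2} (y, v))))
         \<in> borel_measurable (lborel \<Otimes>\<^sub>M lborel)"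
        by measurable
      also have "(\<lambda>(y, v). 2 * (ennreal (p s (x - v)) * ?I v * (ennreal (p t (v - y)) * ennreal (p t y) * indicator {z. fst z \<le> snd z / 2} (y, v)))) =
        (\<lambda>(y, v). 2 * (ennreal (p s (x - v)) * ?I v * (ennreal (p t (v - y)) * ennreal (p t y) * ?J v y)))"
        by (auto simp: fun_eq_iff split: split_indicator)
      finally show "(\<lambda>(y, v). 2 * (ennreal (p s (x - v)) * ?I v * (ennreal (p t (v - y)) * ennreal (p t y) * ?J v y)))
         \<in> borel_measurable (lborel \<Otimes>\<^sub>M lborel)" .
    qed
    also have "\<dots> \<le> (\<integral>\<^sup>+y. ennreal (2 * d) * (ennreal (p s (x - y) * p t y) * indicator {..x / 2} y) \<partial>lborel)"
    proof (rule nn_integral_mono)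
      fix y
      consider "y < 0" | "x / 4 < y" | "0 \<le> y" "y \<le> x / 4" by linarith
      then show "(\<integral>\<^sup>+v. 2 * (ennreal (p s (x - v)) * ?I v * (ennreal (p t (v - y)) * ennreal (p t y) * ?J v y)) \<partial>lborel)
         \<le> ennreal (2 * d) * (ennreal (p s (x - y) * p t y) * indicator {..x / 2} y)"
      proof cases
        case 1
        then show ?thesis using p_neg[OF st(2), of y] by simp
      next
        case 2
        have z: "?I v * ?J v y = 0" for v using 2 by (auto split: split_indicator)
        have "2 * (ennreal (p s (x - v)) * ?I v * (ennreal (p t (v - y)) * ennreal (p t y) * ?J v y)) =
          2 * (ennreal (p s (x - v)) * (ennreal (p t (v - y)) * ennreal (p t y))) * (?I v * ?J v y)" for v
          by (simp only: ac_simps)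
        then have "2 * (ennreal (p s (x - v)) * ?I v * (ennreal (p t (v - y)) * ennreal (p t y) * ?J v y)) = 0" for v
          unfolding z by (simp only: mult_zero_right)
        then show ?thesis by (simp only: nn_integral_0_iff_AE nn_integral_const) simp
      next
        case 3
        have "(\<integral>\<^sup>+v. 2 * (ennreal (p s (x - v)) * ?I v * (ennreal (p t (v - y)) * ennreal (p t y) * ?J v y)) \<partial>lborel)
          \<le> (\<integral>\<^sup>+v. (\<lambda>w. (2 * ennreal (p t y)) * (ennreal (p s (x - y - w) * p t w) * indicator {K<..(x - y) / 2} w)) (v - y) \<partial>lborel)"
          using 3 p_nonneg st by (intro nn_integral_mono) (auto simp: ennreal_mult ac_simps split: split_indicator)
        also have "\<dots> = (\<integral>\<^sup>+w. (2 * ennreal (p t y)) * (ennreal (p s (x - y - w) * p t w) * indicator {K<..(x - y) / 2} w) \<partial>lborel)"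
          by (rule nn_integral_lborel_shift) measurable
        also have "\<dots> = (2 * ennreal (p t y)) * conv_part (p s) (p t) {K<..(x - y) / 2} (x - y)"
          unfolding conv_part_def by (rule nn_integral_cmult) measurable
        also have "\<dots> \<le> (2 * ennreal (p t y)) * ennreal (d * p s (x - y))"
          using 3 elim by (intro mult_left_mono X) auto
        also have "\<dots> = ennreal (2 * d) * (ennreal (p s (x - y) * p t y) * indicator {..x / 2} y)"
          using 3 elim d p_nonneg st by (simp add: ennreal_mult ac_simps)
        finally show ?thesis .
      qed
    qed
    also have "\<dots> = ennreal (2 * d) * conv_part (p s) (p t) {..x / 2} x"
      unfolding conv_part_def by (rule nn_integral_cmult) measurable
    also have "\<dots> \<le> ennreal (2 * d) * ennreal (3 * p s x)" using elim by (intro mult_left_mono) auto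
    also have "\<dots> = ennreal (\<delta> * p s x)"
      using d p_nonneg st by (subst ennreal_mult[symmetric]) (auto simp: d_def)
    finally show ?case .
  qed
  then show "\<exists>K\<ge>0. \<forall>\<^sub>F x in at_top. conv_part (p s) (p (2 * t)) {K<..x / 2} x \<le> ennreal (\<delta> * p s x)"
    using K by (intro exI[of _ "2 * K"]) auto
qed

text \<open>
  The increment from time \<open>s\<close> to time \<open>t\<close> is bounded with probability near \<open>1\<close>, and \<open>p s\<close> is nearly
  constant over bounded shifts.
\<close>
lemma later_density_ge_half:
  assumes st: "0 < s" "s < t" and u: "uniformly_long_tailed (p s)"
  shows "\<forall>\<^sub>F x in at_top. p s x \<le> 2 * p t x"
proof -
  define \<eta> :: real where "\<eta> = 1 / 5"
  have ts: "0 < t - s" using st by simp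
  obtain K where "\<forall>\<^sub>F x in at_top. 0 < p s x \<and>
      ennreal ((1 - \<eta>)\<^sup>2 * p s x) \<le> conv_part (p s) (p (t - s)) {0..K} x"
    using conv_part_near_lower[OF u halfline[OF ts], of \<eta>] by (auto simp: \<eta>_def)
  then show ?thesis
  proof eventually_elim
    case (elim x)
    obtain m where m: "0 \<le> m" "conv_part (p s) (p (t - s)) {0..K} x = ennreal m" "m \<le> p t x"
      using conv_part_finite[OF st(1) ts] by (metis add.commute diff_add_cancel)
    have "(1 - \<eta>)\<^sup>2 * p s x \<le> m" using elim m by (simp add: ennreal_le_iff)
    moreover have "1 / 2 * p s x \<le> (1 - \<eta>)\<^sup>2 * p s x"
      using elim by (intro mult_right_mono) (auto simp: \<eta>_def power2_eq_square)
    ultimately show ?case using m by linarith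
  qed
qed

lemma negligible_middle_if_negligible_lower_middle:
  assumes st: "0 < s" "0 < t" and nl: "negligible_lower_middle (p s) (p t)"
    and le: "\<forall>\<^sub>F x in at_top. p s x \<le> 2 * p t x"
  shows "negligible_middle (p s)"
  unfolding negligible_middle_def
proof (intro allI impI)
  fix \<delta> :: real assume \<delta>: "0 < \<delta>"
  have [measurable]: "p s \<in> borel_measurable borel" "p t \<in> borel_measurable borel"
    using p_measurable st by auto
  obtain Y where Y: "\<And>x. Y \<le> x \<Longrightarrow> p s x \<le> 2 * p t x" using le unfolding eventually_at_top_linorder by blast
  obtain K0 where K0: "0 \<le> K0" and "\<forall>\<^sub>F x in at_top. conv_part (p s) (p t) {K0<..x / 2} x \<le> ennreal (\<delta> / 4 * p s x)"
    using nl[unfolded negligible_lower_middle_def, rule_format, of "\<delta> / 4"] \<delta> by auto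
  then obtain X where X: "\<And>x. X \<le> x \<Longrightarrow> conv_part (p s) (p t) {K0<..x / 2} x \<le> ennreal (\<delta> / 4 * p s x)"
    by (auto simp: eventually_at_top_linorder)
  define K where "K = max K0 Y"
  have K: "0 \<le> K" "K0 \<le> K" "Y \<le> K" using K0 by (auto simp: K_def)
  show "\<exists>K\<ge>0. \<exists>X. \<forall>x\<ge>X. conv_part (p s) (p s) {K<..<x - K} x \<le> ennreal (\<delta> * p s x)"
  proof (rule exI[of _ K], intro conjI K(1) exI[of _ X] allI impI)
    fix x assume x: "X \<le> x"
    have "conv_part (p s) (p s) {K<..<x - K} x \<le> conv_part (p s) (p s) ({K<..x / 2} \<union> {x / 2..<x - K}) x"
      by (intro conv_part_mono) auto
    also have "\<dots> \<le> conv_part (p s) (p s) {K<..x / 2} x + conv_part (p s) (p s) {x / 2..<x - K} x"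
      by (rule conv_part_Un_le) auto
    also have "conv_part (p s) (p s) {x / 2..<x - K} x = conv_part (p s) (p s) {K<..x / 2} x"
    proof -
      have "{u. x - u \<in> {x / 2..<x - K}} = {K<..x / 2}" by (auto simp: field_simps)
      then show ?thesis using conv_part_reflect[of "p s" "p s" "{x / 2..<x - K}" x] by simp
    qed
    also have "conv_part (p s) (p s) {K<..x / 2} x + conv_part (p s) (p s) {K<..x / 2} x = 2 * conv_part (p s) (p s) {K<..x / 2} x"
      by (simp add: mult_2)
    also have "\<dots> \<le> 2 * (2 * conv_part (p s) (p t) {K0<..x / 2} x)"
    proof (intro mult_left_mono)
      have "conv_part (p s) (p s) {K<..x / 2} x \<le> (\<integral>\<^sup>+v. 2 * (ennreal (p s (x - v) * p t v) * indicator {K0<..x / 2} v) \<partial>lborel)"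
        unfolding conv_part_def
      proof (rule nn_integral_mono)
        fix v
        show "ennreal (p s (x - v) * p s v) * indicator {K<..x / 2} v \<le>
          2 * (ennreal (p s (x - v) * p t v) * indicator {K0<..x / 2} v)"
        proof (cases "v \<in> {K<..x / 2}")
          case True
          then have "p s (x - v) * p s v \<le> p s (x - v) * (2 * p t v)"
            using K p_nonneg st by (intro mult_left_mono Y) auto
          also have "\<dots> = 2 * (p s (x - v) * p t v)" by simp
          finally have "ennreal (p s (x - v) * p s v) \<le> ennreal (2 * (p s (x - v) * p t v))"
            by (rule ennreal_leI)
          also have "\<dots> = ennreal 2 * ennreal (p s (x - v) * p t v)"
            using p_nonneg st by (intro ennreal_mult) auto
          finally have "ennreal (p s (x - v) * p s v) \<le> ennreal 2 * ennreal (p s (x - v) * p t v)" .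
          then show ?thesis using True K by simp
        qed simp
      qed
      also have "\<dots> = 2 * conv_part (p s) (p t) {K0<..x / 2} x"
        unfolding conv_part_def by (rule nn_integral_cmult) measurable
      finally show "conv_part (p s) (p s) {K<..x / 2} x \<le> 2 * conv_part (p s) (p t) {K0<..x / 2} x" .
    qed simp
    also have "\<dots> \<le> 2 * (2 * ennreal (\<delta> / 4 * p s x))" using X[OF x] by (intro mult_left_mono) auto
    also have "\<dots> = ennreal 4 * ennreal (\<delta> / 4 * p s x)" by (simp add: mult.assoc[symmetric])
    also have "\<dots> = ennreal (\<delta> * p s x)"
      using \<delta> p_nonneg st by (subst ennreal_mult[symmetric]) auto
    finally show "conv_part (p s) (p s) {K<..<x - K} x \<le> ennreal (\<delta> * p s x)" .
  qed
qed

text \<open>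
  The size-biased identity controls the middle part of \<open>p s\<close> against \<open>p t\<close> only. If \<open>t < s\<close>, then \<open>p s\<close>
  need not be dominated by \<open>p t\<close>, but it is dominated by \<open>p (2 ^ k * t)\<close> for large \<open>k\<close>, and doubling
  preserves negligibility.
\<close>
lemma negligible_middle_if_ratio:
  assumes st: "0 < s" "0 < t" and u: "uniformly_long_tailed (p s)"
    and lim: "((\<lambda>x. p s x / p (s + t) x) \<longlongrightarrow> s / (s + t)) at_top" and pos: "\<forall>\<^sub>F x in at_top. 0 < p (s + t) x"
  shows "negligible_middle (p s)"
proof -
  have nl: "negligible_lower_middle (p s) (p (2 ^ k * t))" for k
  proof (induction k)
    case 0
    then show ?case using negligible_lower_middle_if_ratio[OF st u lim pos] by simp
  next
    case (Suc k)
    have "0 < 2 ^ k * t" using st by simp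
    from negligible_lower_middle_double[OF st(1) this Suc u] show ?case by (simp add: mult.assoc)
  qed
  \<comment> \<open>Beyond time \<open>s\<close> the later density dominates \<open>p s\<close> again.\<close>
  obtain k where "s / t < 2 ^ k" using real_arch_pow[of 2 "s / t"] by auto
  then have k: "s < 2 ^ k * t" using st by (simp add: field_simps)
  then show ?thesis
    using st by (intro negligible_middle_if_negligible_lower_middle[OF _ _ nl later_density_ge_half[OF _ _ u]]) auto
qed

end

section \<open>The tail ratio of two times: submultiplicative weights\<close>

lemma uniformly_long_tailed_heavy:
  assumes h: "halfline_density h" and u: "uniformly_long_tailed h" and \<theta>: "0 < \<theta>"
  shows "(\<integral>\<^sup>+x. ennreal (exp (\<theta> * x) * h x) \<partial>lborel) = \<infinity>"
proof -
  obtain X where X: "\<And>x. X \<le> x \<Longrightarrow> 0 < h x"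
    "\<And>x w. 0 \<le> w \<Longrightarrow> X \<le> x - w \<Longrightarrow> h (x - w) \<le> exp (\<theta> * (w + 1)) * h x"
    using uniformly_long_tailed_exp_bound[OF u \<theta>] by blast
  define c where "c = exp (\<theta> * X - \<theta>) * h X"
  have c: "0 < c" using X(1)[of X] by (simp add: c_def)
  have le: "c \<le> exp (\<theta> * x) * h x" if "X \<le> x" for x
  proof -
    have "h X \<le> exp (\<theta> * ((x - X) + 1)) * h x" using X(2)[of "x - X" x] that by simp
    then have "exp (\<theta> * X - \<theta>) * h X \<le> exp (\<theta> * X - \<theta>) * (exp (\<theta> * ((x - X) + 1)) * h x)"
      by (intro mult_left_mono) auto
    also have "\<dots> = exp (\<theta> * x) * h x" by (simp add: exp_add[symmetric] mult.assoc[symmetric] algebra_simps)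
    finally show ?thesis by (simp add: c_def)
  qed
  have "emeasure lborel {X..} = \<infinity>"
  proof (rule ccontr)
    assume "emeasure lborel {X..} \<noteq> \<infinity>"
    then obtain r where r: "emeasure lborel {X..} = ennreal r" "0 \<le> r"
      by (cases "emeasure lborel {X..}") auto
    obtain n :: nat where "r < real n" using reals_Archimedean2 by blast
    moreover have "ennreal (real n) \<le> ennreal r"
      unfolding r(1)[symmetric] using emeasure_mono[of "{X..X + real n}" "{X..}" lborel] by auto
    ultimately show False using r(2) by (simp add: ennreal_le_iff)
  qed
  then have "\<infinity> = (\<integral>\<^sup>+x. ennreal c * indicator {X..} x \<partial>lborel)"
    using c by (simp add: nn_integral_cmult_indicator ennreal_mult_top)
  also have "\<dots> \<le> (\<integral>\<^sup>+x. ennreal (exp (\<theta> * x) * h x) \<partial>lborel)"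
    using le by (intro nn_integral_mono) (auto split: split_indicator intro: ennreal_leI)
  finally show ?thesis by (simp add: top_unique)
qed

lemma truncated_exp_mass:
  assumes h: "halfline_density h" and u: "uniformly_long_tailed h" and \<theta>: "0 < \<theta>" and \<epsilon>: "0 < \<epsilon>"
  obtains B where "1 \<le> B" "(\<integral>\<^sup>+x. ennreal (min (exp (\<theta> * x)) B * h x) \<partial>lborel) = ennreal (1 + \<epsilon>)"
proof -
  have [measurable]: "h \<in> borel_measurable borel" using halfline_densityD(1)[OF h] .
  have nn: "0 \<le> h x" for x using halfline_densityD(2)[OF h] .
  have int: "integrable lborel h"
    using halfline_densityD(4)[OF h] nn by (intro integrableI_nonneg) auto
  have "integral\<^sup>L lborel h = 1" using halfline_densityD(4)[OF h] nn by (simp add: integral_eq_nn_integral)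
  have intB: "integrable lborel (\<lambda>x. min (exp (\<theta> * x)) B * h x)" if "0 \<le> B" for B
    using that nn by (intro Bochner_Integration.integrable_bound[OF integrable_mult_right[OF int, of B]])
      (auto simp: abs_mult intro!: mult_right_mono)
  define F where "F B = (\<integral>x. min (exp (\<theta> * x)) B * h x \<partial>lborel)" for B
  have F_nn: "(\<integral>\<^sup>+x. ennreal (min (exp (\<theta> * x)) B * h x) \<partial>lborel) = ennreal (F B)" if "0 \<le> B" for B
    unfolding F_def using intB[OF that] that nn by (intro nn_integral_eq_integral) auto
  have lip: "\<bar>F A - F B\<bar> \<le> \<bar>A - B\<bar>" if "0 \<le> A" "0 \<le> B" for A B
  proof -
    have "\<bar>F A - F B\<bar> = \<bar>\<integral>x. min (exp (\<theta> * x)) A * h x - min (exp (\<theta> * x)) B * h x \<partial>lborel\<bar>"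
      unfolding F_def using intB that by simp
    also have "\<dots> \<le> (\<integral>x. \<bar>min (exp (\<theta> * x)) A * h x - min (exp (\<theta> * x)) B * h x\<bar> \<partial>lborel)"
      by (rule integral_abs_bound)
    also have "\<dots> \<le> (\<integral>x. \<bar>A - B\<bar> * h x \<partial>lborel)"
    proof (intro integral_mono)
      fix x
      have "\<bar>min (exp (\<theta> * x)) A * h x - min (exp (\<theta> * x)) B * h x\<bar> = \<bar>min (exp (\<theta> * x)) A - min (exp (\<theta> * x)) B\<bar> * h x"
        using nn[of x] by (simp add: abs_mult left_diff_distrib[symmetric])
      also have "\<dots> \<le> \<bar>A - B\<bar> * h x" using nn[of x] by (intro mult_right_mono) auto
      finally show "\<bar>min (exp (\<theta> * x)) A * h x - min (exp (\<theta> * x)) B * h x\<bar> \<le> \<bar>A - B\<bar> * h x" .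
    qed (use intB int that in auto)
    also have "\<dots> = \<bar>A - B\<bar>" using \<open>integral\<^sup>L lborel h = 1\<close> by simp
    finally show ?thesis .
  qed
  have contF: "continuous_on {1..b} F" for b
  proof (rule lipschitz_on_continuous_on)
    show "1-lipschitz_on {1..b} F" using lip by (intro lipschitz_onI) (auto simp: dist_real_def)
  qed
  have F1: "F 1 \<le> 1"
  proof -
    have "F 1 \<le> (\<integral>x. h x \<partial>lborel)" unfolding F_def
      using intB[of 1] int nn by (intro integral_mono) (auto intro: mult_left_le_one_le mult_right_mono[of _ 1, simplified])
    then show ?thesis using \<open>integral\<^sup>L lborel h = 1\<close> by simp
  qed
  have "(SUP n::nat. \<integral>\<^sup>+x. ennreal (min (exp (\<theta> * x)) (real n) * h x) \<partial>lborel) =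
     (\<integral>\<^sup>+x. (SUP n::nat. ennreal (min (exp (\<theta> * x)) (real n) * h x)) \<partial>lborel)"
    using nn by (intro nn_integral_monotone_convergence_SUP[symmetric])
       (auto simp: incseq_def le_fun_def intro!: ennreal_leI mult_right_mono)
  also have "\<dots> = (\<integral>\<^sup>+x. ennreal (exp (\<theta> * x) * h x) \<partial>lborel)"
  proof (rule nn_integral_cong)
    fix x
    obtain n :: nat where n: "exp (\<theta> * x) \<le> real n" using real_arch_simple by blast
    show "(SUP n::nat. ennreal (min (exp (\<theta> * x)) (real n) * h x)) = ennreal (exp (\<theta> * x) * h x)"
    proof (rule antisym)
      show "(SUP n::nat. ennreal (min (exp (\<theta> * x)) (real n) * h x)) \<le> ennreal (exp (\<theta> * x) * h x)"
        using nn by (intro SUP_least ennreal_leI mult_right_mono) auto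
      show "ennreal (exp (\<theta> * x) * h x) \<le> (SUP n::nat. ennreal (min (exp (\<theta> * x)) (real n) * h x))"
        using n by (intro SUP_upper2[of n]) (auto simp: min_absorb1)
    qed
  qed
  also have "\<dots> = \<infinity>" by (rule uniformly_long_tailed_heavy[OF h u \<theta>])
  finally have sup: "(SUP n::nat. \<integral>\<^sup>+x. ennreal (min (exp (\<theta> * x)) (real n) * h x) \<partial>lborel) = \<infinity>" .
  have "ennreal (1 + \<epsilon>) < (SUP n::nat. \<integral>\<^sup>+x. ennreal (min (exp (\<theta> * x)) (real n) * h x) \<partial>lborel)" unfolding sup by simp
  then obtain n :: nat where "ennreal (1 + \<epsilon>) < (\<integral>\<^sup>+x. ennreal (min (exp (\<theta> * x)) (real n) * h x) \<partial>lborel)"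
    unfolding less_SUP_iff by blast
  then have "ennreal (1 + \<epsilon>) < ennreal (F (real n))" by (simp only: F_nn of_nat_0_le_iff)
  then have n: "1 + \<epsilon> < F (real n)" using \<epsilon> by (subst (asm) ennreal_less_iff) auto
  have "1 \<le> real n"
  proof (rule ccontr)
    assume "\<not> 1 \<le> real n"
    then have "n = 0" by simp
    have "F 0 = 0" by (simp add: F_def min_def)
    then show False using n \<epsilon> \<open>n = 0\<close> by simp
  qed
  then obtain B where "1 \<le> B" "F B = 1 + \<epsilon>"
    using IVT'[of F 1 "1 + \<epsilon>" "real n"] F1 n \<epsilon> contF by auto
  then show ?thesis using that[of B] F_nn[of B] by simp
qed

text \<open>
  Weights in the manner of Foss and Korshunov: a total mass close to \<open>1\<close> together with a
  first moment that is finite but as large as required. If the mean is infinite, \<open>exp (- \<theta> * x)\<close> with small \<open>\<theta>\<close> will do. Otherwise take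
  \<open>min (exp (\<theta> * x)) B\<close>, with \<open>B\<close> chosen so that the total mass is exactly \<open>1 + \<epsilon>\<close>, which is possible
  because exponential moments are infinite. For small \<open>\<theta>\<close> the excess mass \<open>\<epsilon>\<close> sits far out, so that
  the first moment is large.
\<close>
lemma submultiplicative_weight:
  assumes h: "halfline_density h" and u: "uniformly_long_tailed h" and \<epsilon>: "0 < \<epsilon>" and N: "0 < N"
  obtains w where "w \<in> borel_measurable borel" "\<And>x. 0 \<le> w x" "\<And>x. 0 \<le> x \<Longrightarrow> w x \<le> exp x"
    "\<And>x y. 0 \<le> x \<Longrightarrow> 0 \<le> y \<Longrightarrow> w (x + y) \<le> w x * w y"
    "\<And>x y. 0 \<le> x \<Longrightarrow> 0 \<le> y \<Longrightarrow> max 1 (w x) \<le> max 1 (w (x + y))"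
    "(\<integral>\<^sup>+x. ennreal (max 1 (w x) * h x) \<partial>lborel) \<le> ennreal (1 + \<epsilon>)"
    "ennreal N \<le> (\<integral>\<^sup>+x. ennreal (x * w x * h x) \<partial>lborel)"
    "(\<integral>\<^sup>+x. ennreal (x * w x * h x) \<partial>lborel) < \<infinity>"
proof (cases "(\<integral>\<^sup>+x. ennreal (x * h x) \<partial>lborel) = \<infinity>")
  case True
  have [measurable]: "h \<in> borel_measurable borel" using halfline_densityD(1)[OF h] .
  have nn: "0 \<le> h x" for x using halfline_densityD(2)[OF h] .
  let ?w = "\<lambda>n x. exp (- (x / real (Suc n)))"
  have "(SUP n. \<integral>\<^sup>+x. ennreal (x * ?w n x * h x) \<partial>lborel) = (\<integral>\<^sup>+x. (SUP n. ennreal (x * ?w n x * h x)) \<partial>lborel)"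
  proof (intro nn_integral_monotone_convergence_SUP[symmetric])
    show "incseq (\<lambda>n x. ennreal (x * ?w n x * h x))"
      unfolding incseq_def le_fun_def
    proof (intro allI impI)
      fix m n :: nat and x assume "m \<le> n"
      show "ennreal (x * ?w m x * h x) \<le> ennreal (x * ?w n x * h x)"
      proof (cases "x < 0")
        case False
        then show ?thesis using nn \<open>m \<le> n\<close>
          by (intro ennreal_leI mult_right_mono mult_left_mono) (auto intro!: divide_left_mono)
      qed (simp add: halfline_densityD(3)[OF h])
    qed
  qed measurable
  also have "\<dots> = (\<integral>\<^sup>+x. ennreal (x * h x) \<partial>lborel)"
  proof (rule nn_integral_cong)
    fix x
    have "(\<lambda>n. x * ?w n x * h x) \<longlonglongrightarrow> x * exp (- 0) * h x"
      by (intro tendsto_intros LIMSEQ_Suc[OF lim_const_over_n])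
    then have lim: "(\<lambda>n. ennreal (x * ?w n x * h x)) \<longlonglongrightarrow> ennreal (x * h x)" by simp
    have "incseq (\<lambda>n. ennreal (x * ?w n x * h x))"
      unfolding incseq_def
    proof (intro allI impI)
      fix m n :: nat assume "m \<le> n"
      show "ennreal (x * ?w m x * h x) \<le> ennreal (x * ?w n x * h x)"
      proof (cases "x < 0")
        case False
        then show ?thesis using nn \<open>m \<le> n\<close>
          by (intro ennreal_leI mult_right_mono mult_left_mono) (auto intro!: divide_left_mono)
      qed (simp add: halfline_densityD(3)[OF h])
    qed
    then show "(SUP n. ennreal (x * ?w n x * h x)) = ennreal (x * h x)"
      using LIMSEQ_unique[OF LIMSEQ_SUP lim] by blast
  qed
  also have "\<dots> = \<infinity>" by (fact True)
  finally have sup: "(SUP n. \<integral>\<^sup>+x. ennreal (x * ?w n x * h x) \<partial>lborel) = \<infinity>" .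
  have "ennreal N < (SUP n. \<integral>\<^sup>+x. ennreal (x * ?w n x * h x) \<partial>lborel)" unfolding sup by simp
  then obtain n where n: "ennreal N < (\<integral>\<^sup>+x. ennreal (x * ?w n x * h x) \<partial>lborel)"
    unfolding less_SUP_iff by blast
  show ?thesis
  proof (rule that[of "?w n"])
    show "(\<integral>\<^sup>+x. ennreal (max 1 (?w n x) * h x) \<partial>lborel) \<le> ennreal (1 + \<epsilon>)"
    proof -
      have "(\<integral>\<^sup>+x. ennreal (max 1 (?w n x) * h x) \<partial>lborel) \<le> (\<integral>\<^sup>+x. ennreal (h x) \<partial>lborel)"
      proof (rule nn_integral_mono)
        fix x
        show "ennreal (max 1 (?w n x) * h x) \<le> ennreal (h x)"
        proof (cases "x < 0")
          case False
          then have "?w n x \<le> 1" by simp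
          then show ?thesis by (simp add: max_absorb1)
        qed (simp add: halfline_densityD(3)[OF h])
      qed
      also have "\<dots> \<le> ennreal (1 + \<epsilon>)" using halfline_densityD(4)[OF h] \<epsilon> by simp
      finally show ?thesis .
    qed
    show "(\<integral>\<^sup>+x. ennreal (x * ?w n x * h x) \<partial>lborel) < \<infinity>"
    proof -
      have "(\<integral>\<^sup>+x. ennreal (x * ?w n x * h x) \<partial>lborel) \<le> (\<integral>\<^sup>+x. ennreal (real (Suc n)) * ennreal (h x) \<partial>lborel)"
      proof (rule nn_integral_mono)
        fix x
        have "x / real (Suc n) \<le> exp (x / real (Suc n))" using exp_ge_add_one_self[of "x / real (Suc n)"] by linarith
        then have "x / real (Suc n) * ?w n x \<le> exp (x / real (Suc n)) * ?w n x" by (intro mult_right_mono) auto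
        then have "x / real (Suc n) * ?w n x \<le> 1" by (simp add: exp_minus)
        then have "x * ?w n x \<le> real (Suc n)" by (simp add: field_simps)
        then have "x * ?w n x * h x \<le> real (Suc n) * h x" using nn[of x] by (rule mult_right_mono)
        then show "ennreal (x * ?w n x * h x) \<le> ennreal (real (Suc n)) * ennreal (h x)"
          using nn by (simp add: ennreal_mult[symmetric] ennreal_leI del: of_nat_Suc)
      qed
      also have "\<dots> < \<infinity>" by (subst nn_integral_cmult) (auto simp: halfline_densityD(4)[OF h] ennreal_mult_less_top)
      finally show ?thesis .
    qed
    show "?w n x \<le> exp x" if "0 \<le> x" for x
    proof -
      have "?w n x \<le> 1" using that by simp
      also have "1 \<le> exp x" using that by simp
      finally show ?thesis .
    qed
    show "max 1 (?w n x) \<le> max 1 (?w n (x + y))" if "0 \<le> x" "0 \<le> y" for x y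
      using that by simp
    show "?w n (x + y) \<le> ?w n x * ?w n y" for x y
      by (simp add: exp_add[symmetric] add_divide_distrib)
  qed (use n in auto)
next
  case False
  have [measurable]: "h \<in> borel_measurable borel" using halfline_densityD(1)[OF h] .
  have nn: "0 \<le> h x" for x using halfline_densityD(2)[OF h] .
  \<comment> \<open>At least half of the excess mass \<open>\<epsilon>\<close> will lie beyond \<open>N'\<close>, which yields the first moment \<open>N' * (\<epsilon> / 2) = N\<close>.\<close>
  define N' where "N' = 2 * N / \<epsilon>"
  have N': "0 < N'" using N \<epsilon> by (simp add: N'_def)
  define \<theta> where "\<theta> = min 1 (ln (1 + \<epsilon> / 2) / N')"
  have \<theta>: "0 < \<theta>" "\<theta> \<le> 1" using N' \<epsilon> by (auto simp: \<theta>_def)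
  have \<theta>N: "exp (\<theta> * x) \<le> 1 + \<epsilon> / 2" if "x \<le> N'" for x
  proof -
    have "\<theta> * x \<le> \<theta> * N'" using that \<theta> by simp
    also have "\<dots> \<le> ln (1 + \<epsilon> / 2) / N' * N'" using N' by (intro mult_right_mono) (auto simp: \<theta>_def)
    also have "\<dots> = ln (1 + \<epsilon> / 2)" using N' by simp
    finally show ?thesis using \<epsilon> by (simp add: ln_ge_iff)
  qed
  obtain B where B: "1 \<le> B" "(\<integral>\<^sup>+x. ennreal (min (exp (\<theta> * x)) B * h x) \<partial>lborel) = ennreal (1 + \<epsilon>)"
    using truncated_exp_mass[OF h u \<theta>(1) \<epsilon>] by blast
  let ?w = "\<lambda>x. min (exp (\<theta> * x)) B"
  have w1: "1 \<le> ?w x" if "0 \<le> x" for x using that B \<theta> by simp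
  have w0: "0 \<le> ?w x" for x using B by simp
  show ?thesis
  proof (rule that[of ?w])
    show "?w x \<le> exp x" if "0 \<le> x" for x
    proof -
      have "\<theta> * x \<le> 1 * x" using that \<theta> by (intro mult_right_mono) auto
      then show ?thesis by (simp add: min.coboundedI1)
    qed
    show "?w (x + y) \<le> ?w x * ?w y" if "0 \<le> x" "0 \<le> y" for x y
    proof -
      have x: "1 \<le> ?w x" and y: "1 \<le> ?w y" using that w1 by auto
      consider "?w x = exp (\<theta> * x)" "?w y = exp (\<theta> * y)" | "?w x = B" | "?w y = B" by (metis min_def)
      then show ?thesis
      proof cases
        case 1
        then have "?w x * ?w y = exp (\<theta> * (x + y))" by (simp add: exp_add algebra_simps)
        then show ?thesis by simp
      next
        case 2
        have "B * 1 \<le> B * ?w y" using B(1) y by (intro mult_left_mono) auto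
        then show ?thesis unfolding 2 by simp
      next
        case 3
        have "1 * B \<le> ?w x * B" using B(1) x by (intro mult_right_mono) auto
        then show ?thesis unfolding 3 by simp
      qed
    qed
    show "max 1 (?w x) \<le> max 1 (?w (x + y))" if "0 \<le> x" "0 \<le> y" for x y
      using that \<theta> by (intro max.mono min.mono) auto
    show "(\<integral>\<^sup>+x. ennreal (max 1 (?w x) * h x) \<partial>lborel) \<le> ennreal (1 + \<epsilon>)"
    proof -
      have "(\<integral>\<^sup>+x. ennreal (max 1 (?w x) * h x) \<partial>lborel) = (\<integral>\<^sup>+x. ennreal (?w x * h x) \<partial>lborel)"
      proof (rule nn_integral_cong)
        fix x
        show "ennreal (max 1 (?w x) * h x) = ennreal (?w x * h x)"
        proof (cases "x < 0")
          case False
          then have "max 1 (?w x) = ?w x" using w1[of x] by (intro max_absorb2) auto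
          then show ?thesis by simp
        qed (simp add: halfline_densityD(3)[OF h])
      qed
      then show ?thesis using B by simp
    qed
    show "(\<integral>\<^sup>+x. ennreal (x * ?w x * h x) \<partial>lborel) < \<infinity>"
    proof -
      have "(\<integral>\<^sup>+x. ennreal (x * ?w x * h x) \<partial>lborel) \<le> (\<integral>\<^sup>+x. ennreal B * ennreal (x * h x) \<partial>lborel)"
      proof (rule nn_integral_mono)
        fix x
        show "ennreal (x * ?w x * h x) \<le> ennreal B * ennreal (x * h x)"
        proof (cases "x < 0")
          case False
          then have "x * h x * ?w x \<le> x * h x * B" using nn by (intro mult_left_mono) auto
          also have "\<dots> = B * (x * h x)" by simp
          finally show ?thesis using False nn B by (simp add: ennreal_mult[symmetric] ennreal_leI ac_simps)
        qed (simp add: halfline_densityD(3)[OF h])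
      qed
      also have "\<dots> = ennreal B * (\<integral>\<^sup>+x. ennreal (x * h x) \<partial>lborel)" by (rule nn_integral_cmult) measurable
      also have "\<dots> < \<infinity>" using False by (simp add: ennreal_mult_less_top less_top)
      finally show ?thesis .
    qed
    show "ennreal N \<le> (\<integral>\<^sup>+x. ennreal (x * ?w x * h x) \<partial>lborel)"
    proof -
      let ?far = "\<integral>\<^sup>+x. ennreal (?w x * h x) * indicator {N'<..} x \<partial>lborel"
      have "ennreal (1 + \<epsilon>) = (\<integral>\<^sup>+x. ennreal (?w x * h x) \<partial>lborel)" using B by simp
      also have "\<dots> \<le> (\<integral>\<^sup>+x. ennreal (1 + \<epsilon> / 2) * ennreal (h x) + ennreal (?w x * h x) * indicator {N'<..} x \<partial>lborel)"
      proof (rule nn_integral_mono)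
        fix x
        show "ennreal (?w x * h x) \<le> ennreal (1 + \<epsilon> / 2) * ennreal (h x) + ennreal (?w x * h x) * indicator {N'<..} x"
        proof (cases "x \<le> N'")
          case True
          then have "?w x * h x \<le> (1 + \<epsilon> / 2) * h x" using \<theta>N[of x] nn by (intro mult_right_mono) auto
          then have "ennreal (?w x * h x) \<le> ennreal ((1 + \<epsilon> / 2) * h x)" by (rule ennreal_leI)
          also have "\<dots> = ennreal (1 + \<epsilon> / 2) * ennreal (h x)" using \<epsilon> nn by (intro ennreal_mult) auto
          finally show ?thesis by (rule order_trans) simp
        qed (simp add: add_increasing)
      qed
      also have "\<dots> = ennreal (1 + \<epsilon> / 2) + ?far"
        by (subst nn_integral_add) (auto simp: nn_integral_cmult halfline_densityD(4)[OF h])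
      finally have le: "ennreal (1 + \<epsilon>) \<le> ennreal (1 + \<epsilon> / 2) + ?far" .
      have far: "ennreal (\<epsilon> / 2) \<le> ?far"
      proof (cases ?far)
        case (real r)
        then have "1 + \<epsilon> \<le> 1 + \<epsilon> / 2 + r" using le \<epsilon> by (simp flip: ennreal_plus)
        then show ?thesis using real by (simp add: ennreal_leI)
      qed simp
      have "ennreal N = ennreal N' * ennreal (\<epsilon> / 2)"
        using N' \<epsilon> by (subst ennreal_mult[symmetric]) (auto simp: N'_def)
      also have "\<dots> \<le> ennreal N' * ?far" by (intro mult_left_mono far) auto
      also have "\<dots> = (\<integral>\<^sup>+x. ennreal N' * (ennreal (?w x * h x) * indicator {N'<..} x) \<partial>lborel)"
        by (rule nn_integral_cmult[symmetric]) measurable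
      also have "\<dots> \<le> (\<integral>\<^sup>+x. ennreal (x * ?w x * h x) \<partial>lborel)"
      proof (rule nn_integral_mono)
        fix x
        show "ennreal N' * (ennreal (?w x * h x) * indicator {N'<..} x) \<le> ennreal (x * ?w x * h x)"
        proof (cases "N' < x")
          case True
          then have "N' * (?w x * h x) \<le> x * (?w x * h x)" using w0[of x] nn[of x] by (intro mult_right_mono) auto
          then show ?thesis using True N' w0[of x] nn[of x]
            by (simp add: ennreal_mult[symmetric] ennreal_leI mult.assoc)
        qed simp
      qed
      finally show ?thesis .
    qed
  qed (use w0 in auto)
qed

lemma nn_conv_integral:
  assumes [measurable]: "F \<in> borel_measurable borel" "G \<in> borel_measurable borel"
  shows "(\<integral>\<^sup>+x. nn_conv F G x \<partial>lborel) = (\<integral>\<^sup>+x. F x \<partial>lborel) * (\<integral>\<^sup>+x. G x \<partial>lborel)"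
proof -
  have "(\<integral>\<^sup>+x. nn_conv F G x \<partial>lborel) = (\<integral>\<^sup>+v. (\<integral>\<^sup>+x. F (x - v) * G v \<partial>lborel) \<partial>lborel)"
    unfolding nn_conv_def by (rule lborel_pair.Fubini') measurable
  also have "\<dots> = (\<integral>\<^sup>+v. (\<integral>\<^sup>+x. F x \<partial>lborel) * G v \<partial>lborel)"
  proof (rule nn_integral_cong)
    fix v
    have "(\<integral>\<^sup>+x. F (x - v) * G v \<partial>lborel) = (\<integral>\<^sup>+x. F (x - v) \<partial>lborel) * G v"
      by (rule nn_integral_multc) measurable
    then show "(\<integral>\<^sup>+x. F (x - v) * G v \<partial>lborel) = (\<integral>\<^sup>+x. F x \<partial>lborel) * G v"
      by (simp add: nn_integral_lborel_shift)
  qed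
  also have "\<dots> = (\<integral>\<^sup>+x. F x \<partial>lborel) * (\<integral>\<^sup>+x. G x \<partial>lborel)" by (rule nn_integral_cmult) measurable
  finally show ?thesis .
qed

context density_semigroup
begin

text \<open>
  Integrate the size-biased identity against a weight \<open>w\<close> of the preceding kind. Submultiplicativity
  separates the two summands and bounds \<open>s / (s + t)\<close> times the weighted first moment of \<open>p (s + t)\<close> by the
  weighted first moment of \<open>p s\<close> times the \<open>w\<close>-mass of \<open>p t\<close>. The latter is close to \<open>1\<close>, and up to a
  bounded error the weighted first moment of \<open>p s\<close> is at most \<open>c'\<close> times that of \<open>p (s + t)\<close>, for any
  \<open>c' > c\<close>. As the moments can be made arbitrarily large, \<open>s / (s + t) \<le> c\<close>.
\<close>
lemma time_ratio_le_ratio: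
  assumes st: "0 < s" "0 < t" and u: "uniformly_long_tailed (p (s + t))"
    and lim: "((\<lambda>x. p s x / p (s + t) x) \<longlongrightarrow> c) at_top" and pos: "\<forall>\<^sub>F x in at_top. 0 < p (s + t) x"
  shows "s / (s + t) \<le> c"
proof (rule ccontr)
  define T where "T = s + t"
  have T: "0 < T" using st by (simp add: T_def)
  have [measurable]: "p s \<in> borel_measurable borel" "p t \<in> borel_measurable borel" "p T \<in> borel_measurable borel"
    using p_measurable st T by auto
  assume "\<not> s / (s + t) \<le> c"
  then have less: "c < s / T" by (simp add: T_def)
  have "0 \<le> c"
    using lim pos p_nonneg[OF st(1)] by (intro tendsto_lowerbound[OF lim]) (auto elim!: eventually_mono)
  obtain c' where c': "c < c'" "c' < s / T" using dense[OF less] by blast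
  have "0 < c'" using c' \<open>0 \<le> c\<close> by linarith
  note c' = c' this
  obtain \<epsilon> where \<epsilon>: "0 < \<epsilon>" and q: "c' * (1 + \<epsilon>) < s / T"
  proof -
    obtain d where d: "c' < d" "d < s / T" using dense[OF c'(2)] by blast
    have "c' * (1 + (d - c') / c') = d" using c'(3) by (simp add: field_simps)
    moreover have "0 < (d - c') / c'" using d c'(3) by simp
    ultimately show ?thesis using that[of "(d - c') / c'"] d by metis
  qed
  obtain X0 where X0: "\<And>x. X0 \<le> x \<Longrightarrow> p s x \<le> c' * p T x"
    using tendsto_ratio_bounds[OF lim pos _ c'(1), of "c - 1"] unfolding T_def[symmetric] by (metis diff_less zero_less_one less_add_one diff_less_eq)
  define X where "X = max X0 0"
  have X: "0 \<le> X" "\<And>x. X \<le> x \<Longrightarrow> p s x \<le> c' * p T x" using X0 by (auto simp: X_def)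
  define D where "D = X * exp X"
  have D: "0 \<le> D" using X by (simp add: D_def)
  \<comment> \<open>The estimate below reads \<open>(s / T - c' * (1 + \<epsilon>)) * J \<le> (1 + \<epsilon>) * D\<close> for the weighted moment \<open>J \<ge> N\<close>; this \<open>N\<close> refutes it.\<close>
  define N where "N = ((1 + \<epsilon>) * D + 1) / (s / T - c' * (1 + \<epsilon>))"
  have N: "0 < N" using q D \<epsilon> by (auto simp: N_def intro!: divide_pos_pos add_nonneg_pos)
  obtain w where w [measurable]: "w \<in> borel_measurable borel" and w0: "\<And>x. 0 \<le> w x"
    and wexp: "\<And>x. 0 \<le> x \<Longrightarrow> w x \<le> exp x"
    and wsub: "\<And>x y. 0 \<le> x \<Longrightarrow> 0 \<le> y \<Longrightarrow> w (x + y) \<le> w x * w y"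
    and wmono: "\<And>x y. 0 \<le> x \<Longrightarrow> 0 \<le> y \<Longrightarrow> max 1 (w x) \<le> max 1 (w (x + y))"
    and w1: "(\<integral>\<^sup>+x. ennreal (max 1 (w x) * p T x) \<partial>lborel) \<le> ennreal (1 + \<epsilon>)"
    and wN: "ennreal N \<le> (\<integral>\<^sup>+x. ennreal (x * w x * p T x) \<partial>lborel)"
    and wfin: "(\<integral>\<^sup>+x. ennreal (x * w x * p T x) \<partial>lborel) < \<infinity>"
    by (rule submultiplicative_weight[OF halfline[OF T] u[folded T_def] \<epsilon> N]) (rule that; assumption)
  obtain J where J: "(\<integral>\<^sup>+x. ennreal (x * w x * p T x) \<partial>lborel) = ennreal J" "0 \<le> J"
    using wfin by (cases "\<integral>\<^sup>+x. ennreal (x * w x * p T x) \<partial>lborel") auto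
  have NJ: "N \<le> J" using wN J N by simp
  let ?S = "\<integral>\<^sup>+x. ennreal (x * w x * p s x) \<partial>lborel" and ?W = "\<integral>\<^sup>+x. ennreal (w x * p t x) \<partial>lborel"
  have W: "?W \<le> ennreal (1 + \<epsilon>)"
  proof -
    have "?W \<le> (\<integral>\<^sup>+x. ennreal (max 1 (w x) * p t x) \<partial>lborel)"
      using p_nonneg st by (intro nn_integral_mono ennreal_leI mult_right_mono) auto
    also have "\<dots> = (\<integral>\<^sup>+x. nn_conv (\<lambda>x. ennreal (p s x)) (\<lambda>x. ennreal (max 1 (w x) * p t x)) x \<partial>lborel)"
      by (subst nn_conv_integral) (auto simp: p_integral st)
    also have "\<dots> \<le> (\<integral>\<^sup>+x. ennreal (max 1 (w x)) * nn_conv (\<lambda>x. ennreal (p s x)) (\<lambda>x. ennreal (p t x)) x \<partial>lborel)"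
    proof (rule nn_integral_mono)
      fix x
      have "nn_conv (\<lambda>x. ennreal (p s x)) (\<lambda>x. ennreal (max 1 (w x) * p t x)) x \<le>
          (\<integral>\<^sup>+v. ennreal (max 1 (w x)) * (ennreal (p s (x - v)) * ennreal (p t v)) \<partial>lborel)"
        unfolding nn_conv_def
      proof (rule nn_integral_mono)
        fix v
        show "ennreal (p s (x - v)) * ennreal (max 1 (w v) * p t v) \<le>
          ennreal (max 1 (w x)) * (ennreal (p s (x - v)) * ennreal (p t v))"
        proof (cases "v < 0 \<or> x - v < 0")
          case True
          then show ?thesis using p_neg[of t v] p_neg[of s "x - v"] st by auto
        next
          case False
          then have "max 1 (w v) \<le> max 1 (w x)" using wmono[of v "x - v"] by simp
          then have "p s (x - v) * p t v * max 1 (w v) \<le> p s (x - v) * p t v * max 1 (w x)"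
            using p_nonneg st by (intro mult_left_mono) auto
          then have "ennreal (p s (x - v) * (max 1 (w v) * p t v)) \<le> ennreal (max 1 (w x) * (p s (x - v) * p t v))"
            by (intro ennreal_leI) (simp add: ac_simps)
          then show ?thesis using p_nonneg st by (simp add: ennreal_mult[symmetric])
        qed
      qed
      also have "\<dots> = ennreal (max 1 (w x)) * nn_conv (\<lambda>x. ennreal (p s x)) (\<lambda>x. ennreal (p t x)) x"
        unfolding nn_conv_def by (rule nn_integral_cmult) measurable
      finally show "nn_conv (\<lambda>x. ennreal (p s x)) (\<lambda>x. ennreal (max 1 (w x) * p t x)) x \<le>
        ennreal (max 1 (w x)) * nn_conv (\<lambda>x. ennreal (p s x)) (\<lambda>x. ennreal (p t x)) x" .
    qed
    also have "\<dots> = (\<integral>\<^sup>+x. ennreal (max 1 (w x) * p T x) \<partial>lborel)"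
      unfolding nn_conv_p[OF st] T_def using p_nonneg[of "s + t"] st
      by (intro nn_integral_cong ennreal_mult[symmetric]) auto
    also note w1
    finally show ?thesis .
  qed
  have S: "?S \<le> ennreal (D + c' * J)"
  proof -
    have "?S \<le> (\<integral>\<^sup>+x. ennreal D * ennreal (p s x) + ennreal c' * ennreal (x * w x * p T x) \<partial>lborel)"
    proof (rule nn_integral_mono)
      fix x
      consider "x < 0" | "0 \<le> x" "x < X" | "X \<le> x" by linarith
      then show "ennreal (x * w x * p s x) \<le> ennreal D * ennreal (p s x) + ennreal c' * ennreal (x * w x * p T x)"
      proof cases
        case 2
        have "x * w x \<le> X * exp X"
          using 2 wexp[of x] w0[of x] by (intro mult_mono) (auto intro: order_trans)
        then have "x * w x * p s x \<le> D * p s x" unfolding D_def using p_nonneg st by (intro mult_right_mono) auto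
        then have "ennreal (x * w x * p s x) \<le> ennreal D * ennreal (p s x)"
          using D p_nonneg st by (simp add: ennreal_mult[symmetric] ennreal_leI)
        then show ?thesis by (rule order_trans) simp
      next
        case 3
        then have "x * w x * p s x \<le> x * w x * (c' * p T x)"
          using X w0[of x] by (intro mult_left_mono) auto
        also have "\<dots> = c' * (x * w x * p T x)" by simp
        finally have "ennreal (x * w x * p s x) \<le> ennreal c' * ennreal (x * w x * p T x)"
          using 3 X c' w0[of x] p_nonneg[OF T, of x] by (simp add: ennreal_mult[symmetric] ennreal_leI)
        then show ?thesis by (rule order_trans) simp
      qed (simp add: p_neg st)
    qed
    also have "\<dots> = ennreal D + ennreal c' * ennreal J"
      by (subst nn_integral_add) (auto simp: nn_integral_cmult p_integral st J)
    also have "\<dots> = ennreal (D + c' * J)" using D c' J by (simp add: ennreal_mult)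
    finally show ?thesis .
  qed
  have "ennreal (s / T * J) = ennreal (s / T) * (\<integral>\<^sup>+x. ennreal (x * w x * p T x) \<partial>lborel)"
    unfolding J(1) using st T J(2) by (intro ennreal_mult) auto
  also have "\<dots> = (\<integral>\<^sup>+x. ennreal (s / T) * ennreal (x * w x * p T x) \<partial>lborel)"
    by (rule nn_integral_cmult[symmetric]) measurable
  also have "\<dots> = (\<integral>\<^sup>+x. ennreal (w x) * (\<integral>\<^sup>+v. ennreal ((x - v) * p s (x - v) * p t v) \<partial>lborel) \<partial>lborel)"
  proof (rule nn_integral_cong)
    fix x
    have "ennreal (w x) * (\<integral>\<^sup>+v. ennreal ((x - v) * p s (x - v) * p t v) \<partial>lborel) = ennreal (w x) * ennreal (s / T * (x * p T x))"
      unfolding size_biased_conv[OF st] T_def ..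
    also have "\<dots> = ennreal (s / T) * ennreal (x * w x * p T x)"
    proof -
      have "ennreal (w x) * ennreal (s / T * (x * p T x)) = ennreal (w x * (s / T * (x * p T x)))"
        using w0[of x] by (rule ennreal_mult'[symmetric])
      also have "w x * (s / T * (x * p T x)) = s / T * (x * w x * p T x)" by simp
      also have "ennreal \<dots> = ennreal (s / T) * ennreal (x * w x * p T x)"
        using st T by (intro ennreal_mult') auto
      finally show ?thesis .
    qed
    finally show "ennreal (s / T) * ennreal (x * w x * p T x) =
       ennreal (w x) * (\<integral>\<^sup>+v. ennreal ((x - v) * p s (x - v) * p t v) \<partial>lborel)" by simp
  qed
  also have "\<dots> \<le> (\<integral>\<^sup>+x. nn_conv (\<lambda>x. ennreal (x * w x * p s x)) (\<lambda>x. ennreal (w x * p t x)) x \<partial>lborel)"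
  proof (rule nn_integral_mono)
    fix x
    have "ennreal (w x) * (\<integral>\<^sup>+v. ennreal ((x - v) * p s (x - v) * p t v) \<partial>lborel) =
       (\<integral>\<^sup>+v. ennreal (w x) * ennreal ((x - v) * p s (x - v) * p t v) \<partial>lborel)"
      by (rule nn_integral_cmult[symmetric]) measurable
    also have "\<dots> \<le> nn_conv (\<lambda>x. ennreal (x * w x * p s x)) (\<lambda>x. ennreal (w x * p t x)) x"
      unfolding nn_conv_def
    proof (rule nn_integral_mono)
      fix v
      show "ennreal (w x) * ennreal ((x - v) * p s (x - v) * p t v) \<le>
        ennreal ((x - v) * w (x - v) * p s (x - v)) * ennreal (w v * p t v)"
      proof (cases "v < 0 \<or> x - v < 0")
        case True
        then show ?thesis using p_neg[of t v] p_neg[of s "x - v"] st by auto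
      next
        case False
        then have "w x \<le> w (x - v) * w v" using wsub[of "x - v" v] by simp
        then have "((x - v) * p s (x - v) * p t v) * w x \<le> ((x - v) * p s (x - v) * p t v) * (w (x - v) * w v)"
          using False p_nonneg st by (intro mult_left_mono) auto
        then have "ennreal (w x * ((x - v) * p s (x - v) * p t v)) \<le> ennreal ((x - v) * w (x - v) * p s (x - v) * (w v * p t v))"
          by (intro ennreal_leI) (simp add: ac_simps)
        then show ?thesis
          using False w0[of x] w0[of v] p_nonneg st by (simp add: ennreal_mult'[symmetric] ennreal_mult''[symmetric])
      qed
    qed
    finally show "ennreal (w x) * (\<integral>\<^sup>+v. ennreal ((x - v) * p s (x - v) * p t v) \<partial>lborel) \<le>
       nn_conv (\<lambda>x. ennreal (x * w x * p s x)) (\<lambda>x. ennreal (w x * p t x)) x" .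
  qed
  also have "\<dots> = ?S * ?W" by (rule nn_conv_integral) measurable
  also have "\<dots> \<le> ennreal (D + c' * J) * ennreal (1 + \<epsilon>)" by (intro mult_mono S W) auto
  also have "\<dots> = ennreal ((D + c' * J) * (1 + \<epsilon>))" using D c' J \<epsilon> by (intro ennreal_mult[symmetric]) auto
  finally have "s / T * J \<le> (D + c' * J) * (1 + \<epsilon>)" using D c' J \<epsilon> by (simp add: ennreal_le_iff)
  then have "(s / T - c' * (1 + \<epsilon>)) * J \<le> (1 + \<epsilon>) * D" by (simp add: algebra_simps)
  moreover have "(s / T - c' * (1 + \<epsilon>)) * N \<le> (s / T - c' * (1 + \<epsilon>)) * J"
    using NJ q by (intro mult_left_mono) auto
  moreover have "(s / T - c' * (1 + \<epsilon>)) * N = (1 + \<epsilon>) * D + 1" using q by (simp add: N_def)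
  ultimately show False by linarith
qed

end

context density_semigroup
begin

lemma subexp_if_tail_ratio:
  assumes st: "0 < s" "0 < t" and l: "long_tailed (p (s + t))"
    and lim: "((\<lambda>x. p s x / p (s + t) x) \<longlongrightarrow> c) at_top" and c: "0 < c"
    and pos: "\<forall>\<^sub>F x in at_top. 0 < p (s + t) x"
  shows "c = s / (s + t)" "subexp_density (p s)" "subexp_density (p (s + t))"
proof -
  have T: "0 < s + t" using st by simp
  note uT = long_tailed_uniform[OF l cont[OF T]]
  have ls: "long_tailed (p s)"
    using p_measurable p_nonneg st by (intro long_tailed_cong[OF l _ _ lim c]) auto
  note us = long_tailed_uniform[OF ls cont[OF st(1)]]
  show eq: "c = s / (s + t)"
    using ratio_le_time_ratio[OF st us lim pos] time_ratio_le_ratio[OF st uT lim pos] by (rule antisym)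
  show s: "subexp_density (p s)"
    using negligible_middle_if_ratio[OF st us lim[unfolded eq] pos]
    by (rule negligible_middle_imp_subexp_density[OF halfline[OF st(1)] ls us])
  have "((\<lambda>x. inverse (p s x / p (s + t) x)) \<longlongrightarrow> inverse c) at_top"
    using lim c by (intro tendsto_inverse) auto
  then have lim': "((\<lambda>x. p (s + t) x / p s x) \<longlongrightarrow> inverse c) at_top" by simp
  show "subexp_density (p (s + t))"
    using c by (intro subexp_density_cong[OF s halfline[OF st(1)] cont[OF st(1)] halfline[OF T] cont[OF T] lim']) auto
qed

lemma tail_ratio_at_one:
  assumes l: "long_tailed_density (p 1)" and t: "0 < t" "t \<noteq> 1" and C: "0 < C"
    and te: "tail_equiv (p t) (\<lambda>x. C * p 1 x)"
  shows "C = t" "subexp_density (p 1)"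
proof -
  have l1: "long_tailed (p 1)" using l by (simp add: long_tailed_density_def)
  have pos: "\<forall>\<^sub>F x in at_top. 0 < p t x \<and> 0 < p 1 x"
    using te C unfolding tail_equiv_iff by (auto simp: zero_less_mult_iff elim: eventually_mono)
  have "((\<lambda>x. C * (p t x / (C * p 1 x))) \<longlongrightarrow> C * 1) at_top"
    using te unfolding tail_equiv_iff by (intro tendsto_mult tendsto_const) auto
  then have lim: "((\<lambda>x. p t x / p 1 x) \<longlongrightarrow> C) at_top" using C by simp
  have "C = t \<and> subexp_density (p 1)"
  proof (cases "t < 1")
    case True
    have "\<forall>\<^sub>F x in at_top. 0 < p 1 x" using pos by eventually_elim simp
    then show ?thesis using subexp_if_tail_ratio[of t "1 - t" C] l1 lim t C True by simp
  next
    case False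
    then have t1: "1 < t" using t by simp
    have "((\<lambda>x. inverse (p t x / p 1 x)) \<longlongrightarrow> inverse C) at_top"
      using lim C by (intro tendsto_inverse) auto
    then have lim': "((\<lambda>x. p 1 x / p t x) \<longlongrightarrow> inverse C) at_top" by simp
    have "long_tailed (p t)"
      using p_measurable p_nonneg t by (intro long_tailed_cong[OF l1 _ _ lim C]) auto
    moreover have "\<forall>\<^sub>F x in at_top. 0 < p t x" using pos by eventually_elim simp
    ultimately have "inverse C = 1 / t" "subexp_density (p 1)"
      using subexp_if_tail_ratio[of 1 "t - 1" "inverse C"] lim' t1 C by simp_all
    then show ?thesis by (simp add: inverse_eq_divide)
  qed
  then show "C = t" "subexp_density (p 1)" by auto
qed

end

section \<open>Domination of exponential kernels\<close>

text \<open>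
  A long-tailed function decays more slowly than any exponential, so exponential damping beats both its
  growth to the left and, beyond the range where it is controlled, its mere boundedness.
\<close>
lemma uniformly_long_tailed_damped_bound:
  assumes u: "uniformly_long_tailed h" and nn: "\<And>x. 0 \<le> h x" and H: "\<And>x. h x \<le> H" and \<alpha>: "0 < \<alpha>"
  obtains C X where "0 < C"
    "\<And>x w. X \<le> x \<Longrightarrow> 0 \<le> w \<Longrightarrow> exp (- \<alpha> * w) * h (x - w) \<le> C * exp (- (\<alpha> / 2) * w) * h x"
proof -
  define \<beta> where "\<beta> = \<alpha> / 2"
  have \<beta>: "0 < \<beta>" "\<alpha> = \<beta> + \<beta>" using \<alpha> by (auto simp: \<beta>_def)
  obtain X where X: "\<And>x. X \<le> x \<Longrightarrow> 0 < h x"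
    "\<And>x w. 0 \<le> w \<Longrightarrow> X \<le> x - w \<Longrightarrow> h (x - w) \<le> exp (\<beta> * (w + 1)) * h x"
    using uniformly_long_tailed_exp_bound[OF u \<beta>(1)] by blast
  have H0: "0 \<le> H" using nn[of 0] H[of 0] by linarith
  have hX: "0 < h X" using X by simp
  define C where "C = exp \<beta> * (1 + H / h X)"
  have C: "0 < C" "exp \<beta> \<le> C" "exp \<beta> * (H / h X) \<le> C"
    using H0 hX by (auto simp: C_def algebra_simps intro!: add_pos_nonneg)
  show ?thesis
  proof (rule that[OF C(1)])
    fix x w :: real assume x: "X \<le> x" and w: "0 \<le> w"
    have e: "exp (- \<alpha> * w) = exp (- \<beta> * w) * exp (- \<beta> * w)" by (simp add: exp_add[symmetric] \<beta>(2) algebra_simps)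
    have "exp (- \<alpha> * w) * h (x - w) \<le> C * exp (- \<beta> * w) * h x"
    proof (cases "X \<le> x - w")
      case True
      have "exp (- \<alpha> * w) * h (x - w) \<le> exp (- \<alpha> * w) * (exp (\<beta> * (w + 1)) * h x)"
        using X(2)[OF w True] by (intro mult_left_mono) auto
      also have "\<dots> = exp \<beta> * exp (- \<beta> * w) * h x"
        by (simp add: \<beta>(2) exp_add[symmetric] mult.assoc[symmetric]) (simp add: algebra_simps)
      also have "\<dots> \<le> C * exp (- \<beta> * w) * h x" using C nn by (intro mult_right_mono) auto
      finally show ?thesis .
    next
      case False
      have "h X \<le> exp (\<beta> * (x - X + 1)) * h x" using X(2)[of "x - X" x] x by simp
      also have "\<dots> \<le> exp (\<beta> * (w + 1)) * h x"
        using False \<beta> nn by (intro mult_right_mono) auto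
      finally have hX': "exp (- \<beta> * w) * h X \<le> exp (- \<beta> * w) * (exp (\<beta> * (w + 1)) * h x)"
        by (intro mult_left_mono) auto
      also have "exp (- \<beta> * w) * (exp (\<beta> * (w + 1)) * h x) = exp \<beta> * h x"
      proof -
        have "exp (- \<beta> * w) * exp (\<beta> * (w + 1)) = exp \<beta>"
          by (subst exp_add[symmetric]) (simp add: algebra_simps)
        then show ?thesis by (simp only: mult.assoc[symmetric])
      qed
      finally have "exp (- \<beta> * w) \<le> exp \<beta> * h x / h X" using hX by (simp add: field_simps)
      then have "exp (- \<beta> * w) * H \<le> exp \<beta> * h x / h X * H" using H0 by (rule mult_right_mono)
      also have "\<dots> = exp \<beta> * (H / h X) * h x" by simp
      also have "\<dots> \<le> C * h x" using C nn by (intro mult_right_mono) auto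
      finally have 1: "exp (- \<beta> * w) * H \<le> C * h x" .
      have "exp (- \<alpha> * w) * h (x - w) \<le> exp (- \<alpha> * w) * H" using H by (intro mult_left_mono) auto
      also have "\<dots> = exp (- \<beta> * w) * (exp (- \<beta> * w) * H)" unfolding e by (simp only: mult.assoc)
      also have "\<dots> \<le> exp (- \<beta> * w) * (C * h x)" using 1 by (intro mult_left_mono) auto
      finally show ?thesis by (simp add: ac_simps)
    qed
    then show "exp (- \<alpha> * w) * h (x - w) \<le> C * exp (- (\<alpha> / 2) * w) * h x" by (simp add: \<beta>_def)
  qed
qed

lemma nn_integral_exp_halfline_finite:
  assumes "0 < \<beta>"
  obtains L :: real where "0 \<le> L" "(\<integral>\<^sup>+w. ennreal (exp (- \<beta> * w)) * indicator {0..} w \<partial>lborel) = ennreal L"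
proof -
  let ?I = "\<integral>\<^sup>+w. ennreal (exp (- \<beta> * w)) * indicator {0..} w \<partial>lborel"
  have "?I = (\<integral>\<^sup>+w. ennreal (norm (indicator {0<..} w *\<^sub>R exp (- (w * \<beta>)))) \<partial>lborel)"
    using AE_lborel_singleton[of "0::real"]
    by (intro nn_integral_cong_AE, eventually_elim) (auto split: split_indicator simp: mult.commute)
  also have "\<dots> < \<infinity>"
    using integrable_I0i_exp_mscale[OF assms] unfolding set_integrable_def integrable_iff_bounded by blast
  finally show ?thesis using that[of "enn2real ?I"] by simp
qed

text \<open>
  The function \<open>q0\<close> is bounded below on an interval, so one-sided exponentials are dominated by a
  superposition of translates of \<open>q0\<close> with exponentially decaying weights. Convolution with \<open>P\<close>
  preserves the domination, and the damped bound removes the superposition again.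
\<close>
lemma exponential_kernel_dominated:
  fixes P :: "real measure"
  assumes P: "real_distribution P"
    and q0 [measurable]: "q0 \<in> borel_measurable borel" and q0nn: "\<And>y. 0 \<le> q0 y"
    and q0pos: "a < b" "0 < e" "\<And>y. a \<le> y \<Longrightarrow> y \<le> b \<Longrightarrow> e \<le> q0 y"
    and u: "uniformly_long_tailed h" and hm [measurable]: "h \<in> borel_measurable borel"
    and nn: "\<And>x. 0 \<le> h x" and H: "\<And>x. h x \<le> H"
    and dom: "0 \<le> D" "\<And>x. (\<integral>\<^sup>+v. ennreal (q0 (x - v)) \<partial>P) \<le> ennreal (D * h x)" and \<alpha>: "0 < \<alpha>"
  obtains C X where "0 < C"
    "\<And>x. X \<le> x \<Longrightarrow> (\<integral>\<^sup>+v. ennreal (exp (- \<alpha> * (x - v))) * indicator {..x} v \<partial>P) \<le> ennreal (C * h x)"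
proof -
  interpret P: real_distribution P by (fact P)
  interpret PL: pair_sigma_finite P lborel ..
  obtain C0 X0 where C0: "0 < C0"
    "\<And>x w. X0 \<le> x \<Longrightarrow> 0 \<le> w \<Longrightarrow> exp (- \<alpha> * w) * h (x - w) \<le> C0 * exp (- (\<alpha> / 2) * w) * h x"
    using uniformly_long_tailed_damped_bound[OF u nn H \<alpha>] by blast
  obtain L where L: "0 \<le> L" "(\<integral>\<^sup>+w. ennreal (exp (- (\<alpha> / 2) * w)) * indicator {0..} w \<partial>lborel) = ennreal L"
    using nn_integral_exp_halfline_finite[of "\<alpha> / 2"] \<alpha> by (metis half_gt_zero)
  obtain X1 where X1: "\<And>x. X1 \<le> x \<Longrightarrow> 0 < h x"
     "\<And>x v. X1 \<le> x \<Longrightarrow> 0 \<le> v \<Longrightarrow> v \<le> \<bar>b\<bar> \<Longrightarrow> (1 - 1 / 2) * h x \<le> h (x - v)"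
     "\<And>x v. X1 \<le> x \<Longrightarrow> 0 \<le> v \<Longrightarrow> v \<le> \<bar>b\<bar> \<Longrightarrow> h (x - v) \<le> (1 + 1 / 2) * h x"
    using uniformly_long_tailedD[OF u, of "1/2" "\<bar>b\<bar>"] by (metis abs_ge_zero half_gt_zero zero_less_one)
  have hb: "h (x + b) \<le> 2 * h x" if "X1 + \<bar>b\<bar> \<le> x" for x
  proof (cases "0 \<le> b")
    case True
    then show ?thesis using X1(2)[of "x + b" b] that by simp
  next
    case False
    then have "h (x - (- b)) \<le> (1 + 1 / 2) * h x" using that by (intro X1(3)) auto
    then show ?thesis using nn[of x] by simp
  qed
  \<comment> \<open>For \<open>w \<in> {y..y + (b - a)}\<close> the argument \<open>y + b - w\<close> lies in \<open>{a..b}\<close>, where \<open>q0 \<ge> e\<close>.\<close>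
  define C1 where "C1 = exp (\<alpha> * (b - a)) / ((b - a) * e)"
  have C1: "0 < C1" using q0pos by (simp add: C1_def)
  have kernel: "ennreal (exp (- \<alpha> * y)) \<le>
      ennreal C1 * (\<integral>\<^sup>+w. ennreal (exp (- \<alpha> * w) * q0 (y + b - w)) * indicator {0..} w \<partial>lborel)" if y: "0 \<le> y" for y
  proof -
    have "exp (- \<alpha> * y) = exp (\<alpha> * (b - a)) * exp (- \<alpha> * (y + (b - a)))"
      by (subst exp_add[symmetric]) (simp add: algebra_simps)
    also have "\<dots> = C1 * (exp (- \<alpha> * (y + (b - a))) * e * (b - a))"
      using q0pos by (simp add: C1_def)
    also have "ennreal \<dots> = ennreal C1 * (ennreal (exp (- \<alpha> * (y + (b - a))) * e) * ennreal (b - a))"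
      using C1 q0pos by (simp only: ennreal_mult less_imp_le mult_nonneg_nonneg exp_ge_zero diff_ge_0_iff_ge)
    finally have "ennreal (exp (- \<alpha> * y)) = ennreal C1 * (ennreal (exp (- \<alpha> * (y + (b - a))) * e) * ennreal (b - a))" .
    also have "ennreal (exp (- \<alpha> * (y + (b - a))) * e) * ennreal (b - a) =
       (\<integral>\<^sup>+w. ennreal (exp (- \<alpha> * (y + (b - a))) * e) * indicator {y..y + (b - a)} w \<partial>lborel)"
      using q0pos by (simp add: nn_integral_cmult_indicator)
    also have "\<dots> \<le> (\<integral>\<^sup>+w. ennreal (exp (- \<alpha> * w) * q0 (y + b - w)) * indicator {0..} w \<partial>lborel)"
      using y q0pos \<alpha>
      by (intro nn_integral_mono) (auto split: split_indicator intro!: ennreal_leI mult_mono)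
    finally show ?thesis by (simp add: mult_left_mono)
  qed
  define C where "C = C1 * D * (C0 * L) * 2 + 1"
  have C: "0 < C" "C1 * D * (C0 * L) * 2 \<le> C" using C1 dom(1) C0(1) L(1) by (auto simp: C_def intro!: add_nonneg_pos)
  show ?thesis
  proof (rule that[OF C(1)])
    fix x assume x: "max (X1 + \<bar>b\<bar>) (X0 + \<bar>b\<bar>) \<le> x"
    have "(\<integral>\<^sup>+v. ennreal (exp (- \<alpha> * (x - v))) * indicator {..x} v \<partial>P) \<le>
       (\<integral>\<^sup>+v. ennreal C1 * (\<integral>\<^sup>+w. ennreal (exp (- \<alpha> * w) * q0 (x - v + b - w)) * indicator {0..} w \<partial>lborel) \<partial>P)"
      using kernel by (intro nn_integral_mono) (auto split: split_indicator)
    also have "\<dots> = ennreal C1 * (\<integral>\<^sup>+v. (\<integral>\<^sup>+w. ennreal (exp (- \<alpha> * w) * q0 (x - v + b - w)) * indicator {0..} w \<partial>lborel) \<partial>P)"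
      by (rule nn_integral_cmult) measurable
    also have "(\<integral>\<^sup>+v. (\<integral>\<^sup>+w. ennreal (exp (- \<alpha> * w) * q0 (x - v + b - w)) * indicator {0..} w \<partial>lborel) \<partial>P) =
       (\<integral>\<^sup>+w. (\<integral>\<^sup>+v. ennreal (exp (- \<alpha> * w) * q0 (x - v + b - w)) * indicator {0..} w \<partial>P) \<partial>lborel)"
      by (rule PL.Fubini'[symmetric]) measurable
    also have "\<dots> = (\<integral>\<^sup>+w. (ennreal (exp (- \<alpha> * w)) * indicator {0..} w) * (\<integral>\<^sup>+v. ennreal (q0 (x + b - w - v)) \<partial>P) \<partial>lborel)"
    proof (rule nn_integral_cong)
      fix w
      have "(\<integral>\<^sup>+v. ennreal (exp (- \<alpha> * w) * q0 (x - v + b - w)) * indicator {0..} w \<partial>P) =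
         (\<integral>\<^sup>+v. (ennreal (exp (- \<alpha> * w)) * indicator {0..} w) * ennreal (q0 (x + b - w - v)) \<partial>P)"
        using q0nn by (intro nn_integral_cong) (simp add: ennreal_mult algebra_simps)
      also have "\<dots> = (ennreal (exp (- \<alpha> * w)) * indicator {0..} w) * (\<integral>\<^sup>+v. ennreal (q0 (x + b - w - v)) \<partial>P)"
        by (rule nn_integral_cmult) measurable
      finally show "(\<integral>\<^sup>+v. ennreal (exp (- \<alpha> * w) * q0 (x - v + b - w)) * indicator {0..} w \<partial>P) =
        (ennreal (exp (- \<alpha> * w)) * indicator {0..} w) * (\<integral>\<^sup>+v. ennreal (q0 (x + b - w - v)) \<partial>P)" .
    qed
    also have "\<dots> \<le> (\<integral>\<^sup>+w. ennreal (D * C0 * h (x + b)) * (ennreal (exp (- (\<alpha> / 2) * w)) * indicator {0..} w) \<partial>lborel)"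
    proof (rule nn_integral_mono)
      fix w
      show "(ennreal (exp (- \<alpha> * w)) * indicator {0..} w) * (\<integral>\<^sup>+v. ennreal (q0 (x + b - w - v)) \<partial>P) \<le>
        ennreal (D * C0 * h (x + b)) * (ennreal (exp (- (\<alpha> / 2) * w)) * indicator {0..} w)"
      proof (cases "0 \<le> w")
        case True
        have "ennreal (exp (- \<alpha> * w)) * (\<integral>\<^sup>+v. ennreal (q0 (x + b - w - v)) \<partial>P) \<le> ennreal (exp (- \<alpha> * w)) * ennreal (D * h (x + b - w))"
          by (intro mult_left_mono dom) auto
        also have "\<dots> = ennreal (D * (exp (- \<alpha> * w) * h (x + b - w)))"
          using dom(1) nn by (subst ennreal_mult[symmetric]) (auto simp: ac_simps)
        also have "\<dots> \<le> ennreal (D * (C0 * exp (- (\<alpha> / 2) * w) * h (x + b)))"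
          using x True dom(1) by (intro ennreal_leI mult_left_mono C0(2)) auto
        also have "\<dots> = ennreal (D * C0 * h (x + b)) * ennreal (exp (- (\<alpha> / 2) * w))"
          using dom(1) nn C0(1) by (subst ennreal_mult[symmetric]) (auto simp: ac_simps)
        finally show ?thesis using True by simp
      qed simp
    qed
    also have "\<dots> = ennreal (D * C0 * h (x + b)) * ennreal L"
      unfolding L(2)[symmetric] by (rule nn_integral_cmult) measurable
    also have "ennreal C1 * \<dots> = ennreal (C1 * (D * C0 * h (x + b) * L))"
      using C1 dom(1) C0(1) L(1) nn by (simp only: ennreal_mult mult_nonneg_nonneg less_imp_le)
    also have "C1 * (D * C0 * h (x + b) * L) = C1 * D * (C0 * L) * h (x + b)" by simp
    also have "\<dots> \<le> ennreal (C1 * D * (C0 * L) * (2 * h x))"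
      using C1 dom(1) C0(1) L(1) x by (intro ennreal_leI mult_left_mono hb) auto
    also have "\<dots> \<le> ennreal (C * h x)"
      using mult_right_mono[OF C(2) nn[of x]] by (intro ennreal_leI) (simp add: ac_simps)
    finally show "(\<integral>\<^sup>+v. ennreal (exp (- \<alpha> * (x - v))) * indicator {..x} v \<partial>P) \<le> ennreal (C * h x)"
      by (simp add: mult_left_mono)
  qed
qed

section \<open>Deconvolution at infinity\<close>

lemma integral_convolution:
  fixes f :: "real \<Rightarrow> 'b::{banach, second_countable_topology}"
  assumes M: "real_distribution M" and N: "real_distribution N"
    and [measurable]: "f \<in> borel_measurable borel" and B: "\<And>x. norm (f x) \<le> B"
  shows "(\<integral>z. f z \<partial>(M \<star> N)) = (\<integral>y. (\<integral>x. f (x + y) \<partial>M) \<partial>N)"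
proof -
  interpret M: real_distribution M by (fact M)
  interpret N: real_distribution N by (fact N)
  interpret MN: pair_prob_space M N ..
  have int: "integrable (M \<Otimes>\<^sub>M N) (\<lambda>(x, y). f (x + y))"
    using B by (intro MN.integrable_const_bound[where B=B]) auto
  have "(\<integral>z. f z \<partial>(M \<star> N)) = (\<integral>z. f (case z of (x, y) \<Rightarrow> x + y) \<partial>(M \<Otimes>\<^sub>M N))"
    unfolding convolution_def by (rule integral_distr) measurable
  also have "\<dots> = (\<integral>z. (case z of (x, y) \<Rightarrow> f (x + y)) \<partial>(M \<Otimes>\<^sub>M N))"
    by (intro Bochner_Integration.integral_cong) auto
  also have "\<dots> = (\<integral>y. (\<integral>x. f (x + y) \<partial>M) \<partial>N)"
    using MN.integral_snd[OF int] by simp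
  finally show ?thesis .
qed

lemma real_distribution_convolution:
  assumes "real_distribution M" "real_distribution N"
  shows "real_distribution (M \<star> N)"
proof -
  interpret M: real_distribution M by fact
  interpret N: real_distribution N by fact
  interpret MN: pair_prob_space M N ..
  have "prob_space (M \<star> N)"
    unfolding convolution_def by (rule MN.prob_space_distr) measurable
  then show ?thesis by (simp add: real_distribution_def real_distribution_axioms_def)
qed

text \<open>
  The equation \<open>A * g x + (contribution of v \<noteq> 0) \<longlongrightarrow> 0\<close> for \<open>g = \<Psi> - \<kappa>\<close> turns an asymptotic bound \<open>d\<close> on
  \<open>\<bar>g\<bar>\<close> into the bound \<open>d * (1 - A) / A\<close>, up to a small error. Since \<open>A > 1 / 2\<close>, this is a contraction.
\<close>
lemma tendsto_deconvolve_atom: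
  fixes \<Psi> :: "real \<Rightarrow> real"
  assumes Q: "real_distribution Q" and a: "1 / 2 < measure Q {0}"
    and \<Psi> [measurable]: "\<Psi> \<in> borel_measurable borel" and B: "\<And>x. \<bar>\<Psi> x\<bar> \<le> B"
    and lim: "((\<lambda>x. \<integral>v. \<Psi> (x - v) \<partial>Q) \<longlongrightarrow> \<kappa>) at_top"
  shows "(\<Psi> \<longlongrightarrow> \<kappa>) at_top"
proof -
  interpret Q: real_distribution Q by (fact Q)
  have U: "measure Q UNIV = 1" using Q.prob_space by simp
  define A where "A = measure Q {0}"
  have A: "1 / 2 < A" "A \<le> 1" using a by (auto simp: A_def)
  define g where "g x = \<Psi> x - \<kappa>" for x
  have gm [measurable]: "g \<in> borel_measurable borel" unfolding g_def by measurable
  define B' where "B' = B + \<bar>\<kappa>\<bar> + 1"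
  have gB: "\<bar>g x\<bar> \<le> B'" for x using B[of x] by (simp add: g_def B'_def)
  have B'0: "0 < B'" using B[of 0] by (simp add: B'_def)
  have gint: "integrable Q (\<lambda>v. g (x - v))" for x
    using gB by (intro Q.integrable_const_bound[where B=B']) auto
  have ind: "integrable Q (indicat_real S)" if "S \<in> sets borel" for S
    using that by (intro Q.integrable_const_bound[where B=1]) auto
  define I where "I x = (\<integral>v. g (x - v) \<partial>Q)" for x
  have Ieq: "I = (\<lambda>x. (\<integral>v. \<Psi> (x - v) \<partial>Q) - \<kappa>)"
  proof
    fix x
    have "integrable Q (\<lambda>v. \<Psi> (x - v))" using B by (intro Q.integrable_const_bound[where B=B]) auto
    then show "I x = (\<integral>v. \<Psi> (x - v) \<partial>Q) - \<kappa>" unfolding I_def g_def by (simp add: U)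
  qed
  have I: "(I \<longlongrightarrow> 0) at_top" unfolding Ieq using tendsto_diff[OF lim tendsto_const[of \<kappa>]] by simp
  obtain \<theta> where \<theta>: "0 < \<theta>" "\<theta> < 1" "1 - A < A * \<theta>"
  proof -
    have "(1 - A) / A < 1" using A by (simp add: field_simps)
    then obtain d where d: "(1 - A) / A < d" "d < 1" using dense by blast
    have "0 \<le> (1 - A) / A" using A by simp
    then have "0 < d" using d by linarith
    moreover have "1 - A < A * d" using d(1) A by (simp add: field_simps)
    ultimately show ?thesis using that[of d] d by blast
  qed
  have step: "\<forall>\<^sub>F x in at_top. \<bar>g x\<bar> \<le> \<theta> * d"
    if d: "0 < d" and ev: "\<forall>\<^sub>F x in at_top. \<bar>g x\<bar> \<le> d" for d
  proof -
    \<comment> \<open>Half of the gap between the contracted bound and the target \<open>A * (\<theta> * d)\<close>: one half each for the error in the limit and for the part of \<open>Q\<close> beyond \<open>K\<close>.\<close>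
    define \<gamma> where "\<gamma> = (A * \<theta> - (1 - A)) * d / 2"
    have \<gamma>: "0 < \<gamma>" using \<theta> d by (simp add: \<gamma>_def)
    obtain X where X: "\<And>x. X \<le> x \<Longrightarrow> \<bar>g x\<bar> \<le> d" using ev unfolding eventually_at_top_linorder by blast
    have "((\<lambda>K. B' * (1 - cdf Q K)) \<longlongrightarrow> B' * (1 - 1)) at_top"
      by (intro tendsto_intros Q.cdf_lim_at_top_prob)
    then have "\<forall>\<^sub>F K in at_top. B' * (1 - cdf Q K) < \<gamma>" using \<gamma> by (auto dest: order_tendstoD(2))
    then obtain K where K: "B' * (1 - cdf Q K) < \<gamma>" unfolding eventually_at_top_linorder by blast
    have "\<forall>\<^sub>F x in at_top. \<bar>I x\<bar> < \<gamma>" using tendstoD[OF I \<gamma>] by (simp add: dist_real_def)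
    with eventually_ge_at_top[of "X + K"] show ?thesis
    proof eventually_elim
      case (elim x)
      have i1: "integrable Q (\<lambda>v. g x * indicator {0} v)" "integrable Q (\<lambda>v. d * (1 - indicator {0} v) :: real)"
        "integrable Q (\<lambda>v. B' * indicator {K<..} v)"
        using ind by (auto intro!: integrable_mult_right Bochner_Integration.integrable_diff)
      have "g x * A = (\<integral>v. g x * indicator {0} v \<partial>Q)" by (simp add: A_def)
      also have "\<dots> = I x - (\<integral>v. g (x - v) - g x * indicator {0} v \<partial>Q)"
        unfolding I_def by (subst Bochner_Integration.integral_diff[OF gint i1(1)]) simp
      finally have "\<bar>g x * A\<bar> \<le> \<bar>I x\<bar> + \<bar>\<integral>v. g (x - v) - g x * indicator {0} v \<partial>Q\<bar>" by linarith
      also have "\<bar>\<integral>v. g (x - v) - g x * indicator {0} v \<partial>Q\<bar> \<le> (\<integral>v. \<bar>g (x - v) - g x * indicator {0} v\<bar> \<partial>Q)"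
        by (rule integral_abs_bound)
      also have "\<dots> \<le> (\<integral>v. d * (1 - indicator {0} v) + B' * indicator {K<..} v \<partial>Q)"
      proof (rule integral_mono)
        show "integrable Q (\<lambda>v. \<bar>g (x - v) - g x * indicator {0} v\<bar>)" using gint i1 by auto
        show "integrable Q (\<lambda>v. d * (1 - indicator {0} v) + B' * indicator {K<..} v)" using i1 by auto
        fix v
        consider "v = 0" | "v \<noteq> 0" "v \<le> K" | "v \<noteq> 0" "K < v" by linarith
        then show "\<bar>g (x - v) - g x * indicator {0} v\<bar> \<le> d * (1 - indicator {0} v) + B' * indicator {K<..} v"
        proof cases
          case 1 then show ?thesis using B'0 by (simp split: split_indicator)
        next
          case 2 then show ?thesis using X[of "x - v"] elim by simp
        next
          case 3 then show ?thesis using gB[of "x - v"] d by simp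
        qed
      qed
      also have "\<dots> = d * (1 - A) + B' * measure Q {K<..}"
        using i1 ind[of "{0}"] by (simp add: A_def U Bochner_Integration.integral_diff)
      also have "measure Q {K<..} = 1 - cdf Q K"
        unfolding cdf_def using Q.prob_compl[of "{..K}"] by (simp add: Compl_eq_Diff_UNIV[symmetric])
      finally have "\<bar>g x\<bar> * A \<le> \<gamma> + (d * (1 - A) + \<gamma>)" using elim K A by (simp add: abs_mult)
      also have "\<dots> = A * (\<theta> * d)" by (simp add: \<gamma>_def algebra_simps)
      finally have "A * \<bar>g x\<bar> \<le> A * (\<theta> * d)" by (simp add: mult.commute)
      then show ?case using A by (simp only: mult_le_cancel_left_pos) 
    qed
  qed
  have iter: "\<forall>\<^sub>F x in at_top. \<bar>g x\<bar> \<le> \<theta> ^ n * B'" for n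
  proof (induction n)
    case 0 show ?case using gB by simp
  next
    case (Suc n)
    have "0 < \<theta> ^ n * B'" using \<theta> B'0 by simp
    from step[OF this Suc] show ?case by (simp add: mult.assoc)
  qed
  have "(g \<longlongrightarrow> 0) at_top"
  proof (rule tendstoI)
    fix e :: real assume e: "0 < e"
    have "(\<lambda>n. \<theta> ^ n * B') \<longlonglongrightarrow> 0 * B'" using \<theta> by (intro tendsto_intros LIMSEQ_power_zero) auto
    then have "\<forall>\<^sub>F n in sequentially. \<theta> ^ n * B' < e" using e by (auto dest: order_tendstoD(2))
    then obtain n where n: "\<theta> ^ n * B' < e" unfolding eventually_sequentially by blast
    show "\<forall>\<^sub>F x in at_top. dist (g x) 0 < e" using iter[of n] by eventually_elim (use n in \<open>auto simp: dist_real_def\<close>)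
  qed
  then have "((\<lambda>x. g x + \<kappa>) \<longlongrightarrow> 0 + \<kappa>) at_top" by (intro tendsto_intros)
  then show ?thesis by (simp add: g_def)
qed

lemma bounded_convolution:
  fixes \<Psi> :: "real \<Rightarrow> real"
  assumes Q: "real_distribution Q" and [measurable]: "\<Psi> \<in> borel_measurable borel" and B: "\<And>x. \<bar>\<Psi> x\<bar> \<le> B"
  shows "(\<lambda>x. \<integral>v. \<Psi> (x - v) \<partial>Q) \<in> borel_measurable borel" "\<bar>\<integral>v. \<Psi> (x - v) \<partial>Q\<bar> \<le> B"
proof -
  interpret Q: real_distribution Q by (fact Q)
  have U: "measure Q UNIV = 1" using Q.prob_space by simp
  show "(\<lambda>x. \<integral>v. \<Psi> (x - v) \<partial>Q) \<in> borel_measurable borel" by measurable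
  have "\<bar>\<integral>v. \<Psi> (x - v) \<partial>Q\<bar> \<le> (\<integral>v. \<bar>\<Psi> (x - v)\<bar> \<partial>Q)" by (rule integral_abs_bound)
  also have "\<dots> \<le> (\<integral>v. B \<partial>Q)"
    using B order_trans[OF abs_ge_zero B[of 0]] by (intro integral_mono Q.integrable_const_bound[where B=B]) auto
  finally show "\<bar>\<integral>v. \<Psi> (x - v) \<partial>Q\<bar> \<le> B" by (simp add: U)
qed

lemma iterated_convolution:
  fixes \<Psi> :: "real \<Rightarrow> real"
  assumes M: "real_distribution M" and N: "real_distribution N"
    and [measurable]: "\<Psi> \<in> borel_measurable borel" and B: "\<And>x. \<bar>\<Psi> x\<bar> \<le> B"
  shows "(\<integral>w. (\<integral>v. \<Psi> (x - w - v) \<partial>M) \<partial>N) = (\<integral>z. \<Psi> (x - z) \<partial>(M \<star> N))"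
proof -
  have "(\<integral>z. \<Psi> (x - z) \<partial>(M \<star> N)) = (\<integral>y. (\<integral>z. \<Psi> (x - (z + y)) \<partial>M) \<partial>N)"
    using B by (intro integral_convolution[OF M N, where B=B]) auto
  then show ?thesis by (simp add: algebra_simps)
qed

text \<open>
  Over a sufficiently short time \<open>t / 2 ^ k\<close> the atom at \<open>0\<close> has mass above \<open>1 / 2\<close>; \<open>P t\<close> is a convolution
  power of \<open>P (t / 2 ^ k)\<close> and can be removed factor by factor.
\<close>
lemma tendsto_deconvolve_semigroup:
  fixes \<Psi> :: "real \<Rightarrow> real"
  assumes P: "\<And>t. 0 < t \<Longrightarrow> real_distribution (P t)"
    and sg: "\<And>t. 0 < t \<Longrightarrow> P (2 * t) = (P t \<star> P t)"
    and atom: "\<And>t. 0 < t \<Longrightarrow> exp (- c * t) \<le> measure (P t) {0}"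
    and "\<Psi> \<in> borel_measurable borel" "\<And>x. \<bar>\<Psi> x\<bar> \<le> B"
    and "((\<lambda>x. \<integral>v. \<Psi> (x - v) \<partial>P t) \<longlongrightarrow> \<kappa>) at_top" "0 < t"
  shows "(\<Psi> \<longlongrightarrow> \<kappa>) at_top"
proof -
  have main: "(\<Psi> \<longlongrightarrow> \<kappa>) at_top"
    if "1 / 2 < exp (- c * (t / 2 ^ k))" "\<Psi> \<in> borel_measurable borel" "\<And>x. \<bar>\<Psi> x\<bar> \<le> B"
       "((\<lambda>x. \<integral>v. \<Psi> (x - v) \<partial>P t) \<longlongrightarrow> \<kappa>) at_top" "0 < t" for k \<Psi> t
    using that
  proof (induction k arbitrary: \<Psi> t)
    case 0
    then show ?case
      using atom[of t] by (intro tendsto_deconvolve_atom[OF P, of t \<Psi> B]) auto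
  next
    case (Suc k)
    let ?\<Psi> = "\<lambda>x. \<integral>v. \<Psi> (x - v) \<partial>P (t / 2)"
    have t2: "0 < t / 2" using Suc.prems by simp
    note b = bounded_convolution[OF P[OF t2] Suc.prems(2,3)]
    have small: "1 / 2 < exp (- c * (t / 2 / 2 ^ k))" using Suc.prems(1) by (simp add: field_simps)
    have "(\<integral>w. ?\<Psi> (x - w) \<partial>P (t / 2)) = (\<integral>v. \<Psi> (x - v) \<partial>P t)" for x
      using iterated_convolution[OF P[OF t2] P[OF t2] Suc.prems(2,3)] sg[OF t2] by simp
    then have "((\<lambda>x. \<integral>w. ?\<Psi> (x - w) \<partial>P (t / 2)) \<longlongrightarrow> \<kappa>) at_top" using Suc.prems(4) by simp
    from Suc.IH[OF small b this t2] have "(?\<Psi> \<longlongrightarrow> \<kappa>) at_top" .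
    from Suc.IH[OF small Suc.prems(2,3) this t2] show ?case .
  qed
  have "(\<lambda>k. - c * (t * (1 / 2) ^ k)) \<longlonglongrightarrow> - c * (t * 0)"
    by (intro tendsto_intros LIMSEQ_power_zero) auto
  then have "(\<lambda>k. exp (- c * (t / 2 ^ k))) \<longlonglongrightarrow> exp 0"
    by (intro tendsto_exp) (simp add: power_one_over)
  then have "\<forall>\<^sub>F k in sequentially. 1 / 2 < exp (- c * (t / 2 ^ k))"
    by (rule order_tendstoD(1)) simp
  then obtain k where "1 / 2 < exp (- c * (t / 2 ^ k))" unfolding eventually_sequentially by blast
  then show ?thesis using assms(4-) by (rule main)
qed

lemma tendsto_remove_approximate_identity:
  fixes \<Phi> :: "real \<Rightarrow> real"
  assumes \<Phi> [measurable]: "\<Phi> \<in> borel_measurable borel" and B: "\<And>x. \<bar>\<Phi> x\<bar> \<le> B"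
    and osc: "\<And>\<eta>. 0 < \<eta> \<Longrightarrow> \<exists>\<delta>>0. \<exists>X. \<forall>x\<ge>X. \<forall>u\<in>{0..\<delta>}. \<bar>\<Phi> x - \<Phi> (x - u)\<bar> \<le> \<eta>"
    and M: "\<And>\<delta> \<eta>. 0 < \<delta> \<Longrightarrow> 0 < \<eta> \<Longrightarrow> \<exists>M. real_distribution M \<and> measure M {..<0} = 0 \<and> measure M {\<delta><..} \<le> \<eta> \<and>
        ((\<lambda>x. \<integral>v. \<Phi> (x - v) \<partial>M) \<longlongrightarrow> \<kappa>) at_top"
  shows "(\<Phi> \<longlongrightarrow> \<kappa>) at_top"
proof (rule tendstoI)
  fix e :: real assume e: "0 < e"
  have B0: "0 \<le> B" using B[of 0] by simp
  obtain \<delta> X where \<delta>: "0 < \<delta>" and X: "\<And>x u. X \<le> x \<Longrightarrow> 0 \<le> u \<Longrightarrow> u \<le> \<delta> \<Longrightarrow> \<bar>\<Phi> x - \<Phi> (x - u)\<bar> \<le> e / 3"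
    using osc[of "e / 3"] e by force
  define \<eta> where "\<eta> = e / (6 * (B + 1))"
  have \<eta>: "0 < \<eta>" "2 * B * \<eta> < e / 3"
    using e B0 by (auto simp: \<eta>_def field_simps)
  obtain M where M': "real_distribution M" "measure M {..<0} = 0" "measure M {\<delta><..} \<le> \<eta>"
     "((\<lambda>x. \<integral>v. \<Phi> (x - v) \<partial>M) \<longlongrightarrow> \<kappa>) at_top"
    using M[OF \<delta> \<eta>(1)] by blast
  interpret M: real_distribution M by (fact M'(1))
  have U: "measure M UNIV = 1" using M.prob_space by simp
  have int: "integrable M (\<lambda>v. \<Phi> (x - v))" for x using B by (intro M.integrable_const_bound[where B=B]) auto
  have ind: "integrable M (indicat_real {\<delta><..})"
    by (intro M.integrable_const_bound[where B=1]) auto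
  have AEnn: "AE v in M. 0 \<le> v"
    using M'(2) M.prob_eq_0[of "{..<0}"] by (auto simp: not_less)
  have "\<forall>\<^sub>F x in at_top. dist (\<integral>v. \<Phi> (x - v) \<partial>M) \<kappa> < e / 3" using M'(4) e by (intro tendstoD) auto
  with eventually_ge_at_top[of X] show "\<forall>\<^sub>F x in at_top. dist (\<Phi> x) \<kappa> < e"
  proof eventually_elim
    case (elim x)
    have "\<bar>\<Phi> x - (\<integral>v. \<Phi> (x - v) \<partial>M)\<bar> = \<bar>\<integral>v. \<Phi> x - \<Phi> (x - v) \<partial>M\<bar>"
      using int by (simp add: U)
    also have "\<dots> \<le> (\<integral>v. \<bar>\<Phi> x - \<Phi> (x - v)\<bar> \<partial>M)" by (rule integral_abs_bound)
    also have "\<dots> \<le> (\<integral>v. e / 3 + 2 * B * indicator {\<delta><..} v \<partial>M)"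
    proof (rule integral_mono_AE)
      show "AE v in M. \<bar>\<Phi> x - \<Phi> (x - v)\<bar> \<le> e / 3 + 2 * B * indicator {\<delta><..} v"
        using AEnn
      proof eventually_elim
        case (elim v)
        then show ?case
          using X[OF \<open>X \<le> x\<close>, of v] B[of x] B[of "x - v"] e by (cases "v \<le> \<delta>") auto
      qed
    qed (use int ind in \<open>auto intro!: integrable_mult_right\<close>)
    also have "\<dots> = e / 3 + 2 * B * measure M {\<delta><..}" using ind by (simp add: U)
    also have "\<dots> \<le> e / 3 + 2 * B * \<eta>" using M'(3) B0 by (intro add_left_mono mult_left_mono) auto
    finally have "\<bar>\<Phi> x - (\<integral>v. \<Phi> (x - v) \<partial>M)\<bar> \<le> e / 3 + 2 * B * \<eta>" .
    moreover have "\<bar>(\<integral>v. \<Phi> (x - v) \<partial>M) - \<kappa>\<bar> < e / 3" using elim by (simp only: dist_real_def)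
    moreover have "e / 3 + e / 3 + e / 3 = e" by simp
    ultimately show ?case using \<eta>(2) unfolding dist_real_def by linarith
  qed
qed

section \<open>Splitting off the large jumps\<close>

text \<open>
  Here \<open>P \<epsilon> t\<close> is the contribution up to time \<open>t\<close> of the jumps larger than \<open>\<epsilon>\<close>: a compound Poisson
  distribution, of which only the semigroup property and the atom at \<open>0\<close> (no jump at all, with \<open>rate \<epsilon>\<close>
  the intensity of these jumps) are recorded. The measure \<open>M \<epsilon> t\<close> is the contribution of the remaining
  small jumps. For \<open>\<epsilon> = 1\<close> it has the continuous density \<open>q t\<close>, which decays exponentially since its jumps
  are bounded.
\<close>
locale id_density_semigroup = density_semigroup p for p +
  fixes P M :: "real \<Rightarrow> real \<Rightarrow> real measure" and rate :: "real \<Rightarrow> real" and q :: "real \<Rightarrow> real \<Rightarrow> real"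
  assumes bounded: "0 < t \<Longrightarrow> \<exists>B. \<forall>x. p t x \<le> B"
    and P_dist: "0 < \<epsilon> \<Longrightarrow> 0 < t \<Longrightarrow> real_distribution (P \<epsilon> t)"
    and P_add: "0 < \<epsilon> \<Longrightarrow> 0 < s \<Longrightarrow> 0 < t \<Longrightarrow> P \<epsilon> (s + t) = (P \<epsilon> s \<star> P \<epsilon> t)"
    and P_atom: "0 < \<epsilon> \<Longrightarrow> 0 < t \<Longrightarrow> exp (- rate \<epsilon> * t) \<le> measure (P \<epsilon> t) {0}"
    and M_dist: "0 < \<epsilon> \<Longrightarrow> 0 < t \<Longrightarrow> real_distribution (M \<epsilon> t)"
    and M_nonneg: "0 < \<epsilon> \<Longrightarrow> 0 < t \<Longrightarrow> measure (M \<epsilon> t) {..<0} = 0"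
    and M_small: "0 < \<delta> \<Longrightarrow> 0 < \<eta> \<Longrightarrow> 0 < t \<Longrightarrow> \<exists>\<epsilon>>0. measure (M \<epsilon> t) {\<delta><..} \<le> \<eta>"
    and factor: "0 < \<epsilon> \<Longrightarrow> 0 < t \<Longrightarrow> density lborel (\<lambda>x. ennreal (p t x)) = (M \<epsilon> t \<star> P \<epsilon> t)"
    and q_cont: "0 < t \<Longrightarrow> uniformly_continuous_on UNIV (q t)"
    and q_nonneg: "0 < t \<Longrightarrow> 0 \<le> q t x"
    and q_neg: "0 < t \<Longrightarrow> x < 0 \<Longrightarrow> q t x = 0"
    and q_light: "0 < t \<Longrightarrow> \<exists>C. \<forall>x. q t x \<le> C * exp (- x)"
    and q_conv: "0 < t \<Longrightarrow> p t x = (\<integral>v. q t (x - v) \<partial>P 1 t)"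
begin

lemma q_measurable: "0 < t \<Longrightarrow> q t \<in> borel_measurable borel"
  by (intro borel_measurable_continuous_onI uniformly_continuous_imp_continuous q_cont)

lemma q_light':
  assumes "0 < t"
  obtains C where "0 < C" "\<And>x. q t x \<le> C * exp (- x)" "\<And>x. q t x \<le> C"
proof -
  obtain C where C: "\<And>x. q t x \<le> C * exp (- x)" using q_light[OF assms] by blast
  have le: "q t x \<le> (\<bar>C\<bar> + 1) * exp (- x)" for x
    using C[of x] by (rule order_trans) (intro mult_right_mono, auto)
  have "q t x \<le> \<bar>C\<bar> + 1" for x
  proof (cases "x < 0")
    case False
    then have "(\<bar>C\<bar> + 1) * exp (- x) \<le> (\<bar>C\<bar> + 1) * 1" by (intro mult_left_mono) auto
    then show ?thesis using le[of x] by simp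
  qed (simp add: q_neg assms)
  then show ?thesis using that[of "\<bar>C\<bar> + 1"] le by simp
qed

lemma q_integrable: "0 < t \<Longrightarrow> real_distribution N \<Longrightarrow> integrable N (\<lambda>v. q t (x - v))"
proof -
  assume t: "0 < t" and N: "real_distribution N"
  interpret N: real_distribution N by (fact N)
  note q_measurable[OF t, measurable]
  obtain C where "\<And>x. q t x \<le> C" using q_light'[OF t] by metis
  then show ?thesis using q_nonneg[OF t] by (intro N.integrable_const_bound[where B=C]) auto
qed

text \<open>
  On the event that no large jump occurs between the times \<open>s\<close> and \<open>s + r\<close>, the large jumps up to
  time \<open>s + r\<close> are those up to time \<open>s\<close>.
\<close>
lemma p_dominates_kernel_conv:
  assumes sr: "0 < s" "0 < r"
  shows "(\<integral>\<^sup>+v. ennreal (q (s + r) (x - v)) \<partial>P 1 s) \<le> ennreal (exp (rate 1 * r) * p (s + r) x)"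
proof -
  let ?T = "s + r"
  have T: "0 < ?T" using sr by simp
  note q_measurable[OF T, measurable]
  obtain C where C: "0 < C" "\<And>x. q ?T x \<le> C" using q_light'[OF T] by metis
  have qB: "\<bar>q ?T x\<bar> \<le> C" for x using C q_nonneg[OF T, of x] by simp
  interpret R: real_distribution "P 1 r" using P_dist sr by simp
  define G where "G y = (\<integral>v. q ?T (y - v) \<partial>P 1 s)" for y
  have Gnn: "0 \<le> G y" for y unfolding G_def using q_nonneg[OF T] by (intro integral_nonneg_AE) auto
  note Gb = bounded_convolution[OF P_dist[OF zero_less_one sr(1)] q_measurable[OF T] qB, folded G_def]
  note Gb(1)[measurable]
  have "p ?T x = (\<integral>w. G (x - w) \<partial>P 1 r)"
    unfolding G_def q_conv[OF T] P_add[OF zero_less_one sr]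
    using iterated_convolution[OF P_dist[OF zero_less_one sr(1)] P_dist[OF zero_less_one sr(2)] q_measurable[OF T] qB]
    by simp
  moreover have "(\<integral>w. G x * indicator {0} w \<partial>P 1 r) \<le> (\<integral>w. G (x - w) \<partial>P 1 r)"
  proof (rule integral_mono)
    show "integrable (P 1 r) (\<lambda>w. G x * indicator {0} w)"
      using Gb(2) by (intro R.integrable_const_bound[where B=C]) (auto split: split_indicator simp: order_trans[OF abs_ge_zero Gb(2)])
    show "integrable (P 1 r) (\<lambda>w. G (x - w))"
      using Gb(2) by (intro R.integrable_const_bound[where B=C]) auto
  qed (use Gnn in \<open>auto split: split_indicator\<close>)
  ultimately have "G x * measure (P 1 r) {0} \<le> p ?T x" by simp
  moreover have "G x * exp (- rate 1 * r) \<le> G x * measure (P 1 r) {0}"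
    using P_atom sr Gnn by (intro mult_left_mono) auto
  ultimately have "G x * exp (- rate 1 * r) \<le> p ?T x" by linarith
  then have le: "G x * exp (- rate 1 * r) * exp (rate 1 * r) \<le> p ?T x * exp (rate 1 * r)"
    by (intro mult_right_mono) auto
  have "exp (- rate 1 * r) * exp (rate 1 * r) = 1" by (subst exp_add[symmetric]) simp
  then have "G x = G x * exp (- rate 1 * r) * exp (rate 1 * r)" by (simp only: mult.assoc mult_1_right)
  also note le
  also have "p ?T x * exp (rate 1 * r) = exp (rate 1 * r) * p ?T x" by (rule mult.commute)
  finally have "G x \<le> exp (rate 1 * r) * p ?T x" .
  moreover have "(\<integral>\<^sup>+v. ennreal (q ?T (x - v)) \<partial>P 1 s) = ennreal (G x)"
    unfolding G_def using q_integrable[OF T P_dist[OF zero_less_one sr(1)]] q_nonneg[OF T]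
    by (intro nn_integral_eq_integral) auto
  ultimately show ?thesis by (simp add: ennreal_leI)
qed

lemma q_positive_interval:
  assumes t: "0 < t"
  obtains a b e where "a < b" "0 < e" "\<And>y. a \<le> y \<Longrightarrow> y \<le> b \<Longrightarrow> e \<le> q t y"
proof -
  have "\<exists>y. q t y \<noteq> 0"
  proof (rule ccontr)
    assume "\<not> ?thesis"
    then have "p t x = 0" for x unfolding q_conv[OF t] by simp
    then show False using p_integral[OF t] by simp
  qed
  then obtain y where y: "0 < q t y" using q_nonneg[OF t] by (metis less_eq_real_def)
  have "isCont (q t) y"
    using uniformly_continuous_imp_continuous[OF q_cont[OF t]] by (simp add: continuous_on_eq_continuous_at)
  then have "\<forall>\<^sub>F z in at y. q t y / 2 < q t z" using y by (intro order_tendstoD(1)[of _ "q t y"]) (auto simp: isCont_def)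
  then obtain d where d: "0 < d" "\<And>z. z \<noteq> y \<Longrightarrow> dist z y < d \<Longrightarrow> q t y / 2 < q t z"
    unfolding eventually_at by auto
  show ?thesis
  proof (rule that[of y "y + d / 2" "q t y / 2"])
    fix z assume "y \<le> z" "z \<le> y + d / 2"
    then show "q t y / 2 \<le> q t z" using d y by (cases "z = y") (auto simp: dist_real_def intro!: less_imp_le)
  qed (use d y in auto)
qed

lemma exponential_conv_dominated:
  assumes sr: "0 < s" "0 < r" and u: "uniformly_long_tailed (p (s + r))" and \<alpha>: "0 < \<alpha>"
  obtains C X where "0 < C"
    "\<And>x. X \<le> x \<Longrightarrow> (\<integral>\<^sup>+v. ennreal (exp (- \<alpha> * (x - v))) * indicator {..x} v \<partial>P 1 s) \<le> ennreal (C * p (s + r) x)"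
proof -
  have T: "0 < s + r" using sr by simp
  obtain a b e where abe: "a < b" "0 < e" "\<And>y. a \<le> y \<Longrightarrow> y \<le> b \<Longrightarrow> e \<le> q (s + r) y"
    using q_positive_interval[OF T] by blast
  obtain B where B: "\<And>x. p (s + r) x \<le> B" using bounded[OF T] by blast
  show ?thesis
    by (rule exponential_kernel_dominated[OF P_dist[OF zero_less_one sr(1)] q_measurable[OF T] q_nonneg[OF T] abe u
        p_measurable[OF T] p_nonneg[OF T] B exp_ge_zero p_dominates_kernel_conv[OF sr] \<alpha>])
       (assumption | rule that)+
qed

text \<open>
  The density \<open>p s\<close> is \<open>q s\<close> convolved with \<open>P 1 s\<close>, and \<open>q s\<close> is dominated by an exponential.
\<close>
lemma earlier_density_le:
  assumes sr: "0 < s" "0 < r" and u: "uniformly_long_tailed (p (s + r))"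
  obtains C X where "0 < C" "\<And>x. X \<le> x \<Longrightarrow> p s x \<le> C * p (s + r) x"
proof -
  obtain C1 X where C1: "0 < C1" and X: "\<And>x. X \<le> x \<Longrightarrow>
      (\<integral>\<^sup>+v. ennreal (exp (- 1 * (x - v))) * indicator {..x} v \<partial>P 1 s) \<le> ennreal (C1 * p (s + r) x)"
    using exponential_conv_dominated[OF sr u zero_less_one] by blast
  obtain C where C: "0 < C" "\<And>x. q s x \<le> C * exp (- x)" using q_light'[OF sr(1)] by metis
  note q_measurable[OF sr(1), measurable]
  interpret R: real_distribution "P 1 s" using P_dist sr by simp
  show ?thesis
  proof (rule that[of "C * C1" X])
    show "0 < C * C1" using C C1 by simp
    fix x assume x: "X \<le> x"
    have "ennreal (p s x) = (\<integral>\<^sup>+v. ennreal (q s (x - v)) \<partial>P 1 s)"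
      unfolding q_conv[OF sr(1)] using q_integrable[OF sr(1) P_dist[OF zero_less_one sr(1)]] q_nonneg[OF sr(1)]
      by (intro nn_integral_eq_integral[symmetric]) auto
    also have "\<dots> \<le> (\<integral>\<^sup>+v. ennreal C * (ennreal (exp (- 1 * (x - v))) * indicator {..x} v) \<partial>P 1 s)"
    proof (rule nn_integral_mono)
      fix v
      show "ennreal (q s (x - v)) \<le> ennreal C * (ennreal (exp (- 1 * (x - v))) * indicator {..x} v)"
        using C(1) C(2)[of "x - v"] q_neg[OF sr(1), of "x - v"] by (cases "x < v") (auto simp: ennreal_mult[symmetric] intro!: ennreal_leI)
    qed
    also have "\<dots> = ennreal C * (\<integral>\<^sup>+v. ennreal (exp (- 1 * (x - v))) * indicator {..x} v \<partial>P 1 s)"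
      by (rule nn_integral_cmult) measurable
    also have "\<dots> \<le> ennreal C * ennreal (C1 * p (s + r) x)" by (intro mult_left_mono X x) auto
    also have "\<dots> = ennreal (C * C1 * p (s + r) x)"
      using C C1 p_nonneg sr by (subst ennreal_mult[symmetric]) (auto simp: mult.assoc)
    finally show "p s x \<le> C * C1 * p (s + r) x"
      using C C1 p_nonneg[of "s + r" x] sr by (simp add: ennreal_le_iff)
  qed
qed

text \<open>
  The increments of \<open>q s\<close> are bounded by a small constant \<open>\<omega>\<close> (uniform continuity) and by an exponential
  (light tail), hence by the geometric mean of the two: a small multiple of a slower
  exponential, to which the domination applies.
\<close>
lemma earlier_density_equicontinuous:
  assumes sr: "0 < s" "0 < r" and u: "uniformly_long_tailed (p (s + r))" and \<eta>: "0 < \<eta>"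
  obtains \<delta> X where "0 < \<delta>"
    "\<And>x v. X \<le> x \<Longrightarrow> 0 \<le> v \<Longrightarrow> v \<le> \<delta> \<Longrightarrow> \<bar>p s x - p s (x - v)\<bar> \<le> \<eta> * p (s + r) x"
proof -
  obtain C1 X where C1: "0 < C1" and X: "\<And>x. X \<le> x \<Longrightarrow>
      (\<integral>\<^sup>+v. ennreal (exp (- (1 / 2) * (x - v))) * indicator {..x} v \<partial>P 1 s) \<le> ennreal (C1 * p (s + r) x)"
    using exponential_conv_dominated[OF sr u, of "1/2"] by (metis half_gt_zero zero_less_one)
  obtain C where C: "0 < C" "\<And>x. q s x \<le> C * exp (- x)" using q_light'[OF sr(1)] by metis
  note q_measurable[OF sr(1), measurable]
  interpret R: real_distribution "P 1 s" using P_dist sr by simp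
  define D where "D = C * exp 1"
  have D: "0 < D" using C by (simp add: D_def)
  \<comment> \<open>Chosen so that the geometric mean of \<open>\<omega>\<close> and \<open>D * exp (- y)\<close> is \<open>\<eta> / C1 * exp (- y / 2)\<close>.\<close>
  define \<omega> where "\<omega> = (\<eta> / C1)\<^sup>2 / D"
  have \<omega>: "0 < \<omega>" using D C1 \<eta> by (simp add: \<omega>_def)
  have sq: "sqrt (\<omega> * D) = \<eta> / C1" using D C1 \<eta> by (simp add: \<omega>_def)
  obtain d where d: "0 < d" "\<And>x y. dist x y < d \<Longrightarrow> dist (q s x) (q s y) < \<omega>"
    using q_cont[OF sr(1)] \<omega> unfolding uniformly_continuous_on_def by (metis UNIV_I dist_commute)
  define \<delta> where "\<delta> = min 1 (d / 2)"
  have \<delta>: "0 < \<delta>" "\<delta> \<le> 1" "\<delta> < d" using d by (auto simp: \<delta>_def)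
  have diff: "\<bar>q s y - q s (y - v)\<bar> \<le> \<eta> / C1 * exp (- (1 / 2) * y) * indicator {0..} y" if v: "0 \<le> v" "v \<le> \<delta>" for y v
  proof (cases "y < 0")
    case True
    then show ?thesis using q_neg[OF sr(1)] v by simp
  next
    case False
    have 1: "\<bar>q s y - q s (y - v)\<bar> \<le> \<omega>"
      using d(2)[of y "y - v"] v \<delta> by (simp add: dist_real_def)
    have "q s y \<le> D * exp (- y)"
    proof -
      have "C * exp (- y) \<le> C * exp 1 * exp (- y)" using C by (intro mult_right_mono) auto
      then show ?thesis using C(2)[of y] by (simp add: D_def)
    qed
    moreover have "q s (y - v) \<le> D * exp (- y)"
    proof -
      have "exp (- (y - v)) \<le> exp (1 - y)" using v \<delta> by simp
      also have "\<dots> = exp 1 * exp (- y)" by (simp add: exp_add[symmetric])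
      finally have "C * exp (- (y - v)) \<le> C * (exp 1 * exp (- y))" using C by (intro mult_left_mono) auto
      then show ?thesis using C(2)[of "y - v"] by (simp add: D_def)
    qed
    ultimately have 2: "\<bar>q s y - q s (y - v)\<bar> \<le> D * exp (- y)"
      using q_nonneg[OF sr(1), of y] q_nonneg[OF sr(1), of "y - v"] by (auto simp: abs_le_iff)
    have "\<bar>q s y - q s (y - v)\<bar>\<^sup>2 \<le> \<omega> * (D * exp (- y))"
      unfolding power2_eq_square using 1 2 \<omega> by (intro mult_mono) auto
    then have "\<bar>q s y - q s (y - v)\<bar> \<le> sqrt (\<omega> * (D * exp (- y)))" by (rule real_le_rsqrt)
    also have "\<dots> = sqrt (\<omega> * D) * sqrt (exp (- y))" by (simp add: real_sqrt_mult)
    also have "sqrt (exp (- y)) = exp (- (1 / 2) * y)"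
      by (rule real_sqrt_unique) (auto simp: power2_eq_square exp_add[symmetric])
    finally show ?thesis using False by (simp add: sq)
  qed
  show ?thesis
  proof (rule that[OF \<delta>(1)])
    fix x v assume x: "X \<le> x" and v: "0 \<le> v" "v \<le> \<delta>"
    have int: "integrable (P 1 s) (\<lambda>w. q s (x - w))" for x
      by (rule q_integrable[OF sr(1) P_dist[OF zero_less_one sr(1)]])
    have int2: "integrable (P 1 s) (\<lambda>w. q s (x - w) - q s (x - w - v))"
      using Bochner_Integration.integrable_diff[OF int[of x] int[of "x - v"]] by (simp add: algebra_simps)
    have "p s x - p s (x - v) = (\<integral>w. q s (x - w) - q s (x - w - v) \<partial>P 1 s)"
      unfolding q_conv[OF sr(1)] using int[of x] int[of "x - v"]
      by (subst Bochner_Integration.integral_diff[symmetric]) (auto simp: algebra_simps)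
    then have "ennreal \<bar>p s x - p s (x - v)\<bar> \<le> (\<integral>\<^sup>+w. ennreal \<bar>q s (x - w) - q s (x - w - v)\<bar> \<partial>P 1 s)"
      using integral_norm_bound_ennreal[OF int2] by simp
    also have "\<dots> \<le> (\<integral>\<^sup>+w. ennreal (\<eta> / C1) * (ennreal (exp (- (1 / 2) * (x - w))) * indicator {..x} w) \<partial>P 1 s)"
    proof (rule nn_integral_mono)
      fix w
      have "ennreal \<bar>q s (x - w) - q s (x - w - v)\<bar> \<le> ennreal (\<eta> / C1 * exp (- (1 / 2) * (x - w)) * indicator {0..} (x - w))"
        using v by (intro ennreal_leI diff)
      also have "\<dots> = ennreal (\<eta> / C1) * (ennreal (exp (- (1 / 2) * (x - w))) * indicator {..x} w)"
        using \<eta> C1 by (auto split: split_indicator simp: ennreal_mult[symmetric])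
      finally show "ennreal \<bar>q s (x - w) - q s (x - w - v)\<bar> \<le> ennreal (\<eta> / C1) * (ennreal (exp (- (1 / 2) * (x - w))) * indicator {..x} w)" .
    qed
    also have "\<dots> = ennreal (\<eta> / C1) * (\<integral>\<^sup>+w. ennreal (exp (- (1 / 2) * (x - w))) * indicator {..x} w \<partial>P 1 s)"
      by (rule nn_integral_cmult) measurable
    also have "\<dots> \<le> ennreal (\<eta> / C1) * ennreal (C1 * p (s + r) x)" by (intro mult_left_mono X x) auto
    also have "\<dots> = ennreal (\<eta> * p (s + r) x)"
      using \<eta> C1 p_nonneg[of "s + r" x] sr by (subst ennreal_mult[symmetric]) auto
    finally show "\<bar>p s x - p s (x - v)\<bar> \<le> \<eta> * p (s + r) x"
      using \<eta> p_nonneg[of "s + r" x] sr by (simp add: ennreal_le_iff)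
  qed
qed

end

context id_density_semigroup
begin

section \<open>From a subexponential density to all times\<close>

text \<open>
  Both densities are eventually dominated by \<open>p (s + r)\<close>, whose middle part is negligible.
\<close>
lemma earlier_middle_negligible:
  assumes sr: "0 < s" "0 < r" and u: "uniformly_long_tailed (p (s + r))"
    and nm: "negligible_middle (p (s + r))" and \<delta>: "0 < \<delta>"
  obtains K0 where "0 \<le> K0"
    "\<And>K. K0 \<le> K \<Longrightarrow> \<forall>\<^sub>F x in at_top. conv_part (p s) (p r) {K<..<x - K} x \<le> ennreal (\<delta> * p (s + r) x)"
proof -
  let ?T = "s + r"
  have [measurable]: "p s \<in> borel_measurable borel" "p r \<in> borel_measurable borel" "p ?T \<in> borel_measurable borel"
    using p_measurable sr by auto
  obtain C1 X1 where C1: "0 < C1" "\<And>x. X1 \<le> x \<Longrightarrow> p s x \<le> C1 * p ?T x"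
    using earlier_density_le[OF sr u] by blast
  have "uniformly_long_tailed (p (r + s))" using u by (simp add: add.commute)
  then obtain C2 X2 where C2: "0 < C2" "\<And>x. X2 \<le> x \<Longrightarrow> p r x \<le> C2 * p (r + s) x"
    using earlier_density_le[OF sr(2,1)] by blast
  obtain K1 X where K1: "0 \<le> K1" and X: "\<And>x. X \<le> x \<Longrightarrow> conv_part (p ?T) (p ?T) {K1<..<x - K1} x \<le> ennreal (\<delta> / (C1 * C2) * p ?T x)"
    using nm[unfolded negligible_middle_def, rule_format, of "\<delta> / (C1 * C2)"] \<delta> C1 C2 by auto
  show ?thesis
  proof (rule that[of "max K1 (max X1 X2)"])
    show "0 \<le> max K1 (max X1 X2)" using K1 by simp
    fix K assume K: "max K1 (max X1 X2) \<le> K"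
    show "\<forall>\<^sub>F x in at_top. conv_part (p s) (p r) {K<..<x - K} x \<le> ennreal (\<delta> * p ?T x)"
      using eventually_ge_at_top[of X]
    proof eventually_elim
      case (elim x)
      have "conv_part (p s) (p r) {K<..<x - K} x \<le>
        (\<integral>\<^sup>+v. ennreal (C1 * C2) * (ennreal (p ?T (x - v) * p ?T v) * indicator {K1<..<x - K1} v) \<partial>lborel)"
        unfolding conv_part_def
      proof (rule nn_integral_mono)
        fix v
        show "ennreal (p s (x - v) * p r v) * indicator {K<..<x - K} v \<le>
          ennreal (C1 * C2) * (ennreal (p ?T (x - v) * p ?T v) * indicator {K1<..<x - K1} v)"
        proof (cases "v \<in> {K<..<x - K}")
          case True
          then have v: "X2 \<le> v" "X1 \<le> x - v" "v \<in> {K1<..<x - K1}" using K by auto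
          have "p s (x - v) * p r v \<le> (C1 * p ?T (x - v)) * (C2 * p (r + s) v)"
            using C1 C2 v p_nonneg sr by (intro mult_mono) auto
          also have "\<dots> = C1 * C2 * (p ?T (x - v) * p ?T v)" by (simp add: add.commute)
          finally have "ennreal (p s (x - v) * p r v) \<le> ennreal (C1 * C2) * ennreal (p ?T (x - v) * p ?T v)"
            using C1 C2 p_nonneg sr by (subst ennreal_mult[symmetric]) (auto intro: ennreal_leI)
          then show ?thesis using v True by simp
        qed simp
      qed
      also have "\<dots> = ennreal (C1 * C2) * conv_part (p ?T) (p ?T) {K1<..<x - K1} x"
        unfolding conv_part_def by (rule nn_integral_cmult) measurable
      also have "\<dots> \<le> ennreal (C1 * C2) * ennreal (\<delta> / (C1 * C2) * p ?T x)"
        using elim by (intro mult_left_mono X) auto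
      also have "\<dots> = ennreal (\<delta> * p ?T x)"
        using C1 C2 \<delta> p_nonneg[of ?T x] sr by (subst ennreal_mult[symmetric]) auto
      finally show ?case .
    qed
  qed
qed

text \<open>
  Since the middle part is negligible, only the two ends contribute to the size-biased identity. At the end
  where the first summand is bounded its weight \<open>x - v \<le> K\<close> is negligible against \<open>x\<close>; at
  the other end the weight is close to \<open>x\<close>. So the latter end carries the fraction \<open>s / (s + r)\<close>.
\<close>
lemma near_part_bounds:
  assumes sr: "0 < s" "0 < r" and u: "uniformly_long_tailed (p (s + r))"
    and nm: "negligible_middle (p (s + r))" and \<eta>: "0 < \<eta>" "\<eta> < 1"
  obtains K0 where "0 \<le> K0" "\<And>K. K0 \<le> K \<Longrightarrow> \<forall>\<^sub>F x in at_top.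
      ennreal ((s / (s + r) - 2 * \<eta>) * p (s + r) x) \<le> conv_part (p s) (p r) {0..K} x \<and>
      conv_part (p s) (p r) {0..K} x \<le> ennreal (s / (s + r) / (1 - \<eta>) * p (s + r) x)"
proof -
  let ?T = "s + r" and ?k = "s / (s + r)"
  have k: "0 < ?k" using sr by simp
  have [measurable]: "p s \<in> borel_measurable borel" "p r \<in> borel_measurable borel" "p ?T \<in> borel_measurable borel"
    using p_measurable sr by auto
  obtain K0 where K0: "0 \<le> K0"
    "\<And>K. K0 \<le> K \<Longrightarrow> \<forall>\<^sub>F x in at_top. conv_part (p s) (p r) {K<..<x - K} x \<le> ennreal (\<eta> * p ?T x)"
    using earlier_middle_negligible[OF sr u nm \<eta>(1)] by blast
  show ?thesis
  proof (rule that[OF K0(1)])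
    fix K assume KK: "K0 \<le> K"
    then have K: "0 \<le> K" using K0(1) by simp
    show "\<forall>\<^sub>F x in at_top. ennreal ((?k - 2 * \<eta>) * p ?T x) \<le> conv_part (p s) (p r) {0..K} x \<and>
        conv_part (p s) (p r) {0..K} x \<le> ennreal (?k / (1 - \<eta>) * p ?T x)"
      using K0(2)[OF KK] eventually_gt_at_top[of "2 * K"] eventually_ge_at_top[of "K / \<eta>"]
    proof eventually_elim
      case (elim x)
      have x: "0 < x" using K elim by linarith
      have Kx: "K \<le> \<eta> * x" using elim \<eta> by (simp add: field_simps)
      have pT: "0 \<le> p ?T x" using p_nonneg sr by simp
      obtain A where A: "0 \<le> A" "conv_part (p s) (p r) {0..K} x = ennreal A" using conv_part_finite[OF sr] by blast
      have "ennreal ((x - K) * A) = ennreal (x - K) * ennreal A" using elim K A by (intro ennreal_mult) auto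
      also have "\<dots> \<le> ennreal (?k * (x * p ?T x))"
        using weighted_conv_part_le[OF sr K, of x] elim unfolding A(2) by (auto intro: order_trans[rotated] simp: add_increasing2)
      finally have "(x - K) * A \<le> ?k * (x * p ?T x)"
        by (subst (asm) ennreal_le_iff) (intro mult_nonneg_nonneg less_imp_le[OF k] less_imp_le[OF x] pT)
      moreover have "(1 - \<eta>) * x * A \<le> (x - K) * A" using Kx A by (intro mult_right_mono) (auto simp: algebra_simps)
      ultimately have "x * ((1 - \<eta>) * A) \<le> x * (?k * p ?T x)" by (simp add: ac_simps)
      then have "(1 - \<eta>) * A \<le> ?k * p ?T x" using x by (rule mult_left_le_imp_le)
      then have "A * (1 - \<eta>) \<le> ?k * p ?T x" by (simp only: mult.commute)
      then have "A \<le> ?k * p ?T x / (1 - \<eta>)" using \<eta> by (subst pos_le_divide_eq) auto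
      then have up: "A \<le> ?k / (1 - \<eta>) * p ?T x" by (simp only: times_divide_eq_left)
      have "ennreal (?k * (x * p ?T x)) = (\<integral>\<^sup>+v. ennreal ((x - v) * p s (x - v) * p r v) \<partial>lborel)"
        by (rule size_biased_conv[OF sr, symmetric])
      also have "\<dots> \<le> (\<integral>\<^sup>+v. ennreal x * (ennreal (p s (x - v) * p r v) * indicator {0..K} v) +
          (ennreal x * (ennreal (p s (x - v) * p r v) * indicator {K<..<x - K} v) +
           ennreal K * (ennreal (p s (x - v) * p r v) * indicator {x - K..x} v)) \<partial>lborel)"
      proof (rule nn_integral_mono)
        fix v
        let ?w = "p s (x - v) * p r v"
        have w: "0 \<le> ?w" using p_nonneg sr by simp
        consider "v < 0" | "x < v" | "v \<in> {0..K}" | "v \<in> {K<..<x - K}" | "v \<in> {x - K..x}"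
          using K elim by force
        then show "ennreal ((x - v) * p s (x - v) * p r v) \<le>
          ennreal x * (ennreal ?w * indicator {0..K} v) +
          (ennreal x * (ennreal ?w * indicator {K<..<x - K} v) + ennreal K * (ennreal ?w * indicator {x - K..x} v))"
        proof cases
          case 1 then show ?thesis using p_neg[of r v] sr by simp
        next
          case 2 then show ?thesis using p_neg[of s "x - v"] sr by simp
        next
          case 3
          then have "(x - v) * ?w \<le> x * ?w" using w by (intro mult_right_mono) auto
          then have "ennreal ((x - v) * ?w) \<le> ennreal x * ennreal ?w"
            using x w by (subst ennreal_mult[symmetric]) (auto intro: ennreal_leI)
          then show ?thesis using 3 by (simp add: mult.assoc add_increasing2)
        next
          case 4
          then have "(x - v) * ?w \<le> x * ?w" using w K by (intro mult_right_mono) auto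
          then have "ennreal ((x - v) * ?w) \<le> ennreal x * ennreal ?w"
            using x w by (subst ennreal_mult[symmetric]) (auto intro: ennreal_leI)
          then show ?thesis using 4 by (simp add: mult.assoc add_increasing2)
        next
          case 5
          then have "(x - v) * ?w \<le> K * ?w" using w K by (intro mult_right_mono) auto
          then have "ennreal ((x - v) * ?w) \<le> ennreal K * ennreal ?w"
            using K w by (subst ennreal_mult[symmetric]) (auto intro: ennreal_leI)
          then show ?thesis using 5 elim K by (simp add: mult.assoc add_increasing)
        qed
      qed
      also have "\<dots> = ennreal x * conv_part (p s) (p r) {0..K} x +
         (ennreal x * conv_part (p s) (p r) {K<..<x - K} x + ennreal K * conv_part (p s) (p r) {x - K..x} x)"
        unfolding conv_part_def by (simp add: nn_integral_add nn_integral_cmult)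
      also have "\<dots> \<le> ennreal x * ennreal A + (ennreal x * ennreal (\<eta> * p ?T x) + ennreal K * ennreal (p ?T x))"
      proof (intro add_mono mult_left_mono)
        show "conv_part (p s) (p r) {x - K..x} x \<le> ennreal (p ?T x)"
          unfolding conv[OF sr, symmetric] by (rule conv_part_mono) simp
      qed (use A elim in auto)
      also have "\<dots> = ennreal (x * A + (x * (\<eta> * p ?T x) + K * p ?T x))"
        using x A K \<eta> pT by (simp only: ennreal_plus ennreal_mult mult_nonneg_nonneg add_nonneg_nonneg less_imp_le)
      finally have "?k * (x * p ?T x) \<le> x * A + (x * (\<eta> * p ?T x) + K * p ?T x)"
        using x A K \<eta> pT by (subst (asm) ennreal_le_iff) auto
      also have "\<dots> \<le> x * A + (x * (\<eta> * p ?T x) + (\<eta> * x) * p ?T x)"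
        using Kx pT by (intro add_left_mono mult_right_mono) auto
      finally have "x * ((?k - 2 * \<eta>) * p ?T x) \<le> x * A" by (simp add: algebra_simps)
      then have lo: "(?k - 2 * \<eta>) * p ?T x \<le> A" using x by (rule mult_left_le_imp_le)
      show ?case unfolding A(2) using lo up by (auto intro: ennreal_leI)
    qed
  qed
qed

text \<open>
  The function \<open>\<Phi>\<close> is the ratio of the two densities, made bounded by modification on a left half-line. For
  bounded \<open>v\<close> the quotient \<open>p s (x - v) / p (s + r) x\<close> is close to \<open>\<Phi> (x - v)\<close>, so that the preceding bounds
  describe an average of \<open>\<Phi>\<close> near \<open>x\<close>.
\<close>
lemma ratio_convolution_limit:
  assumes sr: "0 < s" "0 < r" and u: "uniformly_long_tailed (p (s + r))" and nm: "negligible_middle (p (s + r))"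
    and \<Phi> [measurable]: "\<Phi> \<in> borel_measurable borel" and C: "\<And>x. 0 \<le> \<Phi> x" "\<And>x. \<Phi> x \<le> C"
    and eq: "\<And>x. X \<le> x \<Longrightarrow> \<Phi> x = p s x / p (s + r) x"
  shows "((\<lambda>x. \<integral>v. \<Phi> (x - v) \<partial>density lborel (\<lambda>x. ennreal (p r x))) \<longlongrightarrow> s / (s + r)) at_top"
proof (rule tendstoI)
  let ?T = "s + r"
  define k where "k = s / (s + r)"
  fix e :: real assume e: "0 < e"
  have [measurable]: "p s \<in> borel_measurable borel" "p r \<in> borel_measurable borel" "p ?T \<in> borel_measurable borel"
    using p_measurable sr by auto
  have k: "0 < k" using sr by (simp add: k_def)
  have C0: "0 \<le> C" using C[of 0] by simp
  have "((\<lambda>\<eta>. k / (1 - \<eta>) / (1 - \<eta>) + C * \<eta>) \<longlongrightarrow> k / (1 - 0) / (1 - 0) + C * 0) (at_right (0::real))"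
    by (intro tendsto_intros) auto
  then have "\<forall>\<^sub>F \<eta> in at_right 0. k / (1 - \<eta>) / (1 - \<eta>) + C * \<eta> < k + e"
    by (rule order_tendstoD(2)) (use e in simp)
  moreover have "((\<lambda>\<eta>. (k - 2 * \<eta>) / (1 + \<eta>)) \<longlongrightarrow> (k - 2 * 0) / (1 + 0)) (at_right (0::real))"
    by (intro tendsto_intros) auto
  then have "\<forall>\<^sub>F \<eta> in at_right 0. k - e < (k - 2 * \<eta>) / (1 + \<eta>)"
    by (rule order_tendstoD(1)) (use e in simp)
  moreover have "\<forall>\<^sub>F \<eta> in at_right 0. 0 < \<eta> \<and> \<eta> < (1::real)" "\<forall>\<^sub>F \<eta> in at_right 0. 2 * \<eta> < k"
    unfolding eventually_at_right_field using k by (auto intro: exI[of _ 1] exI[of _ "k / 2"])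
  ultimately have "\<forall>\<^sub>F \<eta> in at_right 0. k / (1 - \<eta>) / (1 - \<eta>) + C * \<eta> < k + e \<and>
     k - e < (k - 2 * \<eta>) / (1 + \<eta>) \<and> 0 < \<eta> \<and> \<eta> < 1 \<and> 2 * \<eta> < k"
    by eventually_elim blast
  then obtain \<eta> where e1: "k / (1 - \<eta>) / (1 - \<eta>) + C * \<eta> < k + e" and e2: "k - e < (k - 2 * \<eta>) / (1 + \<eta>)"
     and \<eta>: "0 < \<eta>" "\<eta> < 1" "2 * \<eta> < k"
    by (metis (no_types, lifting) eventually_happens trivial_limit_at_right_real)
  obtain K1 where K1: "0 \<le> K1" "\<And>K. K1 \<le> K \<Longrightarrow> \<forall>\<^sub>F x in at_top.
      ennreal ((k - 2 * \<eta>) * p ?T x) \<le> conv_part (p s) (p r) {0..K} x \<and>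
      conv_part (p s) (p r) {0..K} x \<le> ennreal (k / (1 - \<eta>) * p ?T x)"
    using near_part_bounds[OF sr u nm \<eta>(1,2)] unfolding k_def by blast
  obtain K2 where K2: "\<And>K. K2 \<le> K \<Longrightarrow> ennreal (1 - \<eta>) \<le> (\<integral>\<^sup>+v. ennreal (p r v) * indicator {0..K} v \<partial>lborel)"
    using halfline_density_mass[OF halfline[OF sr(2)] \<eta>(1)] by metis
  define K where "K = max K1 K2"
  have K: "0 \<le> K" "K1 \<le> K" "K2 \<le> K" using K1 by (auto simp: K_def)
  have far: "(\<integral>\<^sup>+v. ennreal (p r v) * indicator {K<..} v \<partial>lborel) \<le> ennreal \<eta>"
  proof -
    let ?F = "\<integral>\<^sup>+v. ennreal (p r v) * indicator {K<..} v \<partial>lborel"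
    have "ennreal (1 - \<eta>) + ?F \<le> (\<integral>\<^sup>+v. ennreal (p r v) * indicator {0..K} v \<partial>lborel) + ?F"
      using K2[OF K(3)] by (rule add_right_mono)
    also have "\<dots> = (\<integral>\<^sup>+v. ennreal (p r v) * indicator {0..K} v + ennreal (p r v) * indicator {K<..} v \<partial>lborel)"
      by (rule nn_integral_add[symmetric]) measurable
    also have "\<dots> \<le> (\<integral>\<^sup>+v. ennreal (p r v) \<partial>lborel)"
      by (intro nn_integral_mono) (auto split: split_indicator)
    also have "\<dots> = 1" using p_integral sr by simp
    finally have le: "ennreal (1 - \<eta>) + ?F \<le> ennreal 1" by simp
    then have "?F \<noteq> \<top>" by (auto simp: top_unique)
    then obtain f where f: "?F = ennreal f" "0 \<le> f" by (cases ?F) auto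
    have "ennreal (1 - \<eta> + f) \<le> ennreal 1" using le f \<eta> by (subst ennreal_plus) auto
    then have "f \<le> \<eta>" using f \<eta> by (subst (asm) ennreal_le_iff) auto
    then show ?thesis unfolding f(1) by (rule ennreal_leI)
  qed
  obtain X1 where X1: "\<And>x. X1 \<le> x \<Longrightarrow> 0 < p ?T x"
    "\<And>x v. X1 \<le> x \<Longrightarrow> 0 \<le> v \<Longrightarrow> v \<le> K \<Longrightarrow> (1 - \<eta>) * p ?T x \<le> p ?T (x - v)"
    "\<And>x v. X1 \<le> x \<Longrightarrow> 0 \<le> v \<Longrightarrow> v \<le> K \<Longrightarrow> p ?T (x - v) \<le> (1 + \<eta>) * p ?T x"
    using uniformly_long_tailedD[OF u \<eta>(1) K(1)] by metis
  let ?N = "density lborel (\<lambda>x. ennreal (p r x))"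
  show "\<forall>\<^sub>F x in at_top. dist (\<integral>v. \<Phi> (x - v) \<partial>?N) (s / (s + r)) < e"
    unfolding k_def[symmetric]
    using K1(2)[OF K(2)] eventually_ge_at_top[of "X + K"] eventually_ge_at_top[of X1]
  proof eventually_elim
    case (elim x)
    have pT: "0 < p ?T x" using X1(1) elim by simp
    let ?A = "conv_part (p s) (p r) {0..K} x"
    obtain A where A: "0 \<le> A" "?A = ennreal A" using conv_part_finite[OF sr] by blast
    have Alo: "(k - 2 * \<eta>) * p ?T x \<le> A" and Aup: "A \<le> k / (1 - \<eta>) * p ?T x"
      using elim A \<eta> k pT unfolding A(2) by (auto simp: ennreal_le_iff)
    have near: "\<Phi> (x - v) \<le> p s (x - v) / ((1 - \<eta>) * p ?T x) \<and> p s (x - v) / ((1 + \<eta>) * p ?T x) \<le> \<Phi> (x - v)"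
      if v: "v \<in> {0..K}" for v
    proof -
      have "\<Phi> (x - v) = p s (x - v) / p ?T (x - v)" using elim v by (intro eq) auto
      moreover have "(1 - \<eta>) * p ?T x \<le> p ?T (x - v)" "p ?T (x - v) \<le> (1 + \<eta>) * p ?T x" using X1 v elim by auto
      moreover have "0 < (1 - \<eta>) * p ?T x" using pT \<eta> by simp
      moreover have "0 < p ?T (x - v)" using calculation by linarith
      ultimately show ?thesis using p_nonneg[OF sr(1)] \<eta> pT by (auto intro!: divide_left_mono mult_pos_pos)
    qed
    define J where "J = (\<integral>v. \<Phi> (x - v) \<partial>?N)"
    have J: "ennreal J = conv_part \<Phi> (p r) UNIV x"
    proof -
      interpret N: prob_space ?N
        by (rule prob_spaceI) (simp add: emeasure_density p_integral sr)
      have "ennreal J = (\<integral>\<^sup>+v. ennreal (\<Phi> (x - v)) \<partial>?N)"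
        unfolding J_def using C by (intro nn_integral_eq_integral[symmetric] N.integrable_const_bound[where B=C]) auto
      also have "\<dots> = (\<integral>\<^sup>+v. ennreal (p r v) * ennreal (\<Phi> (x - v)) \<partial>lborel)" by (rule nn_integral_density) auto
      also have "\<dots> = conv_part \<Phi> (p r) UNIV x"
        unfolding conv_part_def using C p_nonneg sr by (intro nn_integral_cong) (simp add: ennreal_mult mult.commute)
      finally show ?thesis .
    qed
    have J0: "0 \<le> J" unfolding J_def using C by (intro integral_nonneg_AE) auto
    have "conv_part \<Phi> (p r) UNIV x = conv_part \<Phi> (p r) ({0..K} \<union> {K<..}) x"
    proof -
      have "conv_part \<Phi> (p r) UNIV x = conv_part \<Phi> (p r) {0..} x"
        unfolding conv_part_def using p_neg[OF sr(2)] by (intro nn_integral_cong) (auto split: split_indicator)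
      also have "{0..} = {0..K} \<union> {K<..}" using K by auto
      finally show ?thesis .
    qed
    also have "\<dots> = conv_part \<Phi> (p r) {0..K} x + conv_part \<Phi> (p r) {K<..} x"
      by (rule conv_part_Un) auto
    finally have J': "ennreal J = conv_part \<Phi> (p r) {0..K} x + conv_part \<Phi> (p r) {K<..} x" unfolding J .
    have "conv_part \<Phi> (p r) {0..K} x \<le>
       (\<integral>\<^sup>+v. ennreal (1 / ((1 - \<eta>) * p ?T x)) * (ennreal (p s (x - v) * p r v) * indicator {0..K} v) \<partial>lborel)"
      unfolding conv_part_def
    proof (rule nn_integral_mono)
      fix v
      show "ennreal (\<Phi> (x - v) * p r v) * indicator {0..K} v \<le>
         ennreal (1 / ((1 - \<eta>) * p ?T x)) * (ennreal (p s (x - v) * p r v) * indicator {0..K} v)"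
      proof (cases "v \<in> {0..K}")
        case True
        have "\<Phi> (x - v) * p r v \<le> p s (x - v) / ((1 - \<eta>) * p ?T x) * p r v"
          using near[OF True] p_nonneg[OF sr(2)] by (intro mult_right_mono) auto
        also have "\<dots> = 1 / ((1 - \<eta>) * p ?T x) * (p s (x - v) * p r v)" by simp
        finally have "ennreal (\<Phi> (x - v) * p r v) \<le> ennreal (1 / ((1 - \<eta>) * p ?T x)) * ennreal (p s (x - v) * p r v)"
          using \<eta> pT p_nonneg sr by (subst ennreal_mult[symmetric]) (auto intro: ennreal_leI)
        then show ?thesis using True by simp
      qed simp
    qed
    also have "\<dots> = ennreal (1 / ((1 - \<eta>) * p ?T x)) * ennreal A"
      unfolding A(2)[symmetric] unfolding conv_part_def by (rule nn_integral_cmult) measurable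
    also have "\<dots> = ennreal (1 / ((1 - \<eta>) * p ?T x) * A)"
      using \<eta> pT A by (intro ennreal_mult[symmetric]) auto
    also have "\<dots> \<le> ennreal (k / (1 - \<eta>) / (1 - \<eta>))"
    proof (rule ennreal_leI)
      have "1 / ((1 - \<eta>) * p ?T x) * A \<le> 1 / ((1 - \<eta>) * p ?T x) * (k / (1 - \<eta>) * p ?T x)"
        using Aup \<eta> pT by (intro mult_left_mono) auto
      also have "\<dots> = k / (1 - \<eta>) / (1 - \<eta>)" using pT by simp
      finally show "1 / ((1 - \<eta>) * p ?T x) * A \<le> k / (1 - \<eta>) / (1 - \<eta>)" .
    qed
    finally have up1: "conv_part \<Phi> (p r) {0..K} x \<le> ennreal (k / (1 - \<eta>) / (1 - \<eta>))" .
    have "conv_part \<Phi> (p r) {K<..} x \<le> (\<integral>\<^sup>+v. ennreal C * (ennreal (p r v) * indicator {K<..} v) \<partial>lborel)"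
      unfolding conv_part_def using C C0 p_nonneg[OF sr(2)]
      by (intro nn_integral_mono) (auto split: split_indicator simp: ennreal_mult[symmetric] intro!: ennreal_leI mult_right_mono)
    also have "\<dots> = ennreal C * (\<integral>\<^sup>+v. ennreal (p r v) * indicator {K<..} v \<partial>lborel)"
      by (rule nn_integral_cmult) measurable
    also have "\<dots> \<le> ennreal C * ennreal \<eta>" by (intro mult_left_mono far) auto
    also have "\<dots> = ennreal (C * \<eta>)" using C0 \<eta> by (simp add: ennreal_mult)
    finally have "ennreal J \<le> ennreal (k / (1 - \<eta>) / (1 - \<eta>)) + ennreal (C * \<eta>)"
      unfolding J' using up1 by (intro add_mono)
    also have "\<dots> = ennreal (k / (1 - \<eta>) / (1 - \<eta>) + C * \<eta>)"
      using k \<eta> C0 by (intro ennreal_plus[symmetric]) (auto intro!: divide_nonneg_nonneg)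
    finally have "J \<le> k / (1 - \<eta>) / (1 - \<eta>) + C * \<eta>"
      using k \<eta> C0 by (subst (asm) ennreal_le_iff) (auto intro!: divide_nonneg_nonneg add_nonneg_nonneg)
    then have Jup: "J < k + e" using e1 by linarith
    have "(k - 2 * \<eta>) / (1 + \<eta>) = 1 / ((1 + \<eta>) * p ?T x) * ((k - 2 * \<eta>) * p ?T x)" using pT by simp
    also have "\<dots> \<le> 1 / ((1 + \<eta>) * p ?T x) * A" using Alo \<eta> pT by (intro mult_left_mono) auto
    finally have "ennreal ((k - 2 * \<eta>) / (1 + \<eta>)) \<le> ennreal (1 / ((1 + \<eta>) * p ?T x) * A)" by (rule ennreal_leI)
    also have "\<dots> = ennreal (1 / ((1 + \<eta>) * p ?T x)) * ennreal A"
      using \<eta> pT A by (intro ennreal_mult) auto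
    also have "\<dots> = (\<integral>\<^sup>+v. ennreal (1 / ((1 + \<eta>) * p ?T x)) * (ennreal (p s (x - v) * p r v) * indicator {0..K} v) \<partial>lborel)"
      unfolding A(2)[symmetric] unfolding conv_part_def by (rule nn_integral_cmult[symmetric]) measurable
    also have "\<dots> \<le> conv_part \<Phi> (p r) {0..K} x"
      unfolding conv_part_def
    proof (rule nn_integral_mono)
      fix v
      show "ennreal (1 / ((1 + \<eta>) * p ?T x)) * (ennreal (p s (x - v) * p r v) * indicator {0..K} v) \<le>
        ennreal (\<Phi> (x - v) * p r v) * indicator {0..K} v"
      proof (cases "v \<in> {0..K}")
        case True
        have "1 / ((1 + \<eta>) * p ?T x) * (p s (x - v) * p r v) = p s (x - v) / ((1 + \<eta>) * p ?T x) * p r v" by simp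
        also have "\<dots> \<le> \<Phi> (x - v) * p r v" using near[OF True] p_nonneg[OF sr(2)] by (intro mult_right_mono) auto
        finally have "ennreal (1 / ((1 + \<eta>) * p ?T x)) * ennreal (p s (x - v) * p r v) \<le> ennreal (\<Phi> (x - v) * p r v)"
          using \<eta> pT p_nonneg sr by (subst ennreal_mult[symmetric]) (auto intro: ennreal_leI)
        then show ?thesis using True by simp
      qed simp
    qed
    also have "\<dots> \<le> ennreal J" unfolding J' by simp
    finally have "(k - 2 * \<eta>) / (1 + \<eta>) \<le> J" using J0 by (simp add: ennreal_le_iff)
    then have "k - e < J" using e2 by linarith
    then show ?case using Jup unfolding J_def[symmetric] dist_real_def by linarith
  qed
qed

text \<open>
  The preceding lemma gives the limit of an average of \<open>\<Phi>\<close>. The averaging distribution is the convolution of the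
  contributions of the jumps above and below \<open>\<epsilon>\<close>; the former is removed by deconvolution, the latter is
  concentrated near \<open>0\<close> for small \<open>\<epsilon>\<close> and affects the slowly oscillating \<open>\<Phi>\<close> only a little.
\<close>
lemma earlier_density_ratio:
  assumes sr: "0 < s" "0 < r" and S: "subexp_density (p (s + r))"
  shows "((\<lambda>x. p s x / p (s + r) x) \<longlongrightarrow> s / (s + r)) at_top"
proof -
  let ?T = "s + r"
  have T: "0 < ?T" using sr by simp
  have [measurable]: "p s \<in> borel_measurable borel" "p r \<in> borel_measurable borel" "p ?T \<in> borel_measurable borel"
    using p_measurable sr by auto
  have l: "long_tailed (p ?T)" using S by (simp add: subexp_density_def long_tailed_density_def)
  note u = long_tailed_uniform[OF l cont[OF T]]
  note nm = subexp_density_imp_negligible_middle[OF halfline[OF T] u S]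
  obtain C X0 where C: "0 < C" "\<And>x. X0 \<le> x \<Longrightarrow> p s x \<le> C * p ?T x" using earlier_density_le[OF sr u] by blast
  obtain X1 where X1: "\<And>x. X1 \<le> x \<Longrightarrow> 0 < p ?T x"
    using uniformly_long_tailedD[OF u zero_less_one order_refl] by metis
  define X where "X = max X0 X1"
  have X: "\<And>x. X \<le> x \<Longrightarrow> p s x \<le> C * p ?T x" "\<And>x. X \<le> x \<Longrightarrow> 0 < p ?T x" using C X1 by (auto simp: X_def)
  define \<Phi> where "\<Phi> x = (if X \<le> x then p s x / p ?T x else 0)" for x
  have \<Phi>m [measurable]: "\<Phi> \<in> borel_measurable borel" unfolding \<Phi>_def by measurable
  have \<Phi>0: "0 \<le> \<Phi> x" for x using p_nonneg sr by (simp add: \<Phi>_def)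
  have \<Phi>C: "\<Phi> x \<le> C" for x using X C by (auto simp: \<Phi>_def pos_divide_le_eq)
  have \<Phi>B: "\<bar>\<Phi> x\<bar> \<le> C" for x using \<Phi>0[of x] \<Phi>C[of x] by simp
  have osc: "\<exists>\<delta>>0. \<exists>Y. \<forall>x\<ge>Y. \<forall>v\<in>{0..\<delta>}. \<bar>\<Phi> x - \<Phi> (x - v)\<bar> \<le> \<eta>" if \<eta>: "0 < \<eta>" for \<eta>
  proof -
    obtain \<delta> Y1 where \<delta>: "0 < \<delta>" and Y1: "\<And>x v. Y1 \<le> x \<Longrightarrow> 0 \<le> v \<Longrightarrow> v \<le> \<delta> \<Longrightarrow> \<bar>p s x - p s (x - v)\<bar> \<le> \<eta> / 2 * p ?T x"
      using earlier_density_equicontinuous[OF sr u, of "\<eta> / 2"] \<eta> by (metis half_gt_zero)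
    define h where "h = \<eta> / (2 * C)"
    have h: "0 < h" "C * h = \<eta> / 2" using \<eta> C by (auto simp: h_def)
    obtain Y2 where Y2: "\<And>x v. Y2 \<le> x \<Longrightarrow> 0 \<le> v \<Longrightarrow> v \<le> \<delta> \<Longrightarrow> (1 - h) * p ?T x \<le> p ?T (x - v)"
      "\<And>x v. Y2 \<le> x \<Longrightarrow> 0 \<le> v \<Longrightarrow> v \<le> \<delta> \<Longrightarrow> p ?T (x - v) \<le> (1 + h) * p ?T x"
      using uniformly_long_tailedD[OF u h(1) less_imp_le[OF \<delta>]] by metis
    show ?thesis
    proof (rule exI[of _ \<delta>], intro conjI \<delta> exI[of _ "max (max Y1 Y2) (X + \<delta>)"] allI impI ballI)
      fix x v assume x: "max (max Y1 Y2) (X + \<delta>) \<le> x" and v: "v \<in> {0..\<delta>}"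
      have XX: "X \<le> x" "X \<le> x - v" using x v \<delta> by auto
      note pos = X(2)[OF XX(1)] X(2)[OF XX(2)]
      have "\<Phi> x - \<Phi> (x - v) = (p s x - p s (x - v)) / p ?T x + \<Phi> (x - v) * ((p ?T (x - v) - p ?T x) / p ?T x)"
        using pos XX by (simp add: \<Phi>_def field_simps)
      then have "\<bar>\<Phi> x - \<Phi> (x - v)\<bar> \<le> \<bar>(p s x - p s (x - v)) / p ?T x\<bar> + \<bar>\<Phi> (x - v) * ((p ?T (x - v) - p ?T x) / p ?T x)\<bar>"
        by linarith
      also have "\<bar>(p s x - p s (x - v)) / p ?T x\<bar> \<le> \<eta> / 2"
        using Y1[of x v] x v pos by (simp add: abs_divide pos_divide_le_eq)
      also have "\<bar>\<Phi> (x - v) * ((p ?T (x - v) - p ?T x) / p ?T x)\<bar> \<le> C * h"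
      proof -
        have "\<bar>p ?T (x - v) - p ?T x\<bar> \<le> h * p ?T x"
          using Y2[of x v] x v by (auto simp: abs_le_iff algebra_simps)
        then have "\<bar>(p ?T (x - v) - p ?T x) / p ?T x\<bar> \<le> h" using pos by (simp add: abs_divide pos_divide_le_eq)
        then show ?thesis unfolding abs_mult using \<Phi>B C h by (intro mult_mono) auto
      qed
      finally show "\<bar>\<Phi> x - \<Phi> (x - v)\<bar> \<le> \<eta>" using h by simp
    qed
  qed
  have lim: "((\<lambda>x. \<integral>v. \<Phi> (x - v) \<partial>density lborel (\<lambda>x. ennreal (p r x))) \<longlongrightarrow> s / ?T) at_top"
    by (rule ratio_convolution_limit[OF sr u nm \<Phi>m \<Phi>0 \<Phi>C, of X]) (simp add: \<Phi>_def)
  have "(\<Phi> \<longlongrightarrow> s / ?T) at_top"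
  proof (rule tendsto_remove_approximate_identity[OF \<Phi>m \<Phi>B osc])
    fix \<delta> \<eta> :: real assume "0 < \<delta>" "0 < \<eta>"
    then obtain \<epsilon> where \<epsilon>: "0 < \<epsilon>" "measure (M \<epsilon> r) {\<delta><..} \<le> \<eta>" using M_small sr by blast
    let ?\<Psi> = "\<lambda>x. \<integral>v. \<Phi> (x - v) \<partial>M \<epsilon> r"
    note \<Psi> = bounded_convolution[OF M_dist[OF \<epsilon>(1) sr(2)] \<Phi>m \<Phi>B]
    have "(?\<Psi> \<longlongrightarrow> s / ?T) at_top"
    proof (rule tendsto_deconvolve_semigroup[where P = "P \<epsilon>" and c = "rate \<epsilon>" and t = r, OF _ _ _ \<Psi>])
      show "real_distribution (P \<epsilon> t)" if "0 < t" for t using P_dist \<epsilon> that by simp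
      show "P \<epsilon> (2 * t) = (P \<epsilon> t \<star> P \<epsilon> t)" if "0 < t" for t using P_add[OF \<epsilon>(1) that that] by simp
      show "exp (- rate \<epsilon> * t) \<le> measure (P \<epsilon> t) {0}" if "0 < t" for t using P_atom \<epsilon> that by simp
      show "((\<lambda>x. \<integral>w. ?\<Psi> (x - w) \<partial>P \<epsilon> r) \<longlongrightarrow> s / ?T) at_top"
        using lim unfolding factor[OF \<epsilon>(1) sr(2)]
        iterated_convolution[OF M_dist[OF \<epsilon>(1) sr(2)] P_dist[OF \<epsilon>(1) sr(2)] \<Phi>m \<Phi>B] .
    qed (fact sr)
    then show "\<exists>M. real_distribution M \<and> measure M {..<0} = 0 \<and> measure M {\<delta><..} \<le> \<eta> \<and>
        ((\<lambda>x. \<integral>v. \<Phi> (x - v) \<partial>M) \<longlongrightarrow> s / ?T) at_top"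
      using M_dist M_nonneg \<epsilon> sr by blast
  qed
  moreover have "\<forall>\<^sub>F x in at_top. \<Phi> x = p s x / p ?T x"
    using eventually_ge_at_top[of X] by eventually_elim (simp add: \<Phi>_def)
  ultimately show ?thesis by (simp add: tendsto_cong)
qed

lemma subexp_density_double:
  assumes t: "0 < t" and S: "subexp_density (p t)"
  shows "subexp_density (p (2 * t))"
proof -
  have t2: "0 < 2 * t" using t by simp
  have dc: "density_conv (p t) (p t) = p (2 * t)"
    using density_conv_eq[OF halfline[OF t] halfline[OF t]] conv[OF t t] p_nonneg[OF t2]
    by (simp add: fun_eq_iff)
  have "((\<lambda>x. 2 * (density_conv (p t) (p t) x / (2 * p t x))) \<longlongrightarrow> 2 * 1) at_top"
    using S unfolding subexp_density_def tail_equiv_iff by (intro tendsto_mult tendsto_const) auto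
  then have "((\<lambda>x. p (2 * t) x / p t x) \<longlongrightarrow> 2) at_top" by (simp add: dc)
  from subexp_density_cong[OF S halfline[OF t] cont[OF t] halfline[OF t2] cont[OF t2] this] show ?thesis by simp
qed

text \<open>
  Ratios are known for times before a subexponential one. By doubling there are arbitrarily late such
  times, which serve as a common reference for all others.
\<close>
lemma subexp_density_all_times:
  assumes T: "0 < T" and S: "subexp_density (p T)"
  shows "0 < t \<Longrightarrow> subexp_density (p t)" "0 < t \<Longrightarrow> tail_equiv (p t) (\<lambda>x. t * p 1 x)"
proof -
  have S': "subexp_density (p (2 ^ n * T))" for n
  proof (induction n)
    case (Suc n)
    then show ?case using subexp_density_double[of "2 ^ n * T"] T by (simp add: mult.assoc)
  qed (use S in simp)
  have later: "\<exists>T'>a. 0 < T' \<and> subexp_density (p T')" for a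
  proof -
    obtain n where "a / T < 2 ^ n" using real_arch_pow[of 2 "a / T"] by auto
    then have "a < 2 ^ n * T" using T by (simp add: field_simps)
    then show ?thesis using S'[of n] T by (intro exI[of _ "2 ^ n * T"]) auto
  qed
  have sub: "subexp_density (p t)" if t: "0 < t" for t
  proof -
    obtain T' where T': "t < T'" "0 < T'" "subexp_density (p T')" using later by blast
    have lim: "((\<lambda>x. p t x / p T' x) \<longlongrightarrow> t / T') at_top"
      using earlier_density_ratio[of t "T' - t"] T' t by simp
    show ?thesis
      by (rule subexp_density_cong[OF T'(3) halfline[OF T'(2)] cont[OF T'(2)] halfline[OF t] cont[OF t] lim])
         (use T' t in simp)
  qed
  then show "0 < t \<Longrightarrow> subexp_density (p t)" .
  show "tail_equiv (p t) (\<lambda>x. t * p 1 x)" if t: "0 < t"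
  proof -
    obtain T' where T': "max t 1 < T'" "0 < T'" "subexp_density (p T')" using later by blast
    have 1: "((\<lambda>x. p t x / p T' x) \<longlongrightarrow> t / T') at_top"
      using earlier_density_ratio[of t "T' - t"] T' t by simp
    have 2: "((\<lambda>x. p 1 x / p T' x) \<longlongrightarrow> 1 / T') at_top"
      using earlier_density_ratio[of 1 "T' - 1"] T' by simp
    have pos: "\<forall>\<^sub>F x in at_top. 0 < p t' x" if "0 < t'" for t'
      using sub[OF that] unfolding subexp_density_def tail_equiv_iff by (auto elim: eventually_mono)
    have "((\<lambda>x. (p t x / p T' x) / (t * (p 1 x / p T' x))) \<longlongrightarrow> (t / T') / (t * (1 / T'))) at_top"
      using t T' by (intro tendsto_divide 1 tendsto_mult tendsto_const 2) auto
    then have "((\<lambda>x. (p t x / p T' x) / (t * (p 1 x / p T' x))) \<longlongrightarrow> 1) at_top" using t T' by simp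
    moreover have "\<forall>\<^sub>F x in at_top. (p t x / p T' x) / (t * (p 1 x / p T' x)) = p t x / (t * p 1 x)"
      using pos[OF T'(2)] by eventually_elim auto
    ultimately have "((\<lambda>x. p t x / (t * p 1 x)) \<longlongrightarrow> 1) at_top" by (rule Lim_transform_eventually)
    then show ?thesis
      unfolding tail_equiv_iff using pos[OF t] pos[OF zero_less_one] t by (auto elim: eventually_elim2)
  qed
qed

end

section \<open>Compound Poisson distributions\<close>

lemma char_convolution:
  assumes M: "real_distribution M" and N: "real_distribution N"
  shows "char (M \<star> N) z = char M z * char N z"
proof -
  have "char (M \<star> N) z = (\<integral>y. (\<integral>x. iexp (z * (x + y)) \<partial>M) \<partial>N)"
    unfolding char_def by (rule integral_convolution[OF M N, where B=1]) auto
  also have "\<dots> = (\<integral>y. (\<integral>x. iexp (z * x) * iexp (z * y) \<partial>M) \<partial>N)"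
    by (intro Bochner_Integration.integral_cong refl) (simp add: exp_add[symmetric] algebra_simps)
  also have "\<dots> = char M z * char N z" by (simp add: char_def)
  finally show ?thesis .
qed

lemma convolution_eqI_char:
  assumes "real_distribution M" "real_distribution N" "real_distribution L"
    and "\<And>z. char L z = char M z * char N z"
  shows "L = (M \<star> N)"
  using assms by (intro Levy_uniqueness real_distribution_convolution) (auto simp: fun_eq_iff char_convolution)

lemma integral_bind_complex:
  fixes f :: "real \<Rightarrow> complex"
  assumes D: "prob_space D" and K: "K \<in> measurable D (prob_algebra borel)"
    and [measurable]: "f \<in> borel_measurable borel" and B: "\<And>x. norm (f x) \<le> B"
  shows "(\<integral>x. f x \<partial>(D \<bind> K)) = (\<integral>n. (\<integral>x. f x \<partial>K n) \<partial>D)"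
proof -
  interpret D: prob_space D by (fact D)
  have K': "K \<in> measurable D (subprob_algebra borel)" by (rule measurable_prob_algebraD[OF K])
  have Kn: "prob_space (K n)" "sets (K n) = sets borel" if "n \<in> space D" for n
    using measurable_space[OF K that] by (auto simp: space_prob_algebra)
  interpret DK: prob_space "D \<bind> K"
    by (rule prob_space_bind'[OF _ K]) (simp add: space_prob_algebra D)
  have sDK: "sets (D \<bind> K) = sets borel" by (rule sets_bind'[OF _ K]) (simp add: space_prob_algebra D)
  have fDK [measurable]: "f \<in> borel_measurable (D \<bind> K)" by (simp add: measurable_cong_sets[OF sDK refl])
  have intf: "integrable (D \<bind> K) f" by (rule DK.integrable_const_bound[OF AE_I2[OF B] fDK])
  have intn: "integrable (K n) f" if "n \<in> space D" for n
  proof -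
    interpret Kn: prob_space "K n" by (rule Kn(1)[OF that])
    have "f \<in> borel_measurable (K n)" by (simp add: measurable_cong_sets[OF Kn(2)[OF that] refl])
    then show ?thesis by (rule Kn.integrable_const_bound[OF AE_I2[OF B]])
  qed
  have Gm: "(\<lambda>n. \<integral>x. f x \<partial>K n) \<in> borel_measurable D"
    using K' by (rule measurable_compose[OF _ integral_measurable_subprob_algebra]) measurable
  have GB: "norm (\<integral>x. f x \<partial>K n) \<le> B" if n: "n \<in> space D" for n
  proof -
    interpret Kn: prob_space "K n" by (rule Kn(1)[OF n])
    have "norm (\<integral>x. f x \<partial>K n) \<le> (\<integral>x. norm (f x) \<partial>K n)" by (rule integral_norm_bound)
    also have "\<dots> \<le> B"
      using intn[OF n] B by (intro Kn.integral_le_const) auto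
    finally show ?thesis .
  qed
  have intG: "integrable D (\<lambda>n. \<integral>x. f x \<partial>K n)"
    by (rule D.integrable_const_bound[OF AE_I2[OF GB] Gm])
  have part: "(\<integral>x. g (f x) \<partial>(D \<bind> K)) = (\<integral>n. (\<integral>x. g (f x) \<partial>K n) \<partial>D)"
    if [measurable]: "g \<in> borel_measurable borel" and g: "\<And>w. \<bar>g w\<bar> \<le> norm w" for g :: "complex \<Rightarrow> real"
    by (rule integral_bind[where B=B and B'=1, OF _ _ K'])
       (use g B D.finite_measure_axioms Kn in \<open>auto intro: order_trans simp: prob_space.emeasure_space_1\<close>)
  show ?thesis
  proof (rule complex_eqI)
    have "Re (\<integral>x. f x \<partial>(D \<bind> K)) = (\<integral>n. (\<integral>x. Re (f x) \<partial>K n) \<partial>D)"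
      using part[of Re] intf abs_Re_le_cmod by simp
    also have "\<dots> = (\<integral>n. Re (\<integral>x. f x \<partial>K n) \<partial>D)"
      using intn by (intro Bochner_Integration.integral_cong) auto
    finally show "Re (\<integral>x. f x \<partial>(D \<bind> K)) = Re (\<integral>n. (\<integral>x. f x \<partial>K n) \<partial>D)" using intG by simp
    have "Im (\<integral>x. f x \<partial>(D \<bind> K)) = (\<integral>n. (\<integral>x. Im (f x) \<partial>K n) \<partial>D)"
      using part[of Im] intf abs_Im_le_cmod by simp
    also have "\<dots> = (\<integral>n. Im (\<integral>x. f x \<partial>K n) \<partial>D)"
      using intn by (intro Bochner_Integration.integral_cong) auto
    finally show "Im (\<integral>x. f x \<partial>(D \<bind> K)) = Im (\<integral>n. (\<integral>x. f x \<partial>K n) \<partial>D)" using intG by simp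
  qed
qed

lemma poisson_power_integral:
  fixes c :: complex
  assumes l: "0 < l" and c: "norm c \<le> 1"
  shows "(\<integral>n. c ^ n \<partial>measure_pmf (poisson_pmf l)) = exp (of_real l * (c - 1))"
proof -
  have eq: "pmf (poisson_pmf l) n *\<^sub>R c ^ n = exp (- of_real l) * ((of_real l * c) ^ n /\<^sub>R fact n)" for n
    using l by (simp add: scaleR_conv_of_real power_mult_distrib field_simps exp_of_real[symmetric] exp_minus)
  have sums: "(\<lambda>n. pmf (poisson_pmf l) n *\<^sub>R c ^ n) sums (exp (- of_real l) * exp (of_real l * c))"
    unfolding eq by (intro sums_mult exp_converges)
  have "summable (\<lambda>n. norm (exp (- of_real l :: complex)) * norm ((of_real l * c) ^ n /\<^sub>R fact n))"
    by (intro summable_mult summable_norm_exp)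
  then have int: "integrable (count_space UNIV) (\<lambda>n. pmf (poisson_pmf l) n *\<^sub>R c ^ n)"
    unfolding integrable_count_space_nat_iff eq by (simp only: norm_mult)
  have "(\<integral>n. c ^ n \<partial>measure_pmf (poisson_pmf l)) = (\<integral>n. pmf (poisson_pmf l) n *\<^sub>R c ^ n \<partial>count_space UNIV)"
    unfolding measure_pmf_eq_density[of "poisson_pmf l"] by (subst integral_density) auto
  also have "\<dots> = exp (- of_real l) * exp (of_real l * c)"
    using sums_unique2[OF sums_integral_count_space_nat[OF int] sums] .
  also have "\<dots> = exp (of_real l * (c - 1))" by (simp add: exp_add[symmetric] algebra_simps)
  finally show ?thesis .
qed

lemma poisson_power_nn_integral:
  assumes l: "0 < l" and r: "0 \<le> r"
  shows "(\<integral>\<^sup>+n. ennreal (r ^ n) \<partial>measure_pmf (poisson_pmf l)) = ennreal (exp (l * (r - 1)))"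
proof -
  have eq: "pmf (poisson_pmf l) n * r ^ n = exp (- l) * ((l * r) ^ n /\<^sub>R fact n)" for n
    using l by (simp add: power_mult_distrib field_simps)
  have sums: "(\<lambda>n. pmf (poisson_pmf l) n * r ^ n) sums (exp (- l) * exp (l * r))"
    unfolding eq by (intro sums_mult exp_converges)
  have "(\<integral>\<^sup>+n. ennreal (r ^ n) \<partial>measure_pmf (poisson_pmf l)) =
      (\<integral>\<^sup>+n. ennreal (pmf (poisson_pmf l) n * r ^ n) \<partial>count_space UNIV)"
    by (subst nn_integral_measure_pmf) (simp add: ennreal_mult' r)
  also have "\<dots> = (\<Sum>n. ennreal (pmf (poisson_pmf l) n * r ^ n))" by (rule nn_integral_count_space_nat)
  also have "\<dots> = ennreal (\<Sum>n. pmf (poisson_pmf l) n * r ^ n)"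
    using sums r by (intro suminf_ennreal2) (auto simp: sums_iff simp del: pmf_poisson)
  also have "(\<Sum>n. pmf (poisson_pmf l) n * r ^ n) = exp (l * (r - 1))"
    using sums by (simp add: sums_iff exp_add[symmetric] algebra_simps)
  finally show ?thesis .
qed

text \<open>
  The mixture of the convolution powers of \<open>Q\<close> with Poisson weights; each asserted property holds for the
  powers and is averaged over the Poisson distribution.
\<close>
lemma compound_poisson_normalized:
  assumes Q: "real_distribution Q" and l: "0 < l"
  obtains P where "real_distribution P" "\<And>z. char P z = exp (of_real l * (char Q z - 1))"
    "exp (- l) \<le> measure P {0}"
    "emeasure Q {..<0} = 0 \<Longrightarrow> emeasure P {..<0} = 0"
    "\<And>a r. 0 \<le> r \<Longrightarrow> (\<integral>\<^sup>+x. ennreal (exp (a * x)) \<partial>Q) \<le> ennreal r \<Longrightarrow>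
      (\<integral>\<^sup>+x. ennreal (exp (a * x)) \<partial>P) \<le> ennreal (exp (l * (r - 1)))"
proof -
  interpret Q: real_distribution Q by (fact Q)
  define S where "S n = ((convolution Q) ^^ n) (return borel 0)" for n
  have ret: "real_distribution (return borel (0::real))"
    by (simp add: real_distribution_def real_distribution_axioms_def prob_space_return)
  have S0: "S 0 = return borel 0" and SS: "S (Suc n) = (Q \<star> S n)" for n by (simp_all add: S_def)
  have Sd: "real_distribution (S n)" for n
    by (induction n) (simp_all add: S0 SS ret real_distribution_convolution Q)
  have Sfin: "finite_measure (S n)" "sets (S n) = sets borel" for n
    using Sd[of n] by (auto simp: real_distribution_def real_distribution_axioms_def prob_space.finite_measure prob_space_def)
  have Schar: "char (S n) z = char Q z ^ n" for n z
  proof (induction n)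
    case 0
    show ?case unfolding S0 char_def by (subst integral_return) auto
  next
    case (Suc n)
    then show ?case by (simp add: SS char_convolution Q Sd)
  qed
  have Smgf: "(\<integral>\<^sup>+x. ennreal (exp (a * x)) \<partial>S n) \<le> ennreal (r ^ n)"
    if r: "0 \<le> r" "(\<integral>\<^sup>+x. ennreal (exp (a * x)) \<partial>Q) \<le> ennreal r" for a r n
  proof (induction n)
    case 0
    show ?case unfolding S0 by (subst nn_integral_return) auto
  next
    case (Suc n)
    have "(\<integral>\<^sup>+x. ennreal (exp (a * x)) \<partial>S (Suc n)) =
        (\<integral>\<^sup>+x. (\<integral>\<^sup>+y. ennreal (exp (a * (x + y))) \<partial>S n) \<partial>Q)"
      unfolding SS using Sfin Q.finite_measure_axioms by (intro nn_integral_convolution) auto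
    also have "\<dots> = (\<integral>\<^sup>+x. ennreal (exp (a * x)) * (\<integral>\<^sup>+y. ennreal (exp (a * y)) \<partial>S n) \<partial>Q)"
    proof (intro nn_integral_cong)
      fix x
      have "(\<integral>\<^sup>+y. ennreal (exp (a * (x + y))) \<partial>S n) = (\<integral>\<^sup>+y. ennreal (exp (a * x)) * ennreal (exp (a * y)) \<partial>S n)"
        by (intro nn_integral_cong) (simp add: ennreal_mult[symmetric] exp_add[symmetric] algebra_simps)
      also have "\<dots> = ennreal (exp (a * x)) * (\<integral>\<^sup>+y. ennreal (exp (a * y)) \<partial>S n)"
        by (intro nn_integral_cmult) (simp add: measurable_cong_sets[OF Sfin(2) refl])
      finally show "(\<integral>\<^sup>+y. ennreal (exp (a * (x + y))) \<partial>S n) = ennreal (exp (a * x)) * (\<integral>\<^sup>+y. ennreal (exp (a * y)) \<partial>S n)" .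
    qed
    also have "\<dots> = (\<integral>\<^sup>+x. ennreal (exp (a * x)) \<partial>Q) * (\<integral>\<^sup>+y. ennreal (exp (a * y)) \<partial>S n)"
      by (intro nn_integral_multc) auto
    also have "\<dots> \<le> ennreal r * ennreal (r ^ n)" by (intro mult_mono r Suc) auto
    also have "\<dots> = ennreal (r ^ Suc n)" using r by (simp add: ennreal_mult)
    finally show ?case .
  qed
  have Sneg: "emeasure (S n) {..<0} = 0" if neg: "emeasure Q {..<0} = 0" for n
  proof (induction n)
    case 0
    show ?case unfolding S0 by (simp add: emeasure_return)
  next
    case (Suc n)
    have "emeasure (S (Suc n)) {..<0} = (\<integral>\<^sup>+x. (\<integral>\<^sup>+y. indicator {..<0} (x + y) \<partial>S n) \<partial>Q)"
      unfolding SS using Sfin Q.finite_measure_axioms by (intro convolution_emeasure') auto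
    also have "\<dots> = (\<integral>\<^sup>+x. 0 \<partial>Q)"
    proof (rule nn_integral_cong_AE)
      have "AE x in Q. x \<notin> {..<0}" using neg by (intro AE_not_in) (auto simp: null_sets_def)
      then show "AE x in Q. (\<integral>\<^sup>+y. indicator {..<0} (x + y) \<partial>S n) = 0"
      proof eventually_elim
        case (elim x)
        have "AE y in S n. y \<notin> {..<0}" using Suc Sfin by (intro AE_not_in) (auto simp: null_sets_def)
        then have "AE y in S n. indicator {..<0} (x + y) = (0::ennreal)"
          by eventually_elim (use elim in auto)
        then have "(\<integral>\<^sup>+y. indicator {..<0} (x + y) \<partial>S n) = (\<integral>\<^sup>+y. 0 \<partial>S n)" by (rule nn_integral_cong_AE)
        then show ?case by simp
      qed
    qed
    finally show ?case by simp
  qed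
  define D where "D = measure_pmf (poisson_pmf l)"
  have D: "prob_space D" unfolding D_def by (rule prob_space_measure_pmf)
  have Sm: "S \<in> measurable D (prob_algebra borel)"
    unfolding D_def using Sd Sfin
    by (auto simp: space_prob_algebra real_distribution_def measurable_def sets_measure_pmf)
  define P where "P = D \<bind> S"
  have D': "D \<in> space (prob_algebra D)" by (simp add: space_prob_algebra D)
  have Pd: "real_distribution P"
    unfolding P_def real_distribution_def real_distribution_axioms_def
    using prob_space_bind'[OF D' Sm] sets_bind'[OF D' Sm] by simp
  have Pchar: "char P z = exp (of_real l * (char Q z - 1))" for z
  proof -
    have "char P z = (\<integral>n. (\<integral>x. iexp (z * x) \<partial>S n) \<partial>D)"
      unfolding char_def P_def by (rule integral_bind_complex[OF D Sm, where B=1]) auto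
    also have "\<dots> = (\<integral>n. char Q z ^ n \<partial>D)" unfolding char_def[symmetric] Schar ..
    also have "\<dots> = exp (of_real l * (char Q z - 1))"
      unfolding D_def by (rule poisson_power_integral[OF l Q.cmod_char_le_1])
    finally show ?thesis .
  qed
  have nnP: "(\<integral>\<^sup>+x. f x \<partial>P) = (\<integral>\<^sup>+n. (\<integral>\<^sup>+x. f x \<partial>S n) \<partial>D)" if "f \<in> borel_measurable borel" for f
    unfolding P_def by (rule nn_integral_bind[OF that measurable_prob_algebraD[OF Sm]])
  have emP: "emeasure P A = (\<integral>\<^sup>+n. emeasure (S n) A \<partial>D)" if "A \<in> sets borel" for A
    using nnP[of "indicator A"] that Sfin Pd by (simp add: real_distribution_def real_distribution_axioms_def)
  show ?thesis
  proof (rule that[OF Pd Pchar])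
    interpret P: real_distribution P by (fact Pd)
    have "ennreal (exp (- l)) = ennreal (pmf (poisson_pmf l) 0)" using l by simp
    also have "\<dots> = emeasure D {0}" unfolding D_def by (simp add: emeasure_pmf_single)
    also have "\<dots> = (\<integral>\<^sup>+n. indicator {0} n \<partial>D)" unfolding D_def by simp
    also have "\<dots> \<le> (\<integral>\<^sup>+n. emeasure (S n) {0} \<partial>D)"
      by (intro nn_integral_mono) (auto simp: S0 emeasure_return split: split_indicator)
    also have "\<dots> = emeasure P {0}" by (simp add: emP)
    finally show "exp (- l) \<le> measure P {0}" by (simp add: P.emeasure_eq_measure)
    show "emeasure P {..<0} = 0" if "emeasure Q {..<0} = 0" using Sneg[OF that] by (simp add: emP)
    show "(\<integral>\<^sup>+x. ennreal (exp (a * x)) \<partial>P) \<le> ennreal (exp (l * (r - 1)))"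
      if "0 \<le> r" "(\<integral>\<^sup>+x. ennreal (exp (a * x)) \<partial>Q) \<le> ennreal r" for a r
    proof -
      have "(\<integral>\<^sup>+x. ennreal (exp (a * x)) \<partial>P) \<le> (\<integral>\<^sup>+n. ennreal (r ^ n) \<partial>D)"
        using Smgf[OF that] by (subst nnP) (auto intro: nn_integral_mono)
      also have "\<dots> = ennreal (exp (l * (r - 1)))" unfolding D_def by (rule poisson_power_nn_integral[OF l that(1)])
      finally show ?thesis .
    qed
  qed
qed

lemma compound_poisson_exists:
  fixes N :: "real measure"
  assumes fin: "finite_measure N" and sN: "sets N = sets borel" and neg: "emeasure N {..<0} = 0"
  obtains P where "real_distribution P"
    "\<And>z. char P z = exp (CLINT x|N. iexp (z * x) - 1)"
    "exp (- measure N UNIV) \<le> measure P {0}" "emeasure P {..<0} = 0"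
    "\<And>a K. 0 \<le> a \<Longrightarrow> 0 \<le> K \<Longrightarrow> (\<integral>\<^sup>+x. ennreal (exp (a * x) - 1) \<partial>N) \<le> ennreal K \<Longrightarrow>
      (\<integral>\<^sup>+x. ennreal (exp (a * x)) \<partial>P) \<le> ennreal (exp K)"
proof (cases "measure N UNIV = 0")
  case True
  interpret N: finite_measure N by (fact fin)
  have sp: "space N = UNIV" using sets_eq_imp_space_eq[OF sN] by simp
  have z: "emeasure N UNIV = 0" using True by (simp add: N.emeasure_eq_measure)
  have "AE x in N. False" by (rule AE_I[of _ _ UNIV]) (use z sp sets.top[of N] in auto)
  then have "(CLINT x|N. iexp (z * x) - 1) = (CLINT x|N. 0)" for z
    by (intro integral_cong_AE) (auto simp: measurable_cong_sets[OF sN refl])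
  then have c: "(CLINT x|N. iexp (z * x) - 1) = 0" for z by simp
  show ?thesis
  proof (rule that[of "return borel 0"])
    show "real_distribution (return borel (0::real))"
      by (simp add: real_distribution_def real_distribution_axioms_def prob_space_return)
    show "char (return borel 0) z = exp (CLINT x|N. iexp (z * x) - 1)" for z
      unfolding c char_def by (subst integral_return) auto
    show "exp (- measure N UNIV) \<le> measure (return borel 0) {0::real}"
      using True by (simp add: measure_return)
    show "emeasure (return borel 0) {..<0::real} = 0" by (simp add: emeasure_return)
    show "(\<integral>\<^sup>+x. ennreal (exp (a * x)) \<partial>return borel 0) \<le> ennreal (exp K)" if "0 \<le> K" for a K
      using that by (subst nn_integral_return) (auto simp flip: ennreal_1 intro!: ennreal_leI)
  qed
next
  case False
  interpret N: finite_measure N by (fact fin)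
  have sp: "space N = UNIV" using sets_eq_imp_space_eq[OF sN] by simp
  note mN = measurable_cong_sets[OF sN refl]
  define l where "l = measure N UNIV"
  have l: "0 < l" using False by (simp add: l_def less_le)
  have eN: "emeasure N UNIV = ennreal l" unfolding l_def by (rule N.emeasure_eq_measure)
  define Q where "Q = density N (\<lambda>_. ennreal (1 / l))"
  have Q: "real_distribution Q"
  proof -
    have "emeasure Q UNIV = ennreal (1 / l) * emeasure N UNIV"
      by (simp add: Q_def emeasure_density sN sp)
    then have "emeasure Q UNIV = 1" using l eN by (simp add: ennreal_mult[symmetric])
    then show ?thesis
      unfolding real_distribution_def real_distribution_axioms_def
      by (auto simp: Q_def sN sp intro!: prob_spaceI)
  qed
  obtain P where P: "real_distribution P" "\<And>z. char P z = exp (of_real l * (char Q z - 1))"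
    "exp (- l) \<le> measure P {0}"
    "emeasure Q {..<0} = 0 \<Longrightarrow> emeasure P {..<0} = 0"
    "\<And>a r. 0 \<le> r \<Longrightarrow> (\<integral>\<^sup>+x. ennreal (exp (a * x)) \<partial>Q) \<le> ennreal r \<Longrightarrow>
      (\<integral>\<^sup>+x. ennreal (exp (a * x)) \<partial>P) \<le> ennreal (exp (l * (r - 1)))"
    using compound_poisson_normalized[OF Q l] by blast
  show ?thesis
  proof (rule that[OF P(1)])
    fix z
    have m: "(\<lambda>x. iexp (z * x)) \<in> borel_measurable N" unfolding mN by measurable
    have int: "integrable N (\<lambda>x. iexp (z * x))" by (rule N.integrable_const_bound[OF _ m, of 1]) simp
    have "char Q z = (CLINT x|N. (1 / l) *\<^sub>R iexp (z * x))"
      unfolding char_def Q_def using m l by (intro integral_density) auto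
    also have "\<dots> = (CLINT x|N. iexp (z * x)) / l" by (simp add: scaleR_conv_of_real)
    finally have "of_real l * (char Q z - 1) = (CLINT x|N. iexp (z * x)) - l"
      using l by (simp add: field_simps)
    also have "\<dots> = (CLINT x|N. iexp (z * x) - 1)" using int by (simp add: sp l_def scaleR_conv_of_real)
    finally show "char P z = exp (CLINT x|N. iexp (z * x) - 1)" using P(2) by simp
  next
    show "exp (- measure N UNIV) \<le> measure P {0}" using P(3) by (simp add: l_def)
    have AEN: "AE x in N. x \<notin> {..<0}" using neg sN by (intro AE_not_in) (auto simp: null_sets_def)
    have "emeasure Q {..<0} = (\<integral>\<^sup>+x. ennreal (1 / l) * indicator {..<0} x \<partial>N)"
      unfolding Q_def by (rule emeasure_density) (auto simp: sN)
    also have "\<dots> = ennreal (1 / l) * emeasure N {..<0}" by (rule nn_integral_cmult_indicator) (simp add: sN)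
    finally show "emeasure P {..<0} = 0" using P(4) neg by simp
    fix a K :: real assume a: "0 \<le> a" and K: "0 \<le> K" and le: "(\<integral>\<^sup>+x. ennreal (exp (a * x) - 1) \<partial>N) \<le> ennreal K"
    have "(\<integral>\<^sup>+x. ennreal (exp (a * x)) \<partial>Q) = (\<integral>\<^sup>+x. ennreal (1 / l) * ennreal (exp (a * x)) \<partial>N)"
      unfolding Q_def by (rule nn_integral_density) (auto simp: mN)
    also have "\<dots> = ennreal (1 / l) * (\<integral>\<^sup>+x. ennreal (exp (a * x)) \<partial>N)" by (rule nn_integral_cmult) (simp add: mN)
    also have "(\<integral>\<^sup>+x. ennreal (exp (a * x)) \<partial>N) = (\<integral>\<^sup>+x. 1 + ennreal (exp (a * x) - 1) \<partial>N)"
    proof (rule nn_integral_cong_AE)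
      show "AE x in N. ennreal (exp (a * x)) = 1 + ennreal (exp (a * x) - 1)"
        using AEN
      proof eventually_elim
        case (elim x)
        then have "0 \<le> exp (a * x) - 1" using a by simp
        then have "ennreal (1 + (exp (a * x) - 1)) = ennreal 1 + ennreal (exp (a * x) - 1)" by (intro ennreal_plus) auto
        then show ?case by simp
      qed
    qed
    also have "\<dots> = ennreal l + (\<integral>\<^sup>+x. ennreal (exp (a * x) - 1) \<partial>N)"
      by (subst nn_integral_add) (auto simp: mN sp eN)
    also have "ennreal (1 / l) * \<dots> \<le> ennreal (1 / l) * (ennreal l + ennreal K)"
      using le by (intro mult_left_mono add_left_mono) auto
    also have "\<dots> = ennreal (1 / l * (l + K))" using l K by (simp only: ennreal_plus ennreal_mult less_imp_le add_nonneg_nonneg divide_nonneg_nonneg zero_le_one)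
    finally have "(\<integral>\<^sup>+x. ennreal (exp (a * x)) \<partial>Q) \<le> ennreal (1 / l * (l + K))" .
    then have "(\<integral>\<^sup>+x. ennreal (exp (a * x)) \<partial>P) \<le> ennreal (exp (l * (1 / l * (l + K) - 1)))"
      using l K by (intro P(5)) auto
    also have "l * (1 / l * (l + K) - 1) = K" using l by (simp add: field_simps)
    finally show "(\<integral>\<^sup>+x. ennreal (exp (a * x)) \<partial>P) \<le> ennreal (exp K)" .
  qed
qed

section \<open>Distributions of small and of large jumps\<close>

lemma exp_moment_tail:
  assumes M: "real_distribution M" and a: "0 \<le> a" and le: "(\<integral>\<^sup>+x. ennreal (exp (a * x)) \<partial>M) \<le> ennreal B" and B: "0 \<le> B"
  shows "measure M {b<..} \<le> B * exp (- a * b)"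
proof -
  interpret M: real_distribution M by (fact M)
  have "ennreal (measure M {b<..}) = (\<integral>\<^sup>+x. indicator {b<..} x \<partial>M)" by (simp add: M.emeasure_eq_measure)
  also have "\<dots> \<le> (\<integral>\<^sup>+x. ennreal (exp (- a * b)) * ennreal (exp (a * x)) \<partial>M)"
  proof (rule nn_integral_mono)
    fix x
    have "1 \<le> exp (- a * b) * exp (a * x)" if "b < x"
      using that a by (simp add: exp_add[symmetric] mult_left_mono)
    then show "indicator {b<..} x \<le> ennreal (exp (- a * b)) * ennreal (exp (a * x))"
      by (auto split: split_indicator simp: ennreal_mult[symmetric] simp flip: ennreal_1 intro!: ennreal_leI)
  qed
  also have "\<dots> = ennreal (exp (- a * b)) * (\<integral>\<^sup>+x. ennreal (exp (a * x)) \<partial>M)" by (rule nn_integral_cmult) simp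
  also have "\<dots> \<le> ennreal (exp (- a * b)) * ennreal B" by (intro mult_left_mono le) auto
  also have "\<dots> = ennreal (B * exp (- a * b))" using B by (simp add: ennreal_mult[symmetric] mult.commute)
  finally show ?thesis using B by (simp add: ennreal_le_iff)
qed

text \<open>
  Bounded exponential moments give tightness, so Helly's theorem provides a weak limit along a
  subsequence, and its characteristic function is \<open>\<phi>\<close>. The remaining properties pass to the limit
  through bounded continuous test functions: truncations of the negative part and of the exponential.
\<close>
lemma limit_distribution_exp_moments:
  fixes P :: "nat \<Rightarrow> real measure" and B :: "real \<Rightarrow> real"
  assumes P: "\<And>k. real_distribution (P k)" and neg: "\<And>k. emeasure (P k) {..<0} = 0"
    and mgf: "\<And>k a. 0 \<le> a \<Longrightarrow> (\<integral>\<^sup>+x. ennreal (exp (a * x)) \<partial>P k) \<le> ennreal (B a)"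
    and B: "\<And>a. 0 \<le> B a"
    and lim: "\<And>z. (\<lambda>k. char (P k) z) \<longlonglongrightarrow> \<phi> z"
  obtains M where "real_distribution M" "char M = \<phi>" "emeasure M {..<0} = 0"
    "\<And>a. 0 \<le> a \<Longrightarrow> (\<integral>\<^sup>+x. ennreal (exp (a * x)) \<partial>M) \<le> ennreal (B a)"
proof -
  interpret P: real_distribution "P k" for k by (rule P)
  have "tight P"
    unfolding tight_def
  proof (intro conjI allI impI P)
    fix e :: real assume e: "0 < e"
    have "((\<lambda>b. B 1 * exp (- b)) \<longlongrightarrow> B 1 * 0) at_top"
      by (intro tendsto_intros filterlim_compose[OF exp_at_bot filterlim_uminus_at_bot_at_top])
    then have "\<forall>\<^sub>F b in at_top. B 1 * exp (- b) < e" using e by (auto dest: order_tendstoD(2))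
    with eventually_ge_at_top[of 0] have "\<forall>\<^sub>F b in at_top. 0 \<le> b \<and> B 1 * exp (- b) < e" by eventually_elim simp
    then obtain b where b: "0 \<le> b" "B 1 * exp (- b) < e" unfolding eventually_at_top_linorder by blast
    show "\<exists>a b. a < b \<and> (\<forall>n. 1 - e < measure (P n) {a<..b})"
    proof (rule exI[of _ "-1"], rule exI[of _ b], intro conjI allI)
      show "-1 < b" using b by simp
      fix n
      have "measure (P n) {b<..} \<le> B 1 * exp (- 1 * b)" by (rule exp_moment_tail[OF P _ mgf B]) auto
      moreover have "measure (P n) {..-1} \<le> measure (P n) {..<0}" by (intro P.finite_measure_mono) auto
      moreover have "measure (P n) {..<0} = 0" using neg by (simp add: P.emeasure_eq_measure)
      moreover have "1 \<le> measure (P n) {-1<..b} + (measure (P n) {..-1} + measure (P n) {b<..})"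
      proof -
        have "1 = measure (P n) UNIV" using P.prob_space[of n] by simp
        also have "(UNIV :: real set) = {-1<..b} \<union> ({..-1} \<union> {b<..})" by auto
        also have "measure (P n) \<dots> \<le> measure (P n) {-1<..b} + measure (P n) ({..-1} \<union> {b<..})"
          by (rule measure_Un_le) auto
        also have "\<dots> \<le> measure (P n) {-1<..b} + (measure (P n) {..-1} + measure (P n) {b<..})"
          by (intro add_left_mono measure_Un_le) auto
        finally show ?thesis .
      qed
      ultimately show "1 - e < measure (P n) {-1<..b}" using b by simp
    qed
  qed
  from tight_imp_convergent_subsubsequence[OF this strict_mono_id]
  obtain r M where r: "strict_mono r" and M: "real_distribution M" and conv: "weak_conv_m (P \<circ> id \<circ> r) M" by blast
  interpret M: real_distribution M by (fact M)
  have conv': "weak_conv_m (\<lambda>n. P (r n)) M" using conv by (simp add: o_def)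
  have "char M z = \<phi> z" for z
    using LIMSEQ_unique[OF levy_continuity1[OF P M conv'] LIMSEQ_subseq_LIMSEQ[OF lim r, unfolded o_def]] .
  then have char: "char M = \<phi>" by auto
  note conv_int = weak_conv_imp_integral_bdd_continuous_conv[OF P M conv']
  have AEP: "AE x in P k. 0 \<le> x" for k
  proof -
    have "AE x in P k. x \<notin> {..<0}" using neg by (intro AE_not_in) (auto simp: null_sets_def)
    then show ?thesis by eventually_elim auto
  qed
  have negM: "emeasure M {..<0} = 0"
  proof -
    let ?f = "\<lambda>x::real. min 1 (max 0 (- x))"
    have "(\<lambda>n. \<integral>x. ?f x \<partial>P (r n)) \<longlonglongrightarrow> (\<integral>x. ?f x \<partial>M)"
      by (rule conv_int[where B=1]) (auto intro!: continuous_intros)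
    moreover have "(\<integral>x. ?f x \<partial>P k) = (\<integral>x. 0 \<partial>P k)" for k
      using AEP[of k] by (intro integral_cong_AE) (auto elim!: eventually_mono)
    ultimately have "(\<integral>x. ?f x \<partial>M) = 0" by (simp add: LIMSEQ_const_iff)
    moreover have "integrable M ?f" by (rule M.integrable_const_bound[where B=1]) auto
    ultimately have "AE x in M. ?f x = 0" by (subst (asm) integral_nonneg_eq_0_iff_AE) auto
    then have "AE x in M. x \<notin> {..<0}" by eventually_elim (auto simp: min_def max_def split: if_splits)
    then show ?thesis by (subst (asm) AE_iff_measurable[of "{..<0}"]) auto
  qed
  have mgfM: "(\<integral>\<^sup>+x. ennreal (exp (a * x)) \<partial>M) \<le> ennreal (B a)" if a: "0 \<le> a" for a
  proof -
    have trunc: "(\<integral>\<^sup>+x. ennreal (min (exp (a * x)) (real L)) \<partial>M) \<le> ennreal (B a)" for L :: nat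
    proof -
      let ?f = "\<lambda>x. min (exp (a * x)) (real L)"
      have "(\<lambda>n. \<integral>x. ?f x \<partial>P (r n)) \<longlonglongrightarrow> (\<integral>x. ?f x \<partial>M)"
        by (rule conv_int[where B="real L"]) (auto intro!: continuous_intros)
      moreover have "(\<integral>x. ?f x \<partial>P k) \<le> B a" for k
      proof -
        have "ennreal (\<integral>x. ?f x \<partial>P k) = (\<integral>\<^sup>+x. ennreal (?f x) \<partial>P k)"
          by (intro nn_integral_eq_integral[symmetric] P.integrable_const_bound[where B="real L"]) auto
        also have "\<dots> \<le> (\<integral>\<^sup>+x. ennreal (exp (a * x)) \<partial>P k)" by (intro nn_integral_mono ennreal_leI) auto
        also have "\<dots> \<le> ennreal (B a)" by (rule mgf[OF a])
        finally show ?thesis using B by (simp add: ennreal_le_iff)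
      qed
      ultimately have "(\<integral>x. ?f x \<partial>M) \<le> B a" by (intro LIMSEQ_le_const2) auto
      moreover have "(\<integral>\<^sup>+x. ennreal (?f x) \<partial>M) = ennreal (\<integral>x. ?f x \<partial>M)"
        by (intro nn_integral_eq_integral M.integrable_const_bound[where B="real L"]) auto
      ultimately show ?thesis by (simp add: ennreal_leI)
    qed
    have "(\<integral>\<^sup>+x. ennreal (exp (a * x)) \<partial>M) = (\<integral>\<^sup>+x. (SUP L::nat. ennreal (min (exp (a * x)) (real L))) \<partial>M)"
    proof (rule nn_integral_cong)
      fix x
      obtain n :: nat where n: "exp (a * x) \<le> real n" using real_arch_simple by blast
      show "ennreal (exp (a * x)) = (SUP L::nat. ennreal (min (exp (a * x)) (real L)))"
      proof (rule antisym)
        show "ennreal (exp (a * x)) \<le> (SUP L::nat. ennreal (min (exp (a * x)) (real L)))"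
          using n by (intro SUP_upper2[of n]) (auto simp: min_absorb1)
        show "(SUP L::nat. ennreal (min (exp (a * x)) (real L))) \<le> ennreal (exp (a * x))"
          by (intro SUP_least ennreal_leI) auto
      qed
    qed
    also have "\<dots> = (SUP L::nat. \<integral>\<^sup>+x. ennreal (min (exp (a * x)) (real L)) \<partial>M)"
      by (intro nn_integral_monotone_convergence_SUP) (auto simp: incseq_def le_fun_def intro!: ennreal_leI)
    also have "\<dots> \<le> ennreal (B a)" by (intro SUP_least trunc)
    finally show ?thesis .
  qed
  show ?thesis by (rule that[OF M char negM mgfM])
qed

locale levy_measure =
  fixes \<nu> :: "real measure"
  assumes levy: "levy_measure_nonneg \<nu>"
begin

lemma sets_\<nu> [simp, measurable_cong]: "sets \<nu> = sets borel"
  using levy by (simp add: levy_measure_nonneg_def)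

lemma space_\<nu> [simp]: "space \<nu> = UNIV"
  using sets_eq_imp_space_eq[OF sets_\<nu>] by simp

lemma AE_\<nu>_pos: "AE x in \<nu>. 0 < x"
proof -
  have "{..<0} \<in> null_sets \<nu>" "{0} \<in> null_sets \<nu>"
    using levy by (auto simp: levy_measure_nonneg_def null_sets_def)
  from this[THEN AE_not_in] show ?thesis by eventually_elim auto
qed

lemma \<nu>_min: "(\<integral>\<^sup>+x. ennreal (min 1 x) \<partial>\<nu>) < \<infinity>"
  using levy by (simp add: levy_measure_nonneg_def)

lemma integrable_dominated:
  fixes f :: "real \<Rightarrow> 'b::{banach, second_countable_topology}"
  assumes [measurable]: "f \<in> borel_measurable borel" and C: "\<And>x. 0 < x \<Longrightarrow> norm (f x) \<le> C * min 1 x" "0 \<le> C"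
  shows "integrable \<nu> f"
proof (rule integrableI_bounded)
  have "(\<integral>\<^sup>+x. ennreal (norm (f x)) \<partial>\<nu>) \<le> (\<integral>\<^sup>+x. ennreal C * ennreal (min 1 x) \<partial>\<nu>)"
  proof (rule nn_integral_mono_AE)
    show "AE x in \<nu>. ennreal (norm (f x)) \<le> ennreal C * ennreal (min 1 x)"
      using AE_\<nu>_pos
    proof eventually_elim
      case (elim x)
      then show ?case using C by (simp add: ennreal_mult[symmetric] ennreal_leI)
    qed
  qed
  also have "\<dots> = ennreal C * (\<integral>\<^sup>+x. ennreal (min 1 x) \<partial>\<nu>)" by (rule nn_integral_cmult) measurable
  also have "\<dots> < \<infinity>" using \<nu>_min by (simp add: ennreal_mult_less_top)
  finally show "(\<integral>\<^sup>+x. ennreal (norm (f x)) \<partial>\<nu>) < \<infinity>" .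
qed measurable

lemma iexp_minus_one_bound:
  assumes "0 < x"
  shows "norm (iexp (z * x) - 1) \<le> (2 + \<bar>z\<bar>) * min 1 x"
proof -
  have 1: "norm (iexp (z * x) - 1) \<le> \<bar>z\<bar> * x"
    using iexp_approx1[of "z * x" 0] assms by (simp add: abs_mult)
  have 2: "norm (iexp (z * x) - 1) \<le> 2"
    by (rule order_trans[OF norm_triangle_ineq4]) simp
  show ?thesis
  proof (cases "x \<le> 1")
    case True
    have "\<bar>z\<bar> * x \<le> (2 + \<bar>z\<bar>) * x" using assms by (intro mult_right_mono) auto
    then show ?thesis using 1 True by simp
  next
    case False
    then show ?thesis using 2 by simp
  qed
qed

definition part :: "real set \<Rightarrow> real \<Rightarrow> real measure" where
  "part S t = density \<nu> (\<lambda>x. ennreal (t * indicator S x))"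

text \<open>
  The part of the Levy exponent that is due to jumps in \<open>S\<close>.
\<close>
definition part_exponent :: "real set \<Rightarrow> real \<Rightarrow> complex" where
  "part_exponent S z = (CLINT x|\<nu>. indicator S x *\<^sub>R (iexp (z * x) - 1))"

lemma part_exponent_integrable: "S \<in> sets borel \<Longrightarrow> integrable \<nu> (\<lambda>x. indicator S x *\<^sub>R (iexp (z * x) - 1))"
proof (rule integrable_dominated[where C="2 + \<bar>z\<bar>"])
  assume [measurable]: "S \<in> sets borel"
  show "(\<lambda>x. indicator S x *\<^sub>R (iexp (z * x) - 1)) \<in> borel_measurable borel" by measurable
  show "norm (indicator S x *\<^sub>R (iexp (z * x) - 1)) \<le> (2 + \<bar>z\<bar>) * min 1 x" if "0 < x" for x
    using iexp_minus_one_bound[OF that, of z] that by (auto split: split_indicator)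
qed auto

lemma part_exponent_add:
  assumes "S \<in> sets borel" "T \<in> sets borel" "S \<inter> T = {}"
  shows "part_exponent (S \<union> T) z = part_exponent S z + part_exponent T z"
proof -
  have "part_exponent (S \<union> T) z =
     (CLINT x|\<nu>. indicator S x *\<^sub>R (iexp (z * x) - 1) + indicator T x *\<^sub>R (iexp (z * x) - 1))"
    unfolding part_exponent_def using assms(3)
    by (intro Bochner_Integration.integral_cong) (auto split: split_indicator)
  then show ?thesis unfolding part_exponent_def using part_exponent_integrable assms by simp
qed

lemma part_exponent_pos: "part_exponent {0<..} z = (CLINT x|\<nu>. iexp (z * x) - 1)"
  unfolding part_exponent_def using AE_\<nu>_pos
  by (intro integral_cong_AE) (auto elim!: eventually_mono)

lemma sets_part [simp]: "sets (part S t) = sets borel"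
  by (simp add: part_def)

lemma integral_part:
  assumes [measurable]: "S \<in> sets borel" and t: "0 \<le> t"
  shows "(CLINT x|part S t. iexp (z * x) - 1) = of_real t * part_exponent S z"
proof -
  have "(CLINT x|part S t. iexp (z * x) - 1) = (CLINT x|\<nu>. (t * indicator S x) *\<^sub>R (iexp (z * x) - 1))"
    unfolding part_def using t by (intro integral_density) auto
  also have "\<dots> = (CLINT x|\<nu>. of_real t * (indicator S x *\<^sub>R (iexp (z * x) - 1)))"
    by (intro Bochner_Integration.integral_cong) (auto simp: scaleR_conv_of_real)
  also have "\<dots> = of_real t * part_exponent S z"
    unfolding part_exponent_def by (rule integral_mult_right_zero)
  finally show ?thesis .
qed

lemma emeasure_part_neg:
  assumes [measurable]: "S \<in> sets borel"
  shows "emeasure (part S t) {..<0} = 0"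
proof -
  have "emeasure (part S t) {..<0} = (\<integral>\<^sup>+x. ennreal (t * indicator S x) * indicator {..<0} x \<partial>\<nu>)"
    unfolding part_def by (rule emeasure_density) auto
  also have "\<dots> = (\<integral>\<^sup>+x. 0 \<partial>\<nu>)" using AE_\<nu>_pos by (intro nn_integral_cong_AE) (auto elim!: eventually_mono)
  finally show ?thesis by simp
qed

lemma emeasure_above: 
  assumes "0 < \<epsilon>" "S \<in> sets borel" "S \<subseteq> {\<epsilon><..}"
  shows "emeasure \<nu> S < \<infinity>"
proof -
  have "emeasure \<nu> S = (\<integral>\<^sup>+x. indicator S x \<partial>\<nu>)" using assms by simp
  also have "\<dots> \<le> (\<integral>\<^sup>+x. ennreal (1 / min 1 \<epsilon>) * ennreal (min 1 x) \<partial>\<nu>)"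
  proof (rule nn_integral_mono)
    fix x
    have "1 \<le> 1 / min 1 \<epsilon> * min 1 x" if "x \<in> S" using that assms by (auto simp: field_simps min_def)
    then show "indicator S x \<le> ennreal (1 / min 1 \<epsilon>) * ennreal (min 1 x)"
      using assms by (auto split: split_indicator simp: ennreal_mult'[symmetric] simp flip: ennreal_1 intro!: ennreal_leI)
  qed
  also have "\<dots> = ennreal (1 / min 1 \<epsilon>) * (\<integral>\<^sup>+x. ennreal (min 1 x) \<partial>\<nu>)" by (rule nn_integral_cmult) measurable
  also have "\<dots> < \<infinity>" using \<nu>_min by (simp add: ennreal_mult_less_top)
  finally show ?thesis .
qed

lemma emeasure_part:
  assumes [measurable]: "S \<in> sets borel" and t: "0 \<le> t"
  shows "emeasure (part S t) UNIV = ennreal t * emeasure \<nu> S"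
proof -
  have "emeasure (part S t) UNIV = (\<integral>\<^sup>+x. ennreal (t * indicator S x) * indicator UNIV x \<partial>\<nu>)"
    unfolding part_def by (rule emeasure_density) auto
  also have "\<dots> = (\<integral>\<^sup>+x. ennreal t * indicator S x \<partial>\<nu>)"
    using t by (intro nn_integral_cong) (auto split: split_indicator)
  finally show ?thesis by (simp add: nn_integral_cmult_indicator)
qed

text \<open>
  The logarithm of the exponential moment of order \<open>a\<close>, per unit of time, of the jumps of size at
  most \<open>\<epsilon>\<close>.
\<close>
definition exp_rate :: "real \<Rightarrow> real \<Rightarrow> ennreal" where
  "exp_rate a \<epsilon> = (\<integral>\<^sup>+x. ennreal (exp (a * x) - 1) * indicator {0<..\<epsilon>} x \<partial>\<nu>)"

lemma exp_rate_bound: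
  fixes a \<epsilon> x :: real
  assumes a: "0 \<le> a" and \<epsilon>: "0 < \<epsilon>" and x: "x \<in> {0<..\<epsilon>}"
  shows "exp (a * x) - 1 \<le> (a * exp (a * \<epsilon>) * max 1 \<epsilon>) * min 1 x"
proof -
  have "1 - a * x \<le> exp (- (a * x))" using exp_ge_add_one_self[of "- (a * x)"] by simp
  then have "exp (a * x) * (1 - a * x) \<le> exp (a * x) * exp (- (a * x))" by (intro mult_left_mono) auto
  then have "exp (a * x) - 1 \<le> a * x * exp (a * x)" by (simp add: exp_add[symmetric] algebra_simps)
  also have "\<dots> \<le> a * x * exp (a * \<epsilon>)" using x a by (intro mult_left_mono) (auto intro: mult_left_mono)
  also have "\<dots> = a * exp (a * \<epsilon>) * x" by simp
  also have "\<dots> \<le> a * exp (a * \<epsilon>) * (max 1 \<epsilon> * min 1 x)"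
    using x a by (intro mult_left_mono) (auto simp: min_def max_def)
  finally show ?thesis by (simp add: mult.assoc)
qed

lemma exp_rate_finite:
  assumes a: "0 \<le> a" and \<epsilon>: "0 < \<epsilon>"
  shows "exp_rate a \<epsilon> < \<infinity>"
proof -
  let ?C = "a * exp (a * \<epsilon>) * max 1 \<epsilon>"
  have C: "0 \<le> ?C" using a by simp
  have "exp_rate a \<epsilon> \<le> (\<integral>\<^sup>+x. ennreal ?C * ennreal (min 1 x) \<partial>\<nu>)"
    unfolding exp_rate_def
  proof (rule nn_integral_mono)
    fix x
    show "ennreal (exp (a * x) - 1) * indicator {0<..\<epsilon>} x \<le> ennreal ?C * ennreal (min 1 x)"
    proof (cases "x \<in> {0<..\<epsilon>}")
      case True
      then show ?thesis using exp_rate_bound[OF a \<epsilon> True] C by (simp add: ennreal_mult'[symmetric] ennreal_leI)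
    qed simp
  qed
  also have "\<dots> = ennreal ?C * (\<integral>\<^sup>+x. ennreal (min 1 x) \<partial>\<nu>)" by (rule nn_integral_cmult) measurable
  also have "\<dots> < \<infinity>" using \<nu>_min by (simp add: ennreal_mult_less_top)
  finally show ?thesis .
qed

lemma exp_rate_small:
  assumes a: "0 \<le> a" and d: "0 < d"
  obtains \<epsilon> where "0 < \<epsilon>" "exp_rate a \<epsilon> \<le> ennreal d"
proof -
  let ?f = "\<lambda>n x. ennreal (exp (a * x) - 1) * indicator {0<..1 / real (Suc n)} x"
  have "(\<lambda>n. \<integral>\<^sup>+x. ?f n x \<partial>\<nu>) \<longlonglongrightarrow> (\<integral>\<^sup>+x. 0 \<partial>\<nu>)"
  proof (rule nn_integral_dominated_convergence[where w="\<lambda>x. ennreal (exp (a * x) - 1) * indicator {0<..1} x"])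
    show "(\<integral>\<^sup>+x. ennreal (exp (a * x) - 1) * indicator {0<..1} x \<partial>\<nu>) < \<infinity>"
      using exp_rate_finite[OF a zero_less_one] by (simp add: exp_rate_def)
    show "AE x in \<nu>. (\<lambda>n. ?f n x) \<longlonglongrightarrow> 0"
    proof (rule AE_I2)
      fix x :: real
      show "(\<lambda>n. ?f n x) \<longlonglongrightarrow> 0"
      proof (cases "0 < x")
        case True
        have "(\<lambda>n. 1 / real (Suc n)) \<longlonglongrightarrow> 0" by (rule LIMSEQ_Suc[OF lim_const_over_n])
        then have "\<forall>\<^sub>F n in sequentially. 1 / real (Suc n) < x" using True by (rule order_tendstoD(2))
        then have "\<forall>\<^sub>F n in sequentially. ?f n x = 0" by eventually_elim simp
        then show ?thesis by (rule tendsto_eventually)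
      qed simp
    qed
    show "AE x in \<nu>. ?f n x \<le> ennreal (exp (a * x) - 1) * indicator {0<..1} x" for n
    proof (rule AE_I2)
      fix x :: real
      have "1 / real (Suc n) \<le> 1" by simp
      then have "x \<in> {0<..1 / real (Suc n)} \<Longrightarrow> x \<in> {0<..1}" by (auto intro: order_trans simp del: of_nat_Suc)
      then show "?f n x \<le> ennreal (exp (a * x) - 1) * indicator {0<..1} x" by (simp add: indicator_def)
    qed
  qed measurable
  then have "(\<lambda>n. exp_rate a (1 / real (Suc n))) \<longlonglongrightarrow> 0" by (simp add: exp_rate_def)
  then have "\<forall>\<^sub>F n in sequentially. exp_rate a (1 / real (Suc n)) < ennreal d"
    by (rule order_tendstoD(2)) (simp add: d)
  then obtain n where "exp_rate a (1 / real (Suc n)) < ennreal d" unfolding eventually_sequentially by blast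
  then show ?thesis by (intro that[of "1 / real (Suc n)"]) auto
qed

lemma nn_integral_part_exp:
  assumes [measurable]: "S \<in> sets borel" and S: "S \<subseteq> {0<..\<epsilon>}" and t: "0 \<le> t"
  shows "(\<integral>\<^sup>+x. ennreal (exp (a * x) - 1) \<partial>part S t) \<le> ennreal t * exp_rate a \<epsilon>"
proof -
  have "(\<integral>\<^sup>+x. ennreal (exp (a * x) - 1) \<partial>part S t) = (\<integral>\<^sup>+x. ennreal (t * indicator S x) * ennreal (exp (a * x) - 1) \<partial>\<nu>)"
    unfolding part_def by (rule nn_integral_density) auto
  also have "\<dots> \<le> (\<integral>\<^sup>+x. ennreal t * (ennreal (exp (a * x) - 1) * indicator {0<..\<epsilon>} x) \<partial>\<nu>)"
    using S by (intro nn_integral_mono) (auto split: split_indicator)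
  also have "\<dots> = ennreal t * exp_rate a \<epsilon>" unfolding exp_rate_def by (rule nn_integral_cmult) measurable
  finally show ?thesis .
qed

lemma finite_part:
  assumes "S \<in> sets borel" "S \<subseteq> {\<epsilon><..}" "0 < \<epsilon>" "0 \<le> t"
  shows "finite_measure (part S t)"
proof (rule finite_measureI)
  have "space (part S t) = UNIV" by (simp add: part_def)
  then show "emeasure (part S t) (space (part S t)) \<noteq> \<infinity>"
    using emeasure_above[of \<epsilon> S] assms by (auto simp: emeasure_part ennreal_mult_eq_top_iff)
qed

lemma big_jumps_exist:
  assumes \<epsilon>: "0 < \<epsilon>" and t: "0 < t"
  obtains P where "real_distribution P" "\<And>z. char P z = exp (of_real t * part_exponent {\<epsilon><..} z)"
    "exp (- measure \<nu> {\<epsilon><..} * t) \<le> measure P {0}"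
proof -
  let ?S = "{\<epsilon><..}"
  have S: "?S \<in> sets borel" by simp
  have fin: "finite_measure (part ?S t)" using \<epsilon> t by (intro finite_part[of _ \<epsilon>]) auto
  obtain P where P: "real_distribution P" "\<And>z. char P z = exp (CLINT x|part ?S t. iexp (z * x) - 1)"
    "exp (- measure (part ?S t) UNIV) \<le> measure P {0}" "emeasure P {..<0} = 0"
    by (rule compound_poisson_exists[OF fin sets_part emeasure_part_neg[OF S]]) (rule that; assumption)
  have "measure (part ?S t) UNIV = measure \<nu> ?S * t"
    unfolding measure_def using t by (simp add: emeasure_part enn2real_mult)
  then show ?thesis using that[OF P(1)] P integral_part[OF S] t by simp
qed

text \<open>
  The jump measure on \<open>{0<..\<epsilon>}\<close> may be infinite, so the distribution is obtained as a limit of compound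
  Poisson distributions with jumps in \<open>{1 / (k + 1)<..\<epsilon>}\<close>, whose exponential moments are bounded uniformly
  in \<open>k\<close>.
\<close>
lemma small_jumps_exist:
  assumes \<epsilon>: "0 < \<epsilon>" and t: "0 < t"
  obtains M where "real_distribution M" "\<And>z. char M z = exp (of_real t * part_exponent {0<..\<epsilon>} z)"
    "emeasure M {..<0} = 0"
    "\<And>a. 0 \<le> a \<Longrightarrow> (\<integral>\<^sup>+x. ennreal (exp (a * x)) \<partial>M) \<le> ennreal (exp (t * enn2real (exp_rate a \<epsilon>)))"
proof -
  let ?S = "\<lambda>k. {1 / real (Suc k)<..\<epsilon>}"
  have S: "?S k \<in> sets borel" for k by simp
  have S2: "?S k \<subseteq> {0<..\<epsilon>}" for k
  proof
    fix x assume x: "x \<in> ?S k"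
    have "0 < 1 / real (Suc k)" by simp
    also have "\<dots> < x" using x by simp
    finally show "x \<in> {0<..\<epsilon>}" using x by simp
  qed
  have "\<exists>P. real_distribution P \<and> (\<forall>z. char P z = exp (of_real t * part_exponent (?S k) z)) \<and> emeasure P {..<0} = 0 \<and>
     (\<forall>a\<ge>0. (\<integral>\<^sup>+x. ennreal (exp (a * x)) \<partial>P) \<le> ennreal (exp (t * enn2real (exp_rate a \<epsilon>))))" for k
  proof -
    have fin: "finite_measure (part (?S k) t)" using t by (intro finite_part[of _ "1 / real (Suc k)"]) auto
    obtain P where P: "real_distribution P" "\<And>z. char P z = exp (CLINT x|part (?S k) t. iexp (z * x) - 1)"
      "emeasure P {..<0} = 0"
      "\<And>a K. 0 \<le> a \<Longrightarrow> 0 \<le> K \<Longrightarrow> (\<integral>\<^sup>+x. ennreal (exp (a * x) - 1) \<partial>part (?S k) t) \<le> ennreal K \<Longrightarrow>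
        (\<integral>\<^sup>+x. ennreal (exp (a * x)) \<partial>P) \<le> ennreal (exp K)"
      by (rule compound_poisson_exists[OF fin sets_part emeasure_part_neg[OF S]]) (rule that; assumption)
    have "(\<integral>\<^sup>+x. ennreal (exp (a * x)) \<partial>P) \<le> ennreal (exp (t * enn2real (exp_rate a \<epsilon>)))" if a: "0 \<le> a" for a
    proof (rule P(4)[OF a])
      have "(\<integral>\<^sup>+x. ennreal (exp (a * x) - 1) \<partial>part (?S k) t) \<le> ennreal t * exp_rate a \<epsilon>"
        using t by (intro nn_integral_part_exp S S2) auto
      also have "exp_rate a \<epsilon> = ennreal (enn2real (exp_rate a \<epsilon>))" using exp_rate_finite[OF a \<epsilon>] by simp
      also have "ennreal t * \<dots> = ennreal (t * enn2real (exp_rate a \<epsilon>))" using t by (intro ennreal_mult[symmetric]) auto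
      finally show "(\<integral>\<^sup>+x. ennreal (exp (a * x) - 1) \<partial>part (?S k) t) \<le> ennreal (t * enn2real (exp_rate a \<epsilon>))" .
    qed (use t in auto)
    then show ?thesis using P(1,2,3) integral_part[OF S] t by (intro exI[of _ P]) auto
  qed
  then obtain P where P: "\<And>k. real_distribution (P k)" "\<And>k z. char (P k) z = exp (of_real t * part_exponent (?S k) z)"
    "\<And>k. emeasure (P k) {..<0} = 0"
    "\<And>k a. 0 \<le> a \<Longrightarrow> (\<integral>\<^sup>+x. ennreal (exp (a * x)) \<partial>P k) \<le> ennreal (exp (t * enn2real (exp_rate a \<epsilon>)))"
    by metis
  have lim: "(\<lambda>k. char (P k) z) \<longlonglongrightarrow> exp (of_real t * part_exponent {0<..\<epsilon>} z)" for z
    unfolding P(2) part_exponent_def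
  proof (intro tendsto_exp tendsto_mult tendsto_const integral_dominated_convergence[where w="\<lambda>x. norm (indicator {0<..\<epsilon>} x *\<^sub>R (iexp (z * x) - 1))"])
    show "integrable \<nu> (\<lambda>x. norm (indicator {0<..\<epsilon>} x *\<^sub>R (iexp (z * x) - 1)))"
      by (intro integrable_norm part_exponent_integrable) simp
    show "AE x in \<nu>. norm (indicator (?S k) x *\<^sub>R (iexp (z * x) - 1)) \<le> norm (indicator {0<..\<epsilon>} x *\<^sub>R (iexp (z * x) - 1))" for k
      using S2[of k] by (intro AE_I2) (auto split: split_indicator)
    show "AE x in \<nu>. (\<lambda>k. indicator (?S k) x *\<^sub>R (iexp (z * x) - 1)) \<longlonglongrightarrow> indicator {0<..\<epsilon>} x *\<^sub>R (iexp (z * x) - 1)"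
      using AE_\<nu>_pos
    proof eventually_elim
      case (elim x)
      have "(\<lambda>n. 1 / real (Suc n)) \<longlonglongrightarrow> 0" by (rule LIMSEQ_Suc[OF lim_const_over_n])
      then have "\<forall>\<^sub>F n in sequentially. 1 / real (Suc n) < x" using elim by (rule order_tendstoD(2))
      then have "\<forall>\<^sub>F k in sequentially. indicator (?S k) x *\<^sub>R (iexp (z * x) - 1) = indicator {0<..\<epsilon>} x *\<^sub>R (iexp (z * x) - 1)"
        by eventually_elim (use elim in \<open>auto split: split_indicator\<close>)
      then show ?case by (rule tendsto_eventually)
    qed
  qed measurable
  obtain M where M: "real_distribution M" "char M = (\<lambda>z. exp (of_real t * part_exponent {0<..\<epsilon>} z))" "emeasure M {..<0} = 0"
    "\<And>a. 0 \<le> a \<Longrightarrow> (\<integral>\<^sup>+x. ennreal (exp (a * x)) \<partial>M) \<le> ennreal (exp (t * enn2real (exp_rate a \<epsilon>)))"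
    using limit_distribution_exp_moments[of P "\<lambda>a. exp (t * enn2real (exp_rate a \<epsilon>))", OF P(1,3,4) _ lim] by auto
  show ?thesis by (rule that[OF M(1) _ M(3,4)]) (simp add: M(2))
qed

end

section \<open>Densities by Fourier inversion\<close>

lemma inversion_kernel_integral:
  fixes t a b :: real
  assumes t: "t \<noteq> 0" and ab: "a \<le> b"
  shows "(iexp (- (t * a)) - iexp (- (t * b))) / (\<i> * t) = (\<integral>x. indicator {a..b} x *\<^sub>R iexp (- (t * x)) \<partial>lborel)"
proof -
  let ?G = "\<lambda>x::real. - exp (- (\<i> * of_real t * of_real x)) / (\<i> * of_real t)"
  have "(?G has_vector_derivative iexp (- (t * x))) (at x within {a..b})" for x
  proof -
    have "((\<lambda>w. - exp (- (\<i> * of_real t * w)) / (\<i> * of_real t)) has_field_derivative exp (- (\<i> * of_real t * of_real x))) (at (of_real x))"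
      using t by (auto intro!: derivative_eq_intros)
    from has_vector_derivative_real_field[OF this] show ?thesis
      by (auto intro: has_vector_derivative_at_within simp: mult.assoc)
  qed
  then have "(\<integral>x. indicator {a..b} x *\<^sub>R iexp (- (t * x)) \<partial>lborel) = ?G b - ?G a"
    using ab by (intro integral_FTC_Icc) (auto intro!: continuous_intros)
  then show ?thesis by (simp add: diff_divide_distrib mult.assoc)
qed

lemma norm_inversion_kernel:
  fixes t a b :: real
  assumes "t \<noteq> 0" "a \<le> b"
  shows "norm ((iexp (- (t * a)) - iexp (- (t * b))) / (\<i> * t)) \<le> b - a"
  using Levy_Inversion_aux2[of "- b" "- a" t] assms by simp

context real_distribution
begin

definition inv_density :: "real \<Rightarrow> real" where
  "inv_density x = Re (\<integral>t. iexp (- (t * x)) * char M t \<partial>lborel) / (2 * pi)"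

context
  assumes int: "integrable lborel (char M)"
begin

lemma integrable_iexp_char: "integrable lborel (\<lambda>t. iexp (- (t * x)) * char M t)"
  by (rule Bochner_Integration.integrable_bound[OF int]) (auto simp: norm_mult)

lemma inv_density_bound: "\<bar>inv_density x\<bar> \<le> (\<integral>t. norm (char M t) \<partial>lborel) / (2 * pi)"
proof -
  have "\<bar>Re (\<integral>t. iexp (- (t * x)) * char M t \<partial>lborel)\<bar> \<le> norm (\<integral>t. iexp (- (t * x)) * char M t \<partial>lborel)"
    by (rule abs_Re_le_cmod)
  also have "\<dots> \<le> (\<integral>t. norm (iexp (- (t * x)) * char M t) \<partial>lborel)" by (rule integral_norm_bound)
  also have "\<dots> = (\<integral>t. norm (char M t) \<partial>lborel)" by (simp add: norm_mult)
  finally show ?thesis by (simp add: inv_density_def abs_divide divide_right_mono)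
qed

lemma inv_density_uniformly_continuous: "uniformly_continuous_on UNIV inv_density"
proof -
  define G where "G h = (\<integral>t. norm (iexp (t * h) - 1) * norm (char M t) \<partial>lborel)" for h :: real
  have Gint: "integrable lborel (\<lambda>t. norm (iexp (t * h) - 1) * norm (char M t))" for h :: real
  proof (rule Bochner_Integration.integrable_bound[of _ "\<lambda>t. 2 * norm (char M t)"])
    show "AE t in lborel. norm (norm (iexp (t * h) - 1) * norm (char M t)) \<le> norm (2 * norm (char M t))"
    proof (rule AE_I2)
      fix t
      have "norm (iexp (t * h) - 1) \<le> 2" by (rule order_trans[OF norm_triangle_ineq4]) simp
      then show "norm (norm (iexp (t * h) - 1) * norm (char M t)) \<le> norm (2 * norm (char M t))"
        by (simp add: abs_mult mult_right_mono)
    qed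
  qed (use int in auto)
  have diff: "\<bar>inv_density x - inv_density y\<bar> \<le> G (y - x)" for x y
  proof -
    have "\<bar>inv_density x - inv_density y\<bar> =
       \<bar>Re (\<integral>t. iexp (- (t * x)) * char M t - iexp (- (t * y)) * char M t \<partial>lborel)\<bar> / (2 * pi)"
      unfolding inv_density_def using integrable_iexp_char
      by (simp add: diff_divide_distrib[symmetric] abs_divide)
    also have "\<dots> \<le> \<bar>Re (\<integral>t. iexp (- (t * x)) * char M t - iexp (- (t * y)) * char M t \<partial>lborel)\<bar> / 1"
      using pi_gt3 by (intro divide_left_mono) auto
    also have "\<dots> \<le> norm (\<integral>t. iexp (- (t * x)) * char M t - iexp (- (t * y)) * char M t \<partial>lborel)"
      using abs_Re_le_cmod by simp
    also have "\<dots> \<le> (\<integral>t. norm (iexp (- (t * x)) * char M t - iexp (- (t * y)) * char M t) \<partial>lborel)"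
      by (rule integral_norm_bound)
    also have "\<dots> = G (y - x)"
      unfolding G_def
    proof (intro Bochner_Integration.integral_cong refl)
      fix t
      have "iexp (- (t * x)) = iexp (- (t * y)) * iexp (t * (y - x))"
        by (simp add: exp_add[symmetric] algebra_simps)
      then have "iexp (- (t * x)) * char M t - iexp (- (t * y)) * char M t = iexp (- (t * y)) * ((iexp (t * (y - x)) - 1) * char M t)"
        by (simp add: algebra_simps)
      then have "norm (iexp (- (t * x)) * char M t - iexp (- (t * y)) * char M t) =
        norm (iexp (- (t * y))) * (norm (iexp (t * (y - x)) - 1) * norm (char M t))"
        by (simp only: norm_mult)
      then show "norm (iexp (- (t * x)) * char M t - iexp (- (t * y)) * char M t) = norm (iexp (t * (y - x)) - 1) * norm (char M t)"
        by (simp only: norm_exp_i_times mult_1_left)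
    qed
    finally show ?thesis .
  qed
  have G0: "G 0 = 0" by (simp add: G_def)
  have "isCont G 0"
  proof (rule continuous_at_sequentiallyI)
    fix h :: "nat \<Rightarrow> real" assume h: "h \<longlonglongrightarrow> 0"
    have "(\<lambda>n. G (h n)) \<longlonglongrightarrow> (\<integral>t. 0 \<partial>(lborel :: real measure))"
      unfolding G_def
    proof (rule integral_dominated_convergence[where w="\<lambda>t. 2 * norm (char M t)"])
      show "AE t in lborel. (\<lambda>n. norm (iexp (t * h n) - 1) * norm (char M t)) \<longlonglongrightarrow> 0"
      proof (rule AE_I2)
        fix t
        have "(\<lambda>n. norm (iexp (t * h n) - 1) * norm (char M t)) \<longlonglongrightarrow> norm (iexp (t * 0) - 1) * norm (char M t)"
          by (intro tendsto_intros h)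
        then show "(\<lambda>n. norm (iexp (t * h n) - 1) * norm (char M t)) \<longlonglongrightarrow> 0" by simp
      qed
      show "AE t in lborel. norm (norm (iexp (t * h n) - 1) * norm (char M t)) \<le> 2 * norm (char M t)" for n
      proof (rule AE_I2)
        fix t
        have "norm (iexp (t * h n) - 1) \<le> 2" by (rule order_trans[OF norm_triangle_ineq4]) simp
        then show "norm (norm (iexp (t * h n) - 1) * norm (char M t)) \<le> 2 * norm (char M t)"
          by (simp add: abs_mult mult_right_mono)
      qed
    qed (use int in auto)
    then show "(\<lambda>n. G (h n)) \<longlonglongrightarrow> G 0" by (simp add: G0)
  qed
  then have lim: "(G \<longlongrightarrow> 0) (at 0)" by (simp add: isCont_def G0)
  show ?thesis
    unfolding uniformly_continuous_on_def
  proof (intro allI impI)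
    fix e :: real assume e: "0 < e"
    have "\<forall>\<^sub>F h in at 0. dist (G h) 0 < e" by (rule tendstoD[OF lim e])
    then obtain d where d: "0 < d" "\<And>h. h \<noteq> 0 \<Longrightarrow> dist h 0 < d \<Longrightarrow> dist (G h) 0 < e"
      unfolding eventually_at by auto
    show "\<exists>d>0. \<forall>x\<in>UNIV. \<forall>x'\<in>UNIV. dist x' x < d \<longrightarrow> dist (inv_density x') (inv_density x) < e"
    proof (rule exI[of _ d], intro conjI d ballI impI)
      fix x x' :: real assume "dist x' x < d"
      then have "\<bar>G (x - x')\<bar> < e" using d(2)[of "x - x'"] G0 e by (cases "x = x'") (auto simp: dist_real_def)
      then show "dist (inv_density x') (inv_density x) < e" using diff[of x' x] by (simp add: dist_real_def)
    qed
  qed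
qed

lemma inv_density_continuous: "continuous_on UNIV inv_density"
  by (rule uniformly_continuous_imp_continuous[OF inv_density_uniformly_continuous])

lemma inv_density_measurable [measurable]: "inv_density \<in> borel_measurable borel"
  by (rule borel_measurable_continuous_onI[OF inv_density_continuous])

text \<open>
  As the characteristic function is integrable, the truncated integrals of the Levy inversion formula converge
  to the integral over the whole line, and the inversion kernel is itself an integral over \<open>{a..b}\<close>; Fubini's
  theorem interchanges the two.
\<close>
lemma integral_inv_density_regular:
  assumes ab: "a \<le> b" and atoms: "measure M {a} = 0" "measure M {b} = 0"
  shows "measure M {a<..b} = (\<integral>x. indicator {a..b} x * inv_density x \<partial>lborel)"
proof -
  let ?F = "\<lambda>t::real. (iexp (- (t * a)) - iexp (- (t * b))) / (\<i> * t)"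
  let ?k = "\<lambda>t x. indicator {a..b} x *\<^sub>R (iexp (- (t * x)) * char M t)"
  have Fm [measurable]: "?F \<in> borel_measurable borel" by measurable
  have F_bound: "AE t in lborel. norm (?F t * char M t) \<le> (b - a) * norm (char M t)"
    using AE_lborel_singleton[of "0::real"]
  proof eventually_elim
    case (elim t)
    have "norm (?F t) \<le> b - a" by (rule norm_inversion_kernel[OF elim ab])
    then show ?case unfolding norm_mult by (rule mult_right_mono) simp
  qed
  have lim0: "(\<lambda>T::nat. CLBINT t=ereal (real_of_int (- int T))..ereal (real T). ?F t * char M t) \<longlonglongrightarrow> (CLBINT t. ?F t * char M t)"
  proof -
    have eq: "(CLBINT t=ereal (real_of_int (- int T))..ereal (real T). ?F t * char M t) = (CLBINT t. indicator {- real T<..<real T} t *\<^sub>R (?F t * char M t))" for T :: nat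
      by (simp add: interval_lebesgue_integral_def set_lebesgue_integral_def)
    show ?thesis
      unfolding eq
    proof (rule integral_dominated_convergence[where w="\<lambda>t. (b - a) * norm (char M t)"])
      show "integrable lborel (\<lambda>t. (b - a) * norm (char M t))" using int by auto
      show "AE t in lborel. norm (indicator {- real T<..<real T} t *\<^sub>R (?F t * char M t)) \<le> (b - a) * norm (char M t)" for T :: nat
        using F_bound
      proof eventually_elim
        case (elim t)
        have "norm (indicator {- real T<..<real T} t *\<^sub>R (?F t * char M t)) \<le> norm (?F t * char M t)"
          by (simp split: split_indicator)
        then show ?case using elim by (rule order_trans)
      qed
      show "AE t in lborel. (\<lambda>T. indicator {- real T<..<real T} t *\<^sub>R (?F t * char M t)) \<longlonglongrightarrow> ?F t * char M t"
      proof (rule AE_I2)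
        fix t
        obtain N :: nat where N: "\<bar>t\<bar> < real N" using reals_Archimedean2 by blast
        have "\<forall>\<^sub>F T in sequentially. indicator {- real T<..<real T} t *\<^sub>R (?F t * char M t) = ?F t * char M t"
          using eventually_ge_at_top[of N]
        proof eventually_elim
          case (elim T)
          then have "real N \<le> real T" by simp
          then have "t \<in> {- real T<..<real T}" using N by (auto simp: abs_less_iff)
          then show ?case by simp
        qed
        then show "(\<lambda>T. indicator {- real T<..<real T} t *\<^sub>R (?F t * char M t)) \<longlonglongrightarrow> ?F t * char M t" by (rule tendsto_eventually)
      qed
    qed measurable
  qed
  have lim: "(\<lambda>T::nat. 1 / (2 * pi) * (CLBINT t=ereal (real_of_int (- int T))..ereal (real T). ?F t * char M t)) \<longlonglongrightarrow> 1 / (2 * pi) * (CLBINT t. ?F t * char M t)"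
    by (rule tendsto_mult[OF tendsto_const lim0])
  have meas: "of_real (measure M {a<..b}) = 1 / (2 * pi) * (CLBINT t. ?F t * char M t)"
    using LIMSEQ_unique[OF Levy_Inversion[OF ab atoms] lim] by simp
  have int2: "integrable (lborel \<Otimes>\<^sub>M lborel) (\<lambda>(t, x). ?k t x)"
  proof (rule lborel_pair.Fubini_integrable)
    have "(\<integral>x. norm (?k t x) \<partial>lborel) = (b - a) * norm (char M t)" for t
    proof -
      have "(\<integral>x. norm (?k t x) \<partial>lborel) = (\<integral>x. norm (char M t) * indicator {a..b} x \<partial>lborel)"
        by (intro Bochner_Integration.integral_cong) (auto simp: norm_mult split: split_indicator)
      then show ?thesis using ab by simp
    qed
    then show "integrable lborel (\<lambda>t. \<integral>x. norm (case (t, x) of (t, x) \<Rightarrow> ?k t x) \<partial>lborel)" using int by simp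
    show "AE t in lborel. integrable lborel (\<lambda>x. case (t, x) of (t, x) \<Rightarrow> ?k t x)"
    proof (rule AE_I2)
      fix t
      have "integrable lborel (\<lambda>x. norm (char M t) * indicator {a..b} x :: real)"
        using ab by (intro integrable_mult_right) (simp add: integrable_indicator_iff)
      then show "integrable lborel (\<lambda>x. case (t, x) of (t, x) \<Rightarrow> ?k t x)"
        by (rule Bochner_Integration.integrable_bound) (auto simp: norm_mult split: split_indicator)
    qed
  qed measurable
  have "(CLBINT t. ?F t * char M t) = (CLBINT t. (\<integral>x. ?k t x \<partial>lborel))"
  proof (rule integral_cong_AE)
    show "AE t in lborel. ?F t * char M t = (\<integral>x. ?k t x \<partial>lborel)"
      using AE_lborel_singleton[of "0::real"]
    proof eventually_elim
      case (elim t)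
      have "?F t * char M t = (\<integral>x. indicator {a..b} x *\<^sub>R iexp (- (t * x)) \<partial>lborel) * char M t"
        by (simp only: inversion_kernel_integral[OF elim ab])
      also have "\<dots> = (\<integral>x. (indicator {a..b} x *\<^sub>R iexp (- (t * x))) * char M t \<partial>lborel)"
        by (rule integral_mult_left_zero[symmetric])
      finally show ?case by simp
    qed
  qed measurable
  also have "\<dots> = (CLBINT x. (\<integral>t. ?k t x \<partial>lborel))"
    by (rule lborel_pair.Fubini_integral[OF int2, symmetric])
  also have "\<dots> = (CLBINT x. indicator {a..b} x *\<^sub>R (\<integral>t. iexp (- (t * x)) * char M t \<partial>lborel))"
    by (intro Bochner_Integration.integral_cong refl integral_scaleR_right)
  finally have eq: "of_real (measure M {a<..b}) = 1 / (2 * pi) * (CLBINT x. indicator {a..b} x *\<^sub>R (\<integral>t. iexp (- (t * x)) * char M t \<partial>lborel))"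
    unfolding meas by simp
  have int3: "integrable lborel (\<lambda>x. indicator {a..b} x *\<^sub>R (\<integral>t. iexp (- (t * x)) * char M t \<partial>lborel))"
  proof -
    have "integrable lborel (\<lambda>x. \<integral>t. ?k t x \<partial>lborel)" using lborel_pair.integrable_snd[OF int2] .
    moreover have "(\<integral>t. ?k t x \<partial>lborel) = indicator {a..b} x *\<^sub>R (\<integral>t. iexp (- (t * x)) * char M t \<partial>lborel)" for x
      by (rule integral_scaleR_right)
    ultimately show ?thesis by simp
  qed
  have "measure M {a<..b} = Re (of_real (measure M {a<..b}))" by simp
  also have "\<dots> = 1 / (2 * pi) * Re (CLBINT x. indicator {a..b} x *\<^sub>R (\<integral>t. iexp (- (t * x)) * char M t \<partial>lborel))"
    unfolding eq by simp
  also have "\<dots> = 1 / (2 * pi) * (LBINT x. Re (indicator {a..b} x *\<^sub>R (\<integral>t. iexp (- (t * x)) * char M t \<partial>lborel)))"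
    by (simp only: integral_Re[OF int3])
  also have "\<dots> = (LBINT x. 1 / (2 * pi) * Re (indicator {a..b} x *\<^sub>R (\<integral>t. iexp (- (t * x)) * char M t \<partial>lborel)))"
    by (rule integral_mult_right_zero[symmetric])
  also have "\<dots> = (LBINT x. indicator {a..b} x * inv_density x)"
    by (intro Bochner_Integration.integral_cong refl) (simp add: inv_density_def)
  finally show ?thesis .
qed

lemma integrable_inv_density_interval: "integrable lborel (\<lambda>x. indicator {a..b} x * inv_density x)"
  using borel_integrable_compact[of "{a..b}" inv_density] continuous_on_subset[OF inv_density_continuous]
  by simp

lemma measure_interval_le:
  assumes "a \<le> b" "measure M {a} = 0" "measure M {b} = 0"
  shows "measure M {a<..b} \<le> (b - a) * ((\<integral>t. norm (char M t) \<partial>lborel) / (2 * pi))"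
proof -
  let ?C = "(\<integral>t. norm (char M t) \<partial>lborel) / (2 * pi)"
  have "measure M {a<..b} \<le> (\<integral>x. indicator {a..b} x * ?C \<partial>lborel)"
    unfolding integral_inv_density_regular[OF assms]
  proof (intro integral_mono integrable_inv_density_interval)
    show "integrable lborel (\<lambda>x. indicator {a..b} x * ?C)" using assms by simp
    show "indicator {a..b} x * inv_density x \<le> indicator {a..b} x * ?C" for x
      using inv_density_bound[of x] by (intro mult_left_mono) auto
  qed
  then show ?thesis using assms by simp
qed

lemma no_atoms: "measure M {x} = 0"
proof -
  define C where "C = (\<integral>t. norm (char M t) \<partial>lborel) / (2 * pi)"
  have C: "0 \<le> C" by (simp add: C_def)
  have "measure M {x} \<le> e" if e: "0 < e" for e
  proof -
    define d where "d = e / (2 * (C + 1))"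
    have d: "0 < d" "2 * d * C \<le> e" using e C by (auto simp: d_def field_simps)
    have "\<exists>a. a \<in> {x - d<..<x} \<and> a \<notin> {x. measure M {x} \<noteq> 0}"
      using open_minus_countable[OF countable_support, of "{x - d<..<x}"] d by auto
    then obtain a where a: "x - d < a" "a < x" "measure M {a} = 0" by auto
    have "\<exists>b. b \<in> {x<..<x + d} \<and> b \<notin> {x. measure M {x} \<noteq> 0}"
      using open_minus_countable[OF countable_support, of "{x<..<x + d}"] d by auto
    then obtain b where b: "x < b" "b < x + d" "measure M {b} = 0" by auto
    have "measure M {x} \<le> measure M {a<..b}" using a b by (intro finite_measure_mono) auto
    also have "\<dots> \<le> (b - a) * C" using a b unfolding C_def by (intro measure_interval_le) auto
    also have "\<dots> \<le> 2 * d * C" using a b C by (intro mult_right_mono) auto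
    finally show ?thesis using d by linarith
  qed
  then have "measure M {x} \<le> 0" by (rule field_le_epsilon[of "measure M {x}" 0, simplified])
  then show ?thesis by (simp add: measure_le_0_iff)
qed

lemma measure_interval_eq: "a \<le> b \<Longrightarrow> measure M {a<..b} = (\<integral>x. indicator {a..b} x * inv_density x \<partial>lborel)"
  by (intro integral_inv_density_regular no_atoms)

lemma inv_density_nonneg: "0 \<le> inv_density x"
proof (rule ccontr)
  assume "\<not> ?thesis"
  then have neg: "inv_density x < 0" by simp
  have "isCont inv_density x" using inv_density_continuous by (simp add: continuous_on_eq_continuous_at)
  then have "\<forall>\<^sub>F y in at x. inv_density y < inv_density x / 2"
    unfolding isCont_def using neg by (intro order_tendstoD(2)) auto
  then obtain d where d: "0 < d" "\<And>y. y \<noteq> x \<Longrightarrow> dist y x < d \<Longrightarrow> inv_density y < inv_density x / 2"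
    unfolding eventually_at by auto
  let ?b = "x + d / 2"
  have "0 \<le> measure M {x<..?b}" by simp
  also have "\<dots> = (\<integral>y. indicator {x..?b} y * inv_density y \<partial>lborel)" using d by (intro measure_interval_eq) auto
  also have "\<dots> \<le> (\<integral>y. indicator {x..?b} y * (inv_density x / 2) \<partial>lborel)"
  proof (intro integral_mono integrable_inv_density_interval)
    show "integrable lborel (\<lambda>y. indicator {x..?b} y * (inv_density x / 2))" using d by simp
    show "indicator {x..?b} y * inv_density y \<le> indicator {x..?b} y * (inv_density x / 2)" for y
      using d(2)[of y] d(1) neg by (cases "y = x") (auto simp: dist_real_def split: split_indicator)
  qed
  also have "\<dots> = d / 2 * (inv_density x / 2)" using d by simp
  also have "\<dots> < 0" using d neg by (intro mult_pos_neg) auto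
  finally show False by simp
qed

lemma eq_inv_density: "M = density lborel (\<lambda>x. ennreal (inv_density x))"
proof (rule measure_eqI_lessThan)
  let ?D = "density lborel (\<lambda>x. ennreal (inv_density x))"
  show "emeasure M {x<..} < \<infinity>" for x by (simp add: less_top[symmetric])
  have ivl: "emeasure M {a<..b} = emeasure ?D {a<..b}" if "a \<le> b" for a b
  proof -
    have "emeasure ?D {a<..b} = (\<integral>\<^sup>+x. ennreal (inv_density x) * indicator {a<..b} x \<partial>lborel)"
      by (rule emeasure_density) auto
    also have "\<dots> = (\<integral>\<^sup>+x. ennreal (indicator {a..b} x * inv_density x) \<partial>lborel)"
      using AE_lborel_singleton[of a]
      by (intro nn_integral_cong_AE) (auto elim!: eventually_mono split: split_indicator)
    also have "\<dots> = ennreal (\<integral>x. indicator {a..b} x * inv_density x \<partial>lborel)"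
      using inv_density_nonneg by (intro nn_integral_eq_integral integrable_inv_density_interval) auto
    also have "\<dots> = emeasure M {a<..b}" using measure_interval_eq[OF that] by (simp add: emeasure_eq_measure)
    finally show ?thesis by simp
  qed
  show "emeasure M {x<..} = emeasure ?D {x<..}" for x
  proof -
    have U: "{x<..} = (\<Union>n. {x<..x + real n})"
    proof (intro equalityI subsetI)
      fix y assume "y \<in> {x<..}"
      obtain n :: nat where "y - x \<le> real n" using real_arch_simple by blast
      then show "y \<in> (\<Union>n. {x<..x + real n})" using \<open>y \<in> {x<..}\<close> by (auto intro!: exI[of _ n])
    qed auto
    have inc: "incseq (\<lambda>n. {x<..x + real n})" by (auto simp: incseq_def)
    have "emeasure M {x<..} = (SUP n. emeasure M {x<..x + real n})"
      unfolding U by (rule SUP_emeasure_incseq[OF _ inc, symmetric]) auto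
    also have "\<dots> = (SUP n. emeasure ?D {x<..x + real n})" by (simp add: ivl)
    also have "\<dots> = emeasure ?D {x<..}"
      unfolding U by (rule SUP_emeasure_incseq[OF _ inc]) auto
    finally show ?thesis .
  qed
qed auto

end

end

section \<open>The densities of the convolution powers\<close>

lemma continuous_eq_if_AE_eq:
  fixes f g :: "real \<Rightarrow> real"
  assumes "continuous_on UNIV f" "continuous_on UNIV g" "open U" "AE x in lborel. x \<in> U \<longrightarrow> f x = g x" "x \<in> U"
  shows "f x = g x"
proof (rule ccontr)
  assume ne: "f x \<noteq> g x"
  have op: "open (U \<inter> {x. f x \<noteq> g x})"
    using assms(1,2,3) by (intro open_Int open_Collect_neq) auto
  have "x \<in> U \<inter> {x. f x \<noteq> g x}" using assms(5) ne by simp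
  then obtain e where e: "0 < e" "ball x e \<subseteq> U \<inter> {x. f x \<noteq> g x}" using op open_contains_ball by blast
  have "AE y in lborel. y \<notin> {x<..<x + e}"
    using assms(4)
  proof eventually_elim
    case (elim y)
    show ?case
    proof
      assume "y \<in> {x<..<x + e}"
      then have "y \<in> ball x e" by (auto simp: dist_real_def)
      then show False using e elim by blast
    qed
  qed
  then have "emeasure lborel {x<..<x + e} = 0"
    by (subst (asm) AE_iff_measurable[of "{x<..<x + e}"]) auto
  then show False using e by simp
qed

lemma continuous_density_unique:
  fixes f g :: "real \<Rightarrow> real"
  assumes "continuous_on UNIV f" "continuous_on UNIV g" "\<And>x. 0 \<le> f x" "\<And>x. 0 \<le> g x"
    and eq: "density lborel (\<lambda>x. ennreal (f x)) = density lborel (\<lambda>x. ennreal (g x))"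
  shows "f x = g x"
proof -
  have [measurable]: "f \<in> borel_measurable borel" "g \<in> borel_measurable borel"
    using assms by (auto intro: borel_measurable_continuous_onI)
  have "AE x in lborel. ennreal (f x) = ennreal (g x)"
    by (rule sigma_finite_measure.density_unique[OF sigma_finite_lborel _ _ eq]) auto
  then have "AE x in lborel. x \<in> UNIV \<longrightarrow> f x = g x"
    by eventually_elim (simp add: assms(3,4))
  from continuous_eq_if_AE_eq[OF assms(1,2) open_UNIV this UNIV_I] show ?thesis .
qed

lemma density_convolution:
  fixes k :: "real \<Rightarrow> real"
  assumes k [measurable]: "k \<in> borel_measurable borel" and nn: "\<And>x. 0 \<le> k x" and B: "\<And>x. k x \<le> B"
    and M: "real_distribution (density lborel (\<lambda>x. ennreal (k x)))" and N: "real_distribution N"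
  shows "(density lborel (\<lambda>x. ennreal (k x)) \<star> N) = density lborel (\<lambda>x. ennreal (\<integral>v. k (x - v) \<partial>N))"
proof (rule measure_eqI)
  let ?M = "density lborel (\<lambda>x. ennreal (k x))"
  interpret M: real_distribution ?M by (fact M)
  interpret N: real_distribution N by (fact N)
  interpret LN: pair_sigma_finite lborel N ..
  show "sets (?M \<star> N) = sets (density lborel (\<lambda>x. ennreal (\<integral>v. k (x - v) \<partial>N)))" by simp
  fix A assume "A \<in> sets (?M \<star> N)"
  then have [measurable]: "A \<in> sets borel" by simp
  have "emeasure (?M \<star> N) A = (\<integral>\<^sup>+x. (\<integral>\<^sup>+v. indicator A (x + v) \<partial>N) \<partial>?M)"
    using M.finite_measure_axioms N.finite_measure_axioms by (intro convolution_emeasure') auto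
  also have "\<dots> = (\<integral>\<^sup>+x. ennreal (k x) * (\<integral>\<^sup>+v. indicator A (x + v) \<partial>N) \<partial>lborel)"
    by (intro nn_integral_density) measurable
  also have "\<dots> = (\<integral>\<^sup>+x. (\<integral>\<^sup>+v. ennreal (k x) * indicator A (x + v) \<partial>N) \<partial>lborel)"
    by (intro nn_integral_cong nn_integral_cmult[symmetric]) measurable
  also have "\<dots> = (\<integral>\<^sup>+v. (\<integral>\<^sup>+x. ennreal (k x) * indicator A (x + v) \<partial>lborel) \<partial>N)"
    by (rule LN.Fubini'[symmetric]) measurable
  also have "\<dots> = (\<integral>\<^sup>+v. (\<integral>\<^sup>+x. ennreal (k (x - v)) * indicator A x \<partial>lborel) \<partial>N)"
  proof (rule nn_integral_cong)
    fix v
    have "(\<integral>\<^sup>+x. (\<lambda>y. ennreal (k y) * indicator A (y + v)) (x - v) \<partial>lborel) = (\<integral>\<^sup>+x. ennreal (k x) * indicator A (x + v) \<partial>lborel)"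
      by (rule nn_integral_lborel_shift) measurable
    then show "(\<integral>\<^sup>+x. ennreal (k x) * indicator A (x + v) \<partial>lborel) = (\<integral>\<^sup>+x. ennreal (k (x - v)) * indicator A x \<partial>lborel)" by simp
  qed
  also have "\<dots> = (\<integral>\<^sup>+x. (\<integral>\<^sup>+v. ennreal (k (x - v)) * indicator A x \<partial>N) \<partial>lborel)"
    by (rule LN.Fubini') measurable
  also have "\<dots> = (\<integral>\<^sup>+x. ennreal (\<integral>v. k (x - v) \<partial>N) * indicator A x \<partial>lborel)"
  proof (rule nn_integral_cong)
    fix x
    have "(\<integral>\<^sup>+v. ennreal (k (x - v)) * indicator A x \<partial>N) = (\<integral>\<^sup>+v. ennreal (k (x - v)) \<partial>N) * indicator A x"
      by (rule nn_integral_multc) measurable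
    also have "(\<integral>\<^sup>+v. ennreal (k (x - v)) \<partial>N) = ennreal (\<integral>v. k (x - v) \<partial>N)"
      using nn B by (intro nn_integral_eq_integral N.integrable_const_bound[where B=B]) auto
    finally show "(\<integral>\<^sup>+v. ennreal (k (x - v)) * indicator A x \<partial>N) = ennreal (\<integral>v. k (x - v) \<partial>N) * indicator A x" .
  qed
  also have "\<dots> = emeasure (density lborel (\<lambda>x. ennreal (\<integral>v. k (x - v) \<partial>N))) A"
    by (rule emeasure_density[symmetric]) auto
  finally show "emeasure (?M \<star> N) A = emeasure (density lborel (\<lambda>x. ennreal (\<integral>v. k (x - v) \<partial>N))) A" .
qed

text \<open>
  Two continuous densities of the same distribution agree at every point, not only almost everywhere.
\<close>
lemma continuous_density_of_convolution:
  fixes f k :: "real \<Rightarrow> real"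
  assumes k: "continuous_on UNIV k" "\<And>x. 0 \<le> k x" "\<And>x. k x \<le> B"
    and M: "real_distribution (density lborel (\<lambda>x. ennreal (k x)))" and N: "real_distribution N"
    and f: "continuous_on UNIV f" "\<And>x. 0 \<le> f x"
    and eq: "density lborel (\<lambda>x. ennreal (f x)) = (density lborel (\<lambda>x. ennreal (k x)) \<star> N)"
  shows "f x = (\<integral>v. k (x - v) \<partial>N)"
proof (rule continuous_density_unique[where f=f and g="\<lambda>x. \<integral>v. k (x - v) \<partial>N"])
  interpret N: real_distribution N by (fact N)
  have km [measurable]: "k \<in> borel_measurable borel" by (rule borel_measurable_continuous_onI[OF k(1)])
  show "continuous_on UNIV (\<lambda>x. \<integral>v. k (x - v) \<partial>N)"
  proof (rule continuous_on_sequentiallyI)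
    fix u :: "nat \<Rightarrow> real" and a assume u: "u \<longlonglongrightarrow> a"
    show "(\<lambda>n. \<integral>v. k (u n - v) \<partial>N) \<longlonglongrightarrow> (\<integral>v. k (a - v) \<partial>N)"
    proof (rule integral_dominated_convergence[where w="\<lambda>_. B"])
      show "AE v in N. (\<lambda>n. k (u n - v)) \<longlonglongrightarrow> k (a - v)"
        using k(1) by (intro AE_I2 isCont_tendsto_compose[of _ k] tendsto_intros u) (auto simp: continuous_on_eq_continuous_at)
      show "AE v in N. norm (k (u n - v)) \<le> B" for n using k(2,3) by simp
    qed auto
  qed
  show "density lborel (\<lambda>x. ennreal (f x)) = density lborel (\<lambda>x. ennreal (\<integral>v. k (x - v) \<partial>N))"
    unfolding eq by (rule density_convolution[OF km k(2,3) M N])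
  show "0 \<le> (\<integral>v. k (x - v) \<partial>N)" for x using k(2) by (intro integral_nonneg_AE) auto
qed (use f in auto)

text \<open>
  Of two summands with total \<open>x\<close>, one is at least \<open>x / 2\<close>, whence
  \<open>1 \<le> exp (2 * (x - v) - x) + exp (2 * v - x)\<close>. In each term bound the density at the other summand by \<open>B\<close>; the
  exponential moment of order \<open>2\<close> remains.
\<close>
lemma light_tail_of_selfconvolution:
  fixes k f :: "real \<Rightarrow> real"
  assumes k [measurable]: "k \<in> borel_measurable borel" and nn: "\<And>x. 0 \<le> k x" and B: "\<And>x. k x \<le> B"
    and mgf: "(\<integral>\<^sup>+x. ennreal (exp (2 * x)) \<partial>density lborel (\<lambda>x. ennreal (k x))) \<le> ennreal K" and K: "0 \<le> K"
    and N: "real_distribution (density lborel (\<lambda>x. ennreal (k x)))"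
    and f: "\<And>x. f x = (\<integral>v. k (x - v) \<partial>density lborel (\<lambda>x. ennreal (k x)))"
  shows "f x \<le> 2 * B * K * exp (- x)"
proof -
  let ?N = "density lborel (\<lambda>x. ennreal (k x))"
  interpret N: real_distribution ?N by (fact N)
  have B0: "0 \<le> B" using nn[of 0] B[of 0] by linarith
  have E: "(\<integral>\<^sup>+v. ennreal (exp (2 * v) * k v) \<partial>lborel) \<le> ennreal K"
  proof -
    have "(\<integral>\<^sup>+v. ennreal (exp (2 * v) * k v) \<partial>lborel) = (\<integral>\<^sup>+v. ennreal (k v) * ennreal (exp (2 * v)) \<partial>lborel)"
      using nn by (intro nn_integral_cong) (simp add: ennreal_mult mult.commute)
    also have "\<dots> = (\<integral>\<^sup>+x. ennreal (exp (2 * x)) \<partial>?N)" by (rule nn_integral_density[symmetric]) auto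
    finally show ?thesis using mgf by simp
  qed
  have "ennreal (f x) = (\<integral>\<^sup>+v. ennreal (k (x - v)) \<partial>?N)"
    unfolding f using nn B by (intro nn_integral_eq_integral[symmetric] N.integrable_const_bound[where B=B]) auto
  also have "\<dots> = (\<integral>\<^sup>+v. ennreal (k v) * ennreal (k (x - v)) \<partial>lborel)" by (rule nn_integral_density) auto
  also have "\<dots> \<le> (\<integral>\<^sup>+v. ennreal (B * exp (- x)) * ennreal (exp (2 * (x - v)) * k (x - v)) +
      ennreal (B * exp (- x)) * ennreal (exp (2 * v) * k v) \<partial>lborel)"
  proof (rule nn_integral_mono)
    fix v
    have "1 \<le> exp (- x) * exp (2 * (x - v)) + exp (- x) * exp (2 * v)"
    proof (cases "v \<le> x / 2")
      case True
      then have "1 \<le> exp (- x) * exp (2 * (x - v))" by (simp add: exp_add[symmetric])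
      then show ?thesis by (rule order_trans) simp
    next
      case False
      then have "1 \<le> exp (- x) * exp (2 * v)" by (simp add: exp_add[symmetric])
      then show ?thesis by (rule order_trans) simp
    qed
    then have "k v * k (x - v) * 1 \<le> k v * k (x - v) * (exp (- x) * exp (2 * (x - v)) + exp (- x) * exp (2 * v))"
      using nn by (intro mult_left_mono) auto
    also have "\<dots> = exp (- x) * (exp (2 * (x - v)) * k (x - v)) * k v + exp (- x) * (exp (2 * v) * k v) * k (x - v)"
      by (simp add: algebra_simps)
    also have "\<dots> \<le> exp (- x) * (exp (2 * (x - v)) * k (x - v)) * B + exp (- x) * (exp (2 * v) * k v) * B"
      using nn B by (intro add_mono mult_left_mono) auto
    also have "\<dots> = B * exp (- x) * (exp (2 * (x - v)) * k (x - v)) + B * exp (- x) * (exp (2 * v) * k v)"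
      by simp
    finally have "ennreal (k v * k (x - v)) \<le> ennreal (B * exp (- x) * (exp (2 * (x - v)) * k (x - v)) + B * exp (- x) * (exp (2 * v) * k v))"
      by (intro ennreal_leI) simp
    then show "ennreal (k v) * ennreal (k (x - v)) \<le> ennreal (B * exp (- x)) * ennreal (exp (2 * (x - v)) * k (x - v)) +
      ennreal (B * exp (- x)) * ennreal (exp (2 * v) * k v)"
      using nn B0 by (simp only: ennreal_mult[symmetric] ennreal_plus[symmetric] mult_nonneg_nonneg exp_ge_zero)
  qed
  also have "\<dots> = ennreal (B * exp (- x)) * (\<integral>\<^sup>+v. ennreal (exp (2 * (x - v)) * k (x - v)) \<partial>lborel) +
     ennreal (B * exp (- x)) * (\<integral>\<^sup>+v. ennreal (exp (2 * v) * k v) \<partial>lborel)"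
    by (subst nn_integral_add) (auto simp: nn_integral_cmult)
  also have "(\<integral>\<^sup>+v. ennreal (exp (2 * (x - v)) * k (x - v)) \<partial>lborel) = (\<integral>\<^sup>+v. ennreal (exp (2 * v) * k v) \<partial>lborel)"
    by (rule nn_integral_lborel_reflect[of "\<lambda>v. ennreal (exp (2 * v) * k v)"]) measurable
  also have "ennreal (B * exp (- x)) * (\<integral>\<^sup>+v. ennreal (exp (2 * v) * k v) \<partial>lborel) +
      ennreal (B * exp (- x)) * (\<integral>\<^sup>+v. ennreal (exp (2 * v) * k v) \<partial>lborel) \<le>
      ennreal (B * exp (- x)) * ennreal K + ennreal (B * exp (- x)) * ennreal K"
    by (intro add_mono mult_left_mono E) auto
  also have "\<dots> = ennreal (2 * B * K * exp (- x))"
    using B0 K by (simp add: ennreal_mult[symmetric] algebra_simps flip: ennreal_plus)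
  finally show ?thesis using B0 K by (simp add: ennreal_le_iff)
qed

context levy_measure
begin

lemma scale_measure_eq_part: "0 \<le> t \<Longrightarrow> scale_measure (ennreal t) \<nu> = part UNIV t"
  by (rule measure_eqI) (auto simp: part_def emeasure_density nn_integral_cmult_indicator)

lemma char_id_dist:
  assumes "id_dist_nonneg \<rho> 0 (scale_measure (ennreal t) \<nu>)" "0 \<le> t"
  shows "real_distribution \<rho>" "char \<rho> z = exp (of_real t * part_exponent {0<..} z)" "emeasure \<rho> {..<0} = 0"
proof -
  have "part_exponent UNIV z = part_exponent {0<..} z"
    unfolding part_exponent_def using AE_\<nu>_pos by (intro integral_cong_AE) (auto elim!: eventually_mono)
  then show "char \<rho> z = exp (of_real t * part_exponent {0<..} z)"
    using assms integral_part[of UNIV t z] by (simp add: id_dist_nonneg_def scale_measure_eq_part)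
  show "real_distribution \<rho>" "emeasure \<rho> {..<0} = 0"
    using assms by (auto simp: id_dist_nonneg_def infinitely_divisible_def)
qed

lemma part_exponent_above_bound:
  assumes "0 < \<epsilon>"
  shows "norm (part_exponent {\<epsilon><..} z) \<le> 2 * measure \<nu> {\<epsilon><..}"
proof -
  have fin: "emeasure \<nu> {\<epsilon><..} < \<infinity>" using assms by (intro emeasure_above) auto
  have "norm (part_exponent {\<epsilon><..} z) \<le> (\<integral>x. norm (indicator {\<epsilon><..} x *\<^sub>R (iexp (z * x) - 1)) \<partial>\<nu>)"
    unfolding part_exponent_def by (rule integral_norm_bound)
  also have "\<dots> \<le> (\<integral>x. 2 * indicator {\<epsilon><..} x \<partial>\<nu>)"
  proof (rule integral_mono)
    show "integrable \<nu> (\<lambda>x. norm (indicator {\<epsilon><..} x *\<^sub>R (iexp (z * x) - 1)))"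
      by (intro integrable_norm part_exponent_integrable) simp
    show "integrable \<nu> (\<lambda>x. 2 * indicator {\<epsilon><..} x :: real)" using fin by simp
    fix x :: real
    have "norm (iexp (z * x) - 1) \<le> 2" by (rule order_trans[OF norm_triangle_ineq4]) simp
    then show "norm (indicator {\<epsilon><..} x *\<^sub>R (iexp (z * x) - 1)) \<le> 2 * indicator {\<epsilon><..} x"
      by (simp split: split_indicator)
  qed
  also have "\<dots> = 2 * measure \<nu> {\<epsilon><..}" by simp
  finally show ?thesis .
qed

text \<open>
  All identities between distributions are checked on characteristic functions, whose exponents are
  \<open>t\<close> times an integral against \<open>\<nu>\<close> over the respective range of jump sizes. The characteristic function of
  the small-jump part is integrable as well: the large jumps change the modulus by a factor that is bounded
  away from \<open>0\<close>. Its density is therefore bounded and continuous, and it has an exponential tail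
  because it is the self-convolution of the bounded density for half the time.
\<close>
lemma id_density_semigroup_exists:
  fixes \<mu>_pow :: "real \<Rightarrow> real measure" and p :: "real \<Rightarrow> real \<Rightarrow> real"
  assumes \<mu>_pow: "\<And>t. 0 < t \<Longrightarrow> id_dist_nonneg (\<mu>_pow t) 0 (scale_measure (ennreal t) \<nu>)"
    and int: "\<And>t. 0 < t \<Longrightarrow> integrable lborel (char (\<mu>_pow t))"
    and p: "\<And>t. 0 < t \<Longrightarrow> is_continuous_density (p t) (\<mu>_pow t)"
  shows "\<exists>P M rate q. id_density_semigroup p P M rate q"
proof -
  define \<psi> where "\<psi> = part_exponent {0<..}"
  have dist: "real_distribution (\<mu>_pow t)" and ch: "char (\<mu>_pow t) z = exp (of_real t * \<psi> z)"
    and neg: "emeasure (\<mu>_pow t) {..<0} = 0" if "0 < t" for t z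
    using char_id_dist[OF \<mu>_pow[OF that]] that by (auto simp: \<psi>_def)
  have pc: "continuous_on UNIV (p t)" and pnn: "0 \<le> p t x" and pd: "\<mu>_pow t = density lborel (\<lambda>x. ennreal (p t x))"
    if "0 < t" for t x
    using p[OF that] by (auto simp: is_continuous_density_def)
  have pm: "p t \<in> borel_measurable borel" if "0 < t" for t by (rule borel_measurable_continuous_onI[OF pc[OF that]])
  have pdist: "real_distribution (density lborel (\<lambda>x. ennreal (p t x)))" if "0 < t" for t
    using dist[OF that] pd[OF that] by simp
  have pint: "(\<integral>\<^sup>+x. ennreal (p t x) \<partial>lborel) = 1" if t: "0 < t" for t
  proof -
    interpret D: real_distribution "density lborel (\<lambda>x. ennreal (p t x))" by (rule pdist[OF t])
    note pm[OF t, measurable]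
    show ?thesis using D.emeasure_space_1 by (simp add: emeasure_density)
  qed
  have pneg: "p t x = 0" if t: "0 < t" and x: "x < 0" for t x
  proof (rule continuous_eq_if_AE_eq[of "p t" "\<lambda>_. 0" "{..<0}"])
    note pm[OF t, measurable]
    have "(\<integral>\<^sup>+x. ennreal (p t x) * indicator {..<0} x \<partial>lborel) = 0"
      using neg[OF t] unfolding pd[OF t] by (simp add: emeasure_density)
    then have "AE x in lborel. ennreal (p t x) * indicator {..<0} x = 0"
      by (subst (asm) nn_integral_0_iff_AE) auto
    then show "AE x in lborel. x \<in> {..<0} \<longrightarrow> p t x = 0"
      by eventually_elim (use pnn[OF t] in \<open>auto simp: ennreal_eq_0_iff intro: antisym\<close>)
  qed (use pc t x in auto)
  have half: "halfline_density (p t)" if "0 < t" for t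
    using pm[OF that] pnn[OF that] pint[OF that] pneg[OF that] by (simp add: halfline_density_def prob_density_def)
  have pb: "\<exists>B. \<forall>x. p t x \<le> B" if t: "0 < t" for t
  proof -
    interpret D: real_distribution "\<mu>_pow t" by (rule dist[OF t])
    have eq: "p t x = D.inv_density x" for x
      by (rule continuous_density_unique[OF pc[OF t] D.inv_density_continuous[OF int[OF t]] pnn[OF t]
            D.inv_density_nonneg[OF int[OF t]] trans[OF pd[OF t, symmetric] D.eq_inv_density[OF int[OF t]]]])
    show ?thesis unfolding eq by (intro exI allI) (rule abs_le_D1[OF D.inv_density_bound[OF int[OF t]]])
  qed
  have pconv: "conv_part (p s) (p t) UNIV x = ennreal (p (s + t) x)" if st: "0 < s" "0 < t" for s t x
  proof -
    obtain B where B: "\<And>x. p s x \<le> B" using pb[OF st(1)] by blast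
    have st': "0 < s + t" using st by simp
    interpret D: real_distribution "density lborel (\<lambda>x. ennreal (p t x))" by (rule pdist[OF st(2)])
    note pm[OF st(1), measurable] pm[OF st(2), measurable]
    have eq: "density lborel (\<lambda>x. ennreal (p (s + t) x)) =
        (density lborel (\<lambda>x. ennreal (p s x)) \<star> density lborel (\<lambda>x. ennreal (p t x)))"
      unfolding pd[OF st', symmetric] pd[OF st(1), symmetric] pd[OF st(2), symmetric]
    proof (rule convolution_eqI_char[OF dist[OF st(1)] dist[OF st(2)] dist[OF st']])
      show "char (\<mu>_pow (s + t)) z = char (\<mu>_pow s) z * char (\<mu>_pow t) z" for z
        unfolding ch[OF st'] ch[OF st(1)] ch[OF st(2)] by (simp add: exp_add[symmetric] algebra_simps)
    qed
    have "p (s + t) x = (\<integral>v. p s (x - v) \<partial>density lborel (\<lambda>x. ennreal (p t x)))"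
      by (rule continuous_density_of_convolution[OF pc[OF st(1)] pnn[OF st(1)] B pdist[OF st(1)] pdist[OF st(2)] pc[OF st'] pnn[OF st'] eq])
    then have "ennreal (p (s + t) x) = (\<integral>\<^sup>+v. ennreal (p s (x - v)) \<partial>density lborel (\<lambda>x. ennreal (p t x)))"
      using pnn[OF st(1)] B by (simp add: nn_integral_eq_integral D.integrable_const_bound[where B=B])
    also have "\<dots> = (\<integral>\<^sup>+v. ennreal (p t v) * ennreal (p s (x - v)) \<partial>lborel)" by (rule nn_integral_density) auto
    also have "\<dots> = conv_part (p s) (p t) UNIV x"
      unfolding conv_part_def using pnn st by (intro nn_integral_cong) (simp add: ennreal_mult mult.commute)
    finally show ?thesis by simp
  qed
  have "\<forall>\<epsilon> t. \<exists>P. 0 < \<epsilon> \<and> 0 < t \<longrightarrow> real_distribution P \<and> (\<forall>z. char P z = exp (of_real t * part_exponent {\<epsilon><..} z)) \<and>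
      exp (- measure \<nu> {\<epsilon><..} * t) \<le> measure P {0}"
    using big_jumps_exist by metis
  then obtain P where P: "\<And>\<epsilon> t. 0 < \<epsilon> \<Longrightarrow> 0 < t \<Longrightarrow> real_distribution (P \<epsilon> t)"
    "\<And>\<epsilon> t z. 0 < \<epsilon> \<Longrightarrow> 0 < t \<Longrightarrow> char (P \<epsilon> t) z = exp (of_real t * part_exponent {\<epsilon><..} z)"
    "\<And>\<epsilon> t. 0 < \<epsilon> \<Longrightarrow> 0 < t \<Longrightarrow> exp (- measure \<nu> {\<epsilon><..} * t) \<le> measure (P \<epsilon> t) {0}"
    by metis
  define small where "small \<epsilon> t N \<longleftrightarrow> real_distribution N \<and>
      (\<forall>z. char N z = exp (of_real t * part_exponent {0<..\<epsilon>} z)) \<and> emeasure N {..<0} = 0 \<and>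
      (\<forall>a\<ge>0. (\<integral>\<^sup>+x. ennreal (exp (a * x)) \<partial>N) \<le> ennreal (exp (t * enn2real (exp_rate a \<epsilon>))))"
    for \<epsilon> t and N :: "real measure"
  define M where "M \<epsilon> t = (SOME N. small \<epsilon> t N)" for \<epsilon> t
  have small_M: "small \<epsilon> t (M \<epsilon> t)" if "0 < \<epsilon>" "0 < t" for \<epsilon> t
  proof -
    have "\<exists>N. small \<epsilon> t N"
      unfolding small_def by (rule small_jumps_exist[OF that]) (intro exI conjI allI impI; assumption)
    then show ?thesis unfolding M_def by (rule someI_ex)
  qed
  have M: "\<And>\<epsilon> t. 0 < \<epsilon> \<Longrightarrow> 0 < t \<Longrightarrow> real_distribution (M \<epsilon> t)"
    "\<And>\<epsilon> t z. 0 < \<epsilon> \<Longrightarrow> 0 < t \<Longrightarrow> char (M \<epsilon> t) z = exp (of_real t * part_exponent {0<..\<epsilon>} z)"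
    "\<And>\<epsilon> t. 0 < \<epsilon> \<Longrightarrow> 0 < t \<Longrightarrow> emeasure (M \<epsilon> t) {..<0} = 0"
    "\<And>\<epsilon> t a. 0 < \<epsilon> \<Longrightarrow> 0 < t \<Longrightarrow> 0 \<le> a \<Longrightarrow>
       (\<integral>\<^sup>+x. ennreal (exp (a * x)) \<partial>M \<epsilon> t) \<le> ennreal (exp (t * enn2real (exp_rate a \<epsilon>)))"
    using small_M unfolding small_def by blast+
  have split: "\<psi> z = part_exponent {0<..\<epsilon>} z + part_exponent {\<epsilon><..} z" if "0 < \<epsilon>" for \<epsilon> z
  proof -
    have "{0<..} = {0<..\<epsilon>} \<union> {\<epsilon><..}" using that by auto
    moreover have "part_exponent ({0<..\<epsilon>} \<union> {\<epsilon><..}) z = part_exponent {0<..\<epsilon>} z + part_exponent {\<epsilon><..} z"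
      by (rule part_exponent_add) auto
    ultimately show ?thesis unfolding \<psi>_def by simp
  qed
  have factor: "density lborel (\<lambda>x. ennreal (p t x)) = (M \<epsilon> t \<star> P \<epsilon> t)" if "0 < \<epsilon>" "0 < t" for \<epsilon> t
    unfolding pd[OF that(2), symmetric] using that M P dist
    by (intro convolution_eqI_char) (auto simp: ch split[OF that(1)] exp_add[symmetric] algebra_simps)
  have Mint: "integrable lborel (char (M 1 t))" if t: "0 < t" for t
  proof (rule Bochner_Integration.integrable_bound)
    interpret Mt: real_distribution "M 1 t" using M t by simp
    let ?C = "exp (t * (2 * measure \<nu> {1<..}))"
    show "integrable lborel (\<lambda>z. ?C * norm (char (\<mu>_pow t) z))" using int[OF t] by auto
    show "char (M 1 t) \<in> borel_measurable lborel" by simp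
    show "AE z in lborel. norm (char (M 1 t) z) \<le> norm (?C * norm (char (\<mu>_pow t) z))"
    proof (rule AE_I2)
      fix z
      have "- Re (part_exponent {1<..} z) \<le> norm (part_exponent {1<..} z)"
        using abs_Re_le_cmod[of "part_exponent {1<..} z"] by linarith
      also have "\<dots> \<le> 2 * measure \<nu> {1<..}" by (rule part_exponent_above_bound) simp
      finally have "Re (part_exponent {0<..1} z) \<le> 2 * measure \<nu> {1<..} + Re (\<psi> z)" by (simp add: split[of 1])
      then have "t * Re (part_exponent {0<..1} z) \<le> t * (2 * measure \<nu> {1<..}) + t * Re (\<psi> z)"
        using t by (simp add: distrib_left[symmetric])
      then have "exp (t * Re (part_exponent {0<..1} z)) \<le> ?C * exp (t * Re (\<psi> z))"
        by (simp add: exp_add[symmetric])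
      then show "norm (char (M 1 t) z) \<le> norm (?C * norm (char (\<mu>_pow t) z))"
        using t by (simp add: M ch norm_exp_eq_Re norm_mult)
    qed
  qed
  define q where "q t = real_distribution.inv_density (M 1 t)" for t
  have qc: "uniformly_continuous_on UNIV (q t)" and qnn: "0 \<le> q t x" and qb: "\<exists>B. \<forall>x. q t x \<le> B"
    and qd: "M 1 t = density lborel (\<lambda>x. ennreal (q t x))" if t: "0 < t" for t x
  proof -
    interpret Mt: real_distribution "M 1 t" using M t by simp
    show "uniformly_continuous_on UNIV (q t)" unfolding q_def by (rule Mt.inv_density_uniformly_continuous[OF Mint[OF t]])
    show "0 \<le> q t x" unfolding q_def by (rule Mt.inv_density_nonneg[OF Mint[OF t]])
    show "M 1 t = density lborel (\<lambda>x. ennreal (q t x))" unfolding q_def by (rule Mt.eq_inv_density[OF Mint[OF t]])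
    show "\<exists>B. \<forall>x. q t x \<le> B"
      unfolding q_def by (intro exI allI) (rule abs_le_D1[OF Mt.inv_density_bound[OF Mint[OF t]]])
  qed
  have qc': "continuous_on UNIV (q t)" if "0 < t" for t by (rule uniformly_continuous_imp_continuous[OF qc[OF that]])
  have qm: "q t \<in> borel_measurable borel" if "0 < t" for t by (rule borel_measurable_continuous_onI[OF qc'[OF that]])
  have qdist: "real_distribution (density lborel (\<lambda>x. ennreal (q t x)))" if "0 < t" for t
    using M(1)[OF zero_less_one that] qd[OF that] by simp
  have qneg: "q t x = 0" if t: "0 < t" and x: "x < 0" for t x
  proof (rule continuous_eq_if_AE_eq[of "q t" "\<lambda>_. 0" "{..<0}"])
    note qm[OF t, measurable]
    have "emeasure (density lborel (\<lambda>x. ennreal (q t x))) {..<0} = 0"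
      using M(3)[OF zero_less_one t] qd[OF t] by simp
    then have "(\<integral>\<^sup>+x. ennreal (q t x) * indicator {..<0} x \<partial>lborel) = 0" by (simp add: emeasure_density)
    then have "AE x in lborel. ennreal (q t x) * indicator {..<0} x = 0"
      by (subst (asm) nn_integral_0_iff_AE) auto
    then show "AE x in lborel. x \<in> {..<0} \<longrightarrow> q t x = 0"
      by eventually_elim (use qnn[OF t] in \<open>auto simp: ennreal_eq_0_iff intro: antisym\<close>)
  qed (use qc' t x in auto)
  have qlight: "\<exists>C. \<forall>x. q t x \<le> C * exp (- x)" if t: "0 < t" for t
  proof -
    have t2: "0 < t / 2" using t by simp
    obtain B where B: "\<And>x. q (t / 2) x \<le> B" using qb[OF t2] by blast
    let ?N = "density lborel (\<lambda>x. ennreal (q (t / 2) x))" and ?K = "exp (t / 2 * enn2real (exp_rate 2 1))"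
    have "M 1 t = (M 1 (t / 2) \<star> M 1 (t / 2))"
      using t M by (intro convolution_eqI_char) (auto simp: exp_add[symmetric] algebra_simps)
    then have eq: "density lborel (\<lambda>x. ennreal (q t x)) = (?N \<star> ?N)" using qd[OF t] qd[OF t2] by simp
    have conv: "q t x = (\<integral>v. q (t / 2) (x - v) \<partial>?N)" for x
      by (rule continuous_density_of_convolution[OF qc'[OF t2] qnn[OF t2] B qdist[OF t2] qdist[OF t2] qc'[OF t] qnn[OF t] eq])
    have mgf: "(\<integral>\<^sup>+x. ennreal (exp (2 * x)) \<partial>?N) \<le> ennreal ?K"
      using M(4)[OF zero_less_one t2, of 2] qd[OF t2] by simp
    have "q t x \<le> 2 * B * ?K * exp (- x)" for x
      by (rule light_tail_of_selfconvolution[OF qm[OF t2] qnn[OF t2] B mgf exp_ge_zero qdist[OF t2] conv])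
    then show ?thesis by blast
  qed
  have qconv: "p t x = (\<integral>v. q t (x - v) \<partial>P 1 t)" if t: "0 < t" for t x
  proof -
    obtain B where B: "\<And>x. q t x \<le> B" using qb[OF t] by blast
    have "density lborel (\<lambda>x. ennreal (p t x)) = (density lborel (\<lambda>x. ennreal (q t x)) \<star> P 1 t)"
      using factor[OF zero_less_one t] qd[OF t] by simp
    then show ?thesis
      by (rule continuous_density_of_convolution[OF qc'[OF t] qnn[OF t] B qdist[OF t] P(1)[OF zero_less_one t] pc[OF t] pnn[OF t]])
  qed
  have Msmall: "\<exists>\<epsilon>>0. measure (M \<epsilon> t) {\<delta><..} \<le> \<eta>" if \<delta>: "0 < \<delta>" and \<eta>: "0 < \<eta>" and t: "0 < t" for \<delta> \<eta> t
  proof -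
    \<comment> \<open>With exponential moment \<open>exp 1\<close> of order \<open>a\<close>, Markov's inequality bounds the tail by \<open>exp (1 - a * \<delta>) \<le> \<eta>\<close>.\<close>
    define a where "a = max 0 ((1 - ln \<eta>) / \<delta>)"
    have a: "0 \<le> a" by (simp add: a_def)
    have "(1 - ln \<eta>) / \<delta> \<le> a" by (simp add: a_def)
    then have "1 - ln \<eta> \<le> a * \<delta>" using \<delta> by (simp add: pos_divide_le_eq)
    then have "exp (1 - a * \<delta>) \<le> exp (ln \<eta>)" by simp
    then have small: "exp 1 * exp (- a * \<delta>) \<le> \<eta>" using \<eta> by (simp add: exp_add[symmetric])
    obtain \<epsilon> where \<epsilon>: "0 < \<epsilon>" "exp_rate a \<epsilon> \<le> ennreal (1 / t)"
      using exp_rate_small[OF a, of "1 / t"] t by auto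
    have "enn2real (exp_rate a \<epsilon>) \<le> 1 / t" using \<epsilon> t by (intro enn2real_leI) auto
    then have "t * enn2real (exp_rate a \<epsilon>) \<le> 1" using t by (simp add: field_simps)
    then have "(\<integral>\<^sup>+x. ennreal (exp (a * x)) \<partial>M \<epsilon> t) \<le> ennreal (exp 1)"
      using M(4)[OF \<epsilon>(1) t a] by (auto intro: order_trans ennreal_leI)
    then have "measure (M \<epsilon> t) {\<delta><..} \<le> exp 1 * exp (- a * \<delta>)"
      by (intro exp_moment_tail[OF M(1)[OF \<epsilon>(1) t] a]) auto
    then show ?thesis using \<epsilon>(1) small by (intro exI[of _ \<epsilon>]) auto
  qed
  have "id_density_semigroup p P M (\<lambda>\<epsilon>. measure \<nu> {\<epsilon><..}) q"
  proof (intro id_density_semigroup.intro density_semigroup.intro id_density_semigroup_axioms.intro)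
    show "P \<epsilon> (s + t) = (P \<epsilon> s \<star> P \<epsilon> t)" if "0 < \<epsilon>" "0 < s" "0 < t" for \<epsilon> s t
      using that P by (intro convolution_eqI_char) (auto simp: exp_add[symmetric] algebra_simps)
    show "measure (M \<epsilon> t) {..<0} = 0" if "0 < \<epsilon>" "0 < t" for \<epsilon> t
      using M(3)[OF that] by (simp add: measure_def)
  qed (rule half pc pconv pb P(1) P(3) M(1) Msmall factor qc qnn qneg qlight qconv; assumption)+
  then show ?thesis by blast
qed

end

theorem corollary1p2:
  fixes \<mu> \<nu> :: "real measure"
    and \<mu>_pow :: "real \<Rightarrow> real measure"
    and p :: "real \<Rightarrow> real \<Rightarrow> real"
  assumes "id_dist_nonneg \<mu> 0 \<nu>"
    and "\<forall>c>0. emeasure \<nu> {c<..} > 0"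
    and "\<forall>t>0. (\<integral>\<^sup>+z. ennreal (cmod (char \<mu> z) powr t) \<partial>lborel) < \<infinity>"
    and "\<forall>t>0. is_conv_power 0 \<nu> t (\<mu>_pow t)"
    and "\<forall>t>0. is_continuous_density (p t) (\<mu>_pow t)"
  shows "((\<exists>t>0. subexp_density (p t)) \<longrightarrow>
            (\<forall>t>0. subexp_density (p t)) \<and>
            (\<forall>t>0. tail_equiv (p t) (\<lambda>x. t * p 1 x)))
       \<and> (\<forall>t C. long_tailed_density (p 1) \<and> t \<in> {0<..<1} \<union> {1<..} \<and> 0 < C \<and>
                 tail_equiv (p t) (\<lambda>x. C * p 1 x) \<longrightarrow>
            C = t \<and> subexp_density (p 1))"
proof -
  interpret levy_measure \<nu>
    using assms(1) by unfold_locales (simp add: id_dist_nonneg_def)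
  have pow: "id_dist_nonneg (\<mu>_pow t) 0 (scale_measure (ennreal t) \<nu>)" if "0 < t" for t
    using assms(4) that by (simp add: is_conv_power_def)
  have \<mu>: "char \<mu> z = exp (part_exponent {0<..} z)" for z
    using assms(1) by (simp add: id_dist_nonneg_def part_exponent_pos)
  have int: "integrable lborel (char (\<mu>_pow t))" if t: "0 < t" for t
  proof (rule integrableI_bounded)
    interpret D: real_distribution "\<mu>_pow t" by (rule char_id_dist(1)[OF pow[OF t]]) (use t in simp)
    show "char (\<mu>_pow t) \<in> borel_measurable lborel" by simp
    have "norm (char (\<mu>_pow t) z) = cmod (char \<mu> z) powr t" for z
      unfolding \<mu> using char_id_dist(2)[OF pow[OF t], of z] t by (simp add: norm_exp_eq_Re powr_def)
    then show "(\<integral>\<^sup>+z. ennreal (norm (char (\<mu>_pow t) z)) \<partial>lborel) < \<infinity>" using assms(3) t by simp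
  qed
  obtain P M rate q where "id_density_semigroup p P M rate q"
    using id_density_semigroup_exists[OF pow int] assms(5) by blast
  then interpret S: id_density_semigroup p P M rate q .
  show ?thesis
  proof (intro conjI impI allI)
    fix t assume "\<exists>t>0. subexp_density (p t)" "0 < (t :: real)"
    then show "subexp_density (p t)" using S.subexp_density_all_times(1) by blast
  next
    fix t assume "\<exists>t>0. subexp_density (p t)" "0 < (t :: real)"
    then show "tail_equiv (p t) (\<lambda>x. t * p 1 x)" using S.subexp_density_all_times(2) by blast
  next
    fix t C
    assume *: "long_tailed_density (p 1) \<and> t \<in> {0<..<1} \<union> {1<..} \<and> 0 < C \<and> tail_equiv (p t) (\<lambda>x. C * p 1 x)"
    then have t: "0 < t" "t \<noteq> 1" by auto
    show "C = t" "subexp_density (p 1)" using * S.tail_ratio_at_one[OF _ t] by blast+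
  qed
qed

end
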